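(* Let $\mathbf{k}$ be a field, $R=\mathbf{k}[s,u,t,v]$ the bigraded coordinate ring of $\mathbf{P}^1\times\mathbf{P}^1$, and let $I=\langle f_1,f_2,f_3\rangle\subset R$, where $f_i$ is bihomogeneous of bidegree $(d_i,d_i')$ for $i=1,2,3$. Suppose that $I$ has codimension two in $R$. Let $K\subset\bigoplus_{i=1}^3R(-d_i,-d_i')$ be the module of Koszul syzygies on $f_1,f_2,f_3$, and $V\subset\bigoplus_{i=1}^3R(-d_i,-d_i')$ the module of syzygies on $f_1,f_2,f_3$ vanishing at the base points of $I$. Then the following are equivalent: (1) $K_{k,k'}=V_{k,k'}$, as subspaces of $\bigoplus_{i=1}^3R(-d_i,-d_i')_{k,k'}$, for all $(k,k')$ with $\left(k-\sum_{i=1}^3d_i+1\right)\left(k'-\sum_{i=1}^3d_i'+1\right)\ge 0$; (2) $I$ is a local complete intersection.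
   Context: The ring $R=\mathbf{k}[s,u,t,v]$ is bigraded with $s,u$ of bidegree $(1,0)$ and $t,v$ of bidegree $(0,1)$; $\mathbf{m}=\langle st,sv,ut,uv\rangle$ is the irrelevant ideal. $Z=\mathbb{V}(I)\subset\mathbf{P}^1\times\mathbf{P}^1$ is the base point locus (it is finite when $I$ has codimension two), and $\mathcal{I}$ is the ideal sheaf on $\mathbf{P}^1\times\mathbf{P}^1$ defined by $I$. For a bigraded module $M$, $M_{k,k'}$ is its piece of bidegree $(k,k')\in\mathbb{Z}^2$, and $R(-d,-d')_{k,k'}=R_{k-d,k'-d'}$. $I^{\mathrm{sat}}=\{r\in R:\mathbf{m}^jr\subset I\text{ for some }j\}$. $K$ is the submodule of $\bigoplus_{i=1}^3R(-d_i,-d_i')$ generated by the columns $(f_2,-f_1,0)^T$, $(f_3,0,-f_1)^T$, $(0,f_3,-f_2)^T$. $V$ is the set of $(a_1,a_2,a_3)\in\bigoplus_{i=1}^3R(-d_i,-d_i')$ with $a_1f_1+a_2f_2+a_3f_3=0$ and $a_i\in I^{\mathrm{sat}}$ for $i=1,2,3$. $I$ is a local complete intersection (LCI) if for every point $p\in Z$ the stalk $\mathcal{I}_p\subset\mathcal{O}_{\mathbf{P}^1\times\mathbf{P}^1,p}$ is generated by a regular sequence. *)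

theory Defs
  imports
    "HOL-Library.Poly_Mapping"
    "HOL-Library.Extended_Nat"
    "HOL-Library.Product_Plus"
    "HOL-Computational_Algebra.Fraction_Field"
begin

section \<open>The bigraded coordinate ring of P1 x P1\<close>

datatype bivar = Var_s | Var_u | Var_t | Var_v

text \<open>The order on the variables carries no meaning: the library proves that the polynomial ring
  is an integral domain only for linearly ordered variables.\<close>

primrec bivar_index :: "bivar \<Rightarrow> nat" where
  "bivar_index Var_s = 0"
| "bivar_index Var_u = 1"
| "bivar_index Var_t = 2"
| "bivar_index Var_v = 3"

lemma bivar_index_inject: "bivar_index x = bivar_index y \<Longrightarrow> x = y"
  by (cases x; cases y) simp_all

instantiation bivar :: linorder
begin

definition less_eq_bivar :: "bivar \<Rightarrow> bivar \<Rightarrow> bool" where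
  "x \<le> y \<longleftrightarrow> bivar_index x \<le> bivar_index y"

definition less_bivar :: "bivar \<Rightarrow> bivar \<Rightarrow> bool" where
  "x < y \<longleftrightarrow> bivar_index x < bivar_index y"

instance
  by standard (auto simp: less_eq_bivar_def less_bivar_def dest: bivar_index_inject order.antisym)

end

type_synonym 'k bipoly = "(bivar \<Rightarrow>\<^sub>0 nat) \<Rightarrow>\<^sub>0 'k"

definition var :: "bivar \<Rightarrow> 'k::field bipoly" where
  "var x = Poly_Mapping.single (Poly_Mapping.single x 1) 1"

definition bidegree :: "(bivar \<Rightarrow>\<^sub>0 nat) \<Rightarrow> int \<times> int" where
  "bidegree e =
    (int (Poly_Mapping.lookup e Var_s + Poly_Mapping.lookup e Var_u),
     int (Poly_Mapping.lookup e Var_t + Poly_Mapping.lookup e Var_v))"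

text \<open>The graded piece of bidegree \<open>(k, k')\<close> of the ring; it contains 0 for every bidegree and is
  \<open>{0}\<close> if \<open>k < 0\<close> or \<open>k' < 0\<close>.\<close>

definition bihom :: "int \<Rightarrow> int \<Rightarrow> 'k::field bipoly set" where
  "bihom k k' = {f. \<forall>e \<in> Poly_Mapping.keys f. bidegree e = (k, k')}"


section \<open>Ideals\<close>

text \<open>Ideals of a commutative ring are the submodules of the ring, regarded as a module over
  itself.\<close>

global_interpretation ideal: module "(*) :: 'a::comm_ring_1 \<Rightarrow> 'a \<Rightarrow> 'a"
  by standard (simp_all only: distrib_left distrib_right mult.assoc mult_1_left)

definition prime_ideal :: "'a::comm_ring_1 set \<Rightarrow> bool" where
  "prime_ideal P \<longleftrightarrow> ideal.subspace P \<and> P \<noteq> UNIV \<and> (\<forall>a b. a * b \<in> P \<longrightarrow> a \<in> P \<or> b \<in> P)"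

definition height :: "'a::comm_ring_1 set \<Rightarrow> enat" where
  "height P = Sup {enat n |n. \<exists>C :: nat \<Rightarrow> 'a set.
     (\<forall>i\<le>n. prime_ideal (C i)) \<and> (\<forall>i<n. C i \<subset> C (Suc i)) \<and> C n = P}"

text \<open>The unit ideal has codimension \<open>\<infinity>\<close>.\<close>

definition codimension :: "'a::comm_ring_1 set \<Rightarrow> enat" where
  "codimension I = Inf {height P |P. prime_ideal P \<and> I \<subseteq> P}"

primrec ideal_power :: "'a::comm_ring_1 set \<Rightarrow> nat \<Rightarrow> 'a set" where
  "ideal_power I 0 = UNIV"
| "ideal_power I (Suc j) = ideal.span {a * b |a b. a \<in> I \<and> b \<in> ideal_power I j}"

definition irrelevant_ideal :: "'k::field bipoly set" where
  "irrelevant_ideal = ideal.span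
     {var Var_s * var Var_t, var Var_s * var Var_v, var Var_u * var Var_t, var Var_u * var Var_v}"

definition saturation :: "'k::field bipoly set \<Rightarrow> 'k bipoly set" where
  "saturation I = {r. \<exists>j. \<forall>a \<in> ideal_power irrelevant_ideal j. a * r \<in> I}"


section \<open>Syzygies\<close>

text \<open>The direct sum of three copies of the ring is the type of triples.\<close>

type_synonym 'k bipoly3 = "'k bipoly \<times> 'k bipoly \<times> 'k bipoly"

definition scale3 :: "'k::field bipoly \<Rightarrow> 'k bipoly3 \<Rightarrow> 'k bipoly3" where
  "scale3 r = (\<lambda>(a1, a2, a3). (r * a1, r * a2, r * a3))"

global_interpretation free3: module "scale3 :: 'k::field bipoly \<Rightarrow> 'k bipoly3 \<Rightarrow> 'k bipoly3"
  by (standard; (unfold split_paired_all)?)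
    (simp_all only: scale3_def prod.case add_Pair distrib_left distrib_right mult.assoc mult_1_left)

text \<open>The piece of bidegree \<open>(k, k')\<close> of the direct sum of the twists \<open>R(-d\<^sub>i, -d\<^sub>i')\<close>. The twists
  only affect the grading; the piece of a bigraded submodule is its intersection with this set.\<close>

definition twisted_piece ::
  "int \<times> int \<Rightarrow> int \<times> int \<Rightarrow> int \<times> int \<Rightarrow> int \<Rightarrow> int \<Rightarrow> 'k::field bipoly3 set" where
  "twisted_piece = (\<lambda>(d1, d1') (d2, d2') (d3, d3') k k'.
     bihom (k - d1) (k' - d1') \<times> bihom (k - d2) (k' - d2') \<times> bihom (k - d3) (k' - d3'))"

definition koszul_syzygies ::
  "'k::field bipoly \<Rightarrow> 'k bipoly \<Rightarrow> 'k bipoly \<Rightarrow> 'k bipoly3 set" where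
  "koszul_syzygies f1 f2 f3 = free3.span {(f2, - f1, 0), (f3, 0, - f1), (0, f3, - f2)}"

definition vanishing_syzygies ::
  "'k::field bipoly \<Rightarrow> 'k bipoly \<Rightarrow> 'k bipoly \<Rightarrow> 'k bipoly3 set" where
  "vanishing_syzygies f1 f2 f3 =
     (let J = saturation (ideal.span {f1, f2, f3}) in
      {(a1, a2, a3). a1 * f1 + a2 * f2 + a3 * f3 = 0 \<and> a1 \<in> J \<and> a2 \<in> J \<and> a3 \<in> J})"


section \<open>Local complete intersections in P1 x P1\<close>

text \<open>The points of P1 x P1, as a scheme over an arbitrary field, are the prime ideals that are
  generated by bihomogeneous elements and do not contain the irrelevant ideal.\<close>

definition bihom_ideal :: "'k::field bipoly set \<Rightarrow> bool" where
  "bihom_ideal P \<longleftrightarrow> P = ideal.span (P \<inter> (\<Union>k k'. bihom k k'))"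

definition points :: "'k::field bipoly set set" where
  "points = {P. prime_ideal P \<and> bihom_ideal P \<and> \<not> irrelevant_ideal \<subseteq> P}"

definition base_points :: "'k::field bipoly set \<Rightarrow> 'k bipoly set set" where
  "base_points I = {P \<in> points. I \<subseteq> P}"

text \<open>The stalk at a point \<open>P\<close> of the ideal sheaf defined by \<open>I\<close> is the part of bidegree \<open>(0, 0)\<close> of
  the localization of \<open>I\<close> at the bihomogeneous elements outside \<open>P\<close>. As the ring is a domain,
  the stalks are subsets of its fraction field. The structure sheaf is the case \<open>I = UNIV\<close>.\<close>

definition ideal_sheaf_stalk ::
  "'k::field bipoly set \<Rightarrow> 'k bipoly set \<Rightarrow> 'k bipoly fract set" where
  "ideal_sheaf_stalk I P =
     {Fract a b |a b. \<exists>k k'. a \<in> I \<inter> bihom k k' \<and> b \<in> bihom k k' - P}"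

abbreviation structure_stalk :: "'k::field bipoly set \<Rightarrow> 'k bipoly fract set" where
  "structure_stalk \<equiv> ideal_sheaf_stalk UNIV"

text \<open>In the next two definitions \<open>A\<close> is a subring of the ambient ring, and all notions are
  relative to \<open>A\<close>.\<close>

definition generated_ideal :: "'a::comm_ring_1 set \<Rightarrow> 'a list \<Rightarrow> 'a set" where
  "generated_ideal A xs =
     {(\<Sum>i<length xs. c i * xs ! i) |c. \<forall>i<length xs. c i \<in> A}"

definition regular_sequence :: "'a::comm_ring_1 set \<Rightarrow> 'a list \<Rightarrow> bool" where
  "regular_sequence A xs \<longleftrightarrow>
     set xs \<subseteq> A \<and>
     (\<forall>i<length xs. \<forall>a\<in>A. a * xs ! i \<in> generated_ideal A (take i xs) \<longrightarrow>
        a \<in> generated_ideal A (take i xs)) \<and>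
     generated_ideal A xs \<noteq> A"

definition local_complete_intersection :: "'k::field bipoly set \<Rightarrow> bool" where
  "local_complete_intersection I \<longleftrightarrow>
     (\<forall>P \<in> base_points I. \<exists>xs. regular_sequence (structure_stalk P) xs \<and>
        ideal_sheaf_stalk I P = generated_ideal (structure_stalk P) xs)"

end

theory Submission
  imports Defs "Berlekamp_Zassenhaus.Unique_Factorization_Poly"
begin

text \<open>
  Let \<open>I\<close> be the ideal of \<open>f1, f2, f3\<close>. Codimension two means that no prime element divides all three
  generators (\<open>codimension_two_no_common_prime\<close>). The ring is factorial, so a rational function that
  multiplies \<open>I\<close> into the ring, or into one of its local rings, already lies there (\<open>localization_normal\<close>), and
  the Koszul complex is exact in the middle (\<open>koszul_kernel\<close>).

  Suppose that \<open>I\<close> is a local complete intersection. If an ideal is generated by a regular sequence, then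
  with respect to any generators every syzygy with coefficients in the ideal is Koszul
  (\<open>syzygies_with_coefficients_in_ideal\<close>). A syzygy \<open>v\<close> that vanishes at the base points is therefore Koszul
  near every base point, and near the other points every syzygy is Koszul. Hence a power of the irrelevant
  ideal multiplies \<open>v\<close> into the Koszul syzygies (\<open>koszul_after_variable_power\<close>). By the resolution
  \<open>0 \<rightarrow> R(-\<Sum>d) \<rightarrow> \<Oplus>R(-d\<^sub>i - d\<^sub>j) \<rightarrow> K \<rightarrow> 0\<close> the obstruction to \<open>v\<close> being Koszul lies in the first cohomology
  of the line bundle of bidegree \<open>(k - \<Sum>d, k' - \<Sum>d')\<close>, and this group vanishes under the sign condition
  (\<open>koszul_saturated\<close>).

  Conversely, equality in all large bidegrees says that near every base point all syzygies with coefficients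
  in \<open>I\<close> are Koszul, that is, that the second symmetric power of \<open>I\<close> is \<open>I\<^sup>2\<close> there. Over the local ring
  of a point on a regular surface an ideal without common factor that needs three generators does not have this
  property: its syzygies and the symmetric power would give a minimal free resolution of \<open>I\<^sup>2\<close> of length two,
  whereas \<open>I\<^sup>2\<close> is torsion free and so has projective dimension at most one. The lemma
  \<open>not_all_koszul_reducible\<close> is this argument, and \<open>generator_redundant\<close>, which rests on the socle of a
  complete intersection, provides the minimality. So two of the generators suffice at each base point, and they
  form a regular sequence (\<open>complete_intersection_of_redundant\<close>).

  The local rings enter through two parameters and the fact that two elements without a common prime
  generate an ideal that contains powers of both. At a closed point of the surface this follows from
  factoriality and pseudo-division (\<open>local_parameters_nested\<close>), once the bigraded ring is written as an
  iterated ring of univariate polynomials.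
\<close>

(* For the ring as a module over itself this rule is associativity read from right to left; as a
  rewrite rule it would run in a circle with mult.assoc. *)
declare ideal.scale_scale [simp del]

section \<open>Bihomogeneous components\<close>

definition component :: "int \<times> int \<Rightarrow> 'k::field bipoly \<Rightarrow> 'k bipoly" where
  "component d f = Poly_Mapping.mapp (\<lambda>e c. c when bidegree e = d) f"

lemma lookup_component:
  "Poly_Mapping.lookup (component d f) e = (Poly_Mapping.lookup f e when bidegree e = d)"
  unfolding component_def by (auto simp: lookup_mapp when_def in_keys_iff)

lemma component_add: "component d (f + g) = component d f + component d g"
  by (rule poly_mapping_eqI) (simp add: lookup_component lookup_add when_add_distrib)

lemma component_0 [simp]: "component d 0 = 0"
  by (rule poly_mapping_eqI) (simp add: lookup_component)

lemma component_uminus: "component d (- f) = - component d f"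
  by (rule poly_mapping_eqI) (simp add: lookup_component when_uminus_distrib)

lemma component_sum: "component d (sum f A) = (\<Sum>a\<in>A. component d (f a))"
  by (induction A rule: infinite_finite_induct) (simp_all add: component_add)

lemma bihom_iff:
  "f \<in> bihom k k' \<longleftrightarrow> (\<forall>e. Poly_Mapping.lookup f e \<noteq> 0 \<longrightarrow> bidegree e = (k, k'))"
  by (auto simp: bihom_def in_keys_iff)

lemma component_in_bihom [simp]: "component (k, k') f \<in> bihom k k'"
  by (auto simp: bihom_iff lookup_component when_def)

lemma component_bihom: "f \<in> bihom k k' \<Longrightarrow> component (k, k') f = f"
  by (rule poly_mapping_eqI) (auto simp: lookup_component when_def bihom_iff)

lemma component_bihom_other: "f \<in> bihom k k' \<Longrightarrow> d \<noteq> (k, k') \<Longrightarrow> component d f = 0"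
  by (rule poly_mapping_eqI) (auto simp: lookup_component when_def bihom_iff)

lemma sum_component:
  assumes "finite D" "bidegree ` Poly_Mapping.keys f \<subseteq> D"
  shows "(\<Sum>d\<in>D. component d f) = f"
proof (rule poly_mapping_eqI)
  fix e
  show "Poly_Mapping.lookup (\<Sum>d\<in>D. component d f) e = Poly_Mapping.lookup f e"
  proof (cases "e \<in> Poly_Mapping.keys f")
    case True
    then have "bidegree e \<in> D" using assms by auto
    then show ?thesis using assms(1)
      by (simp add: lookup_sum lookup_component when_def sum.delta')
  next
    case False
    then show ?thesis by (simp add: lookup_sum lookup_component in_keys_iff)
  qed
qed

lemma bihom_0 [simp]: "0 \<in> bihom k k'"
  by (simp add: bihom_def)

lemma bihom_add: "f \<in> bihom k k' \<Longrightarrow> g \<in> bihom k k' \<Longrightarrow> f + g \<in> bihom k k'"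
  by (auto simp: bihom_iff lookup_add) (metis add_cancel_left_left)

lemma bihom_uminus: "f \<in> bihom k k' \<Longrightarrow> - f \<in> bihom k k'"
  by (auto simp: bihom_iff)

lemma bihom_diff: "f \<in> bihom k k' \<Longrightarrow> g \<in> bihom k k' \<Longrightarrow> f - g \<in> bihom k k'"
  using bihom_add[of f k k' "- g"] bihom_uminus[of g] by simp

lemma bidegree_add: "bidegree (e + e') = bidegree e + bidegree e'"
  by (simp add: bidegree_def lookup_add)

lemma bihom_mult:
  assumes "f \<in> bihom k k'" "g \<in> bihom l l'"
  shows "f * g \<in> bihom (k + l) (k' + l')"
  using assms keys_mult[of f g] by (fastforce simp: bihom_def bidegree_add)

lemma bihom_1 [simp]: "1 \<in> bihom 0 0"
  by (auto simp: bihom_iff lookup_one when_def bidegree_def)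

lemma bihom_power: "f \<in> bihom k k' \<Longrightarrow> f ^ n \<in> bihom (int n * k) (int n * k')"
proof (induction n)
  case (Suc n)
  then have "f * f ^ n \<in> bihom (k + int n * k) (k' + int n * k')" by (intro bihom_mult) auto
  then show ?case by (simp add: algebra_simps)
qed simp

lemma bihom_negative: "f \<in> bihom k k' \<Longrightarrow> k < 0 \<or> k' < 0 \<Longrightarrow> f = 0"
  by (rule poly_mapping_eqI) (auto simp: bihom_iff bidegree_def)

lemma component_mult_bihom:
  assumes "g \<in> bihom l l'"
  shows "component (k, k') (g * f) = g * component (k - l, k' - l') f"
proof -
  let ?D = "insert (k - l, k' - l') (bidegree ` Poly_Mapping.keys f)"
  have "g * f = (\<Sum>d\<in>?D. g * component d f)"
    by (subst sum_distrib_left[symmetric]) (subst sum_component, auto)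
  then have "component (k, k') (g * f) = (\<Sum>d\<in>?D. component (k, k') (g * component d f))"
    by (simp add: component_sum)
  also have "\<dots> = (\<Sum>d\<in>?D. if d = (k - l, k' - l') then g * component d f else 0)"
  proof (rule sum.cong[OF refl])
    fix d assume "d \<in> ?D"
    obtain m m' where d: "d = (m, m')" by (cases d)
    have h: "g * component d f \<in> bihom (l + m) (l' + m')"
      unfolding d by (rule bihom_mult[OF assms component_in_bihom])
    show "component (k, k') (g * component d f) = (if d = (k - l, k' - l') then g * component d f else 0)"
    proof (cases "d = (k - l, k' - l')")
      case True
      then show ?thesis using component_bihom[OF h] d by auto
    next
      case False
      then show ?thesis using component_bihom_other[OF h, of "(k, k')"] d by auto
    qed
  qed
  also have "\<dots> = g * component (k - l, k' - l') f" by simp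
  finally show ?thesis .
qed

definition bidegrees :: "'k::field bipoly \<Rightarrow> (int \<times> int) set" where
  "bidegrees f = bidegree ` Poly_Mapping.keys f"

lemma finite_bidegrees [simp]: "finite (bidegrees f)"
  by (simp add: bidegrees_def)

lemma sum_component_bidegrees: "(\<Sum>d\<in>bidegrees f. component d f) = f"
  by (rule sum_component) (auto simp: bidegrees_def)

lemma component_eq_0: "d \<notin> bidegrees f \<Longrightarrow> component d f = 0"
  by (rule poly_mapping_eqI) (auto simp: lookup_component bidegrees_def when_def in_keys_iff)


section \<open>Homogeneous ideals\<close>

lemma idealI:
  assumes "0 \<in> J" "\<And>a b. a \<in> J \<Longrightarrow> b \<in> J \<Longrightarrow> a + b \<in> J" "\<And>r a. a \<in> J \<Longrightarrow> r * a \<in> J"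
  shows "ideal.subspace J"
  using assms by (auto simp: ideal.subspace_def)

lemma ideal_mult_left: "ideal.subspace J \<Longrightarrow> a \<in> J \<Longrightarrow> r * a \<in> J"
  using ideal.subspace_scale .

lemma ideal_mult_right: "ideal.subspace J \<Longrightarrow> a \<in> J \<Longrightarrow> a * r \<in> J"
  using ideal.subspace_scale[of J a r] by (simp add: mult.commute)

lemma mem_span3:
  fixes f1 f2 f3 :: "'a::comm_ring_1"
  shows "a \<in> ideal.span {f1, f2, f3} \<longleftrightarrow> (\<exists>r1 r2 r3. a = r1 * f1 + r2 * f2 + r3 * f3)"
proof -
  have "a \<in> ideal.span {f1, f2, f3} \<longleftrightarrow> (\<exists>r1 r2 r3. a - r1 * f1 - r2 * f2 = r3 * f3)"
    by (auto simp: ideal.span_insert[of f1] ideal.span_insert[of f2] ideal.span_singleton)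
  also have "\<dots> \<longleftrightarrow> (\<exists>r1 r2 r3. a = r1 * f1 + r2 * f2 + r3 * f3)"
    by (intro ex_cong1) (auto simp: algebra_simps)
  finally show ?thesis .
qed

definition homogeneous :: "'k::field bipoly set \<Rightarrow> bool" where
  "homogeneous J \<longleftrightarrow> (\<forall>a\<in>J. \<forall>d. component d a \<in> J)"

lemma homogeneousD: "homogeneous J \<Longrightarrow> a \<in> J \<Longrightarrow> component d a \<in> J"
  unfolding homogeneous_def by (drule (1) bspec) (erule spec)

lemma homogeneous_span:
  assumes "S \<subseteq> (\<Union>k k'. bihom k k')"
  shows "homogeneous (ideal.span S)"
  unfolding homogeneous_def
proof (intro ballI allI)
  fix a d assume "a \<in> ideal.span S"
  then show "component d a \<in> ideal.span S"
  proof (induction rule: ideal.span_induct_alt)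
    case base
    then show ?case by (simp add: ideal.span_zero)
  next
    case (step c x y)
    obtain k k' where x: "x \<in> bihom k k'" using assms step(1) by auto
    obtain l l' where d: "d = (l, l')" by (cases d)
    have "component d (c * x) = component (l - k, l' - k') c * x"
      using component_mult_bihom[OF x, of l l' c] d by (simp add: mult.commute)
    then show ?case
      using step by (simp add: component_add ideal.span_add ideal.span_scale ideal.span_base)
  qed
qed

lemma bihom_ideal_iff_homogeneous:
  assumes "ideal.subspace J"
  shows "bihom_ideal J \<longleftrightarrow> homogeneous J"
proof
  assume "bihom_ideal J"
  then show "homogeneous J"
    using homogeneous_span[of "J \<inter> (\<Union>k k'. bihom k k')"] unfolding bihom_ideal_def by auto
next
  assume h: "homogeneous J"
  have "a \<in> ideal.span (J \<inter> (\<Union>k k'. bihom k k'))" if "a \<in> J" for a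
  proof -
    have "(\<Sum>d\<in>bidegrees a. component d a) \<in> ideal.span (J \<inter> (\<Union>k k'. bihom k k'))"
    proof (rule ideal.span_sum, rule ideal.span_base)
      fix d assume "d \<in> bidegrees a"
      show "component d a \<in> J \<inter> (\<Union>k k'. bihom k k')"
      proof
        show "component d a \<in> J" using h that by (rule homogeneousD)
        show "component d a \<in> (\<Union>k k'. bihom k k')"
          by (cases d) (use component_in_bihom in blast)
      qed
    qed
    then show ?thesis by (simp add: sum_component_bidegrees)
  qed
  moreover have "ideal.span (J \<inter> (\<Union>k k'. bihom k k')) \<subseteq> J"
    using assms by (intro ideal.span_minimal) auto
  ultimately show "bihom_ideal J" unfolding bihom_ideal_def by auto
qed

lemma homogeneous_not_mem:
  assumes "ideal.subspace J" "c \<notin> J"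
  shows "\<exists>d. component d c \<notin> J"
proof (rule ccontr)
  assume "\<not> ?thesis"
  then have "(\<Sum>d\<in>bidegrees c. component d c) \<in> J"
    using assms by (intro ideal.subspace_sum) auto
  then show False using assms by (simp add: sum_component_bidegrees)
qed

lemma max_pair:
  fixes D :: "(int \<times> int) set"
  assumes "finite D" "D \<noteq> {}"
  shows "\<exists>k k'. (k, k') \<in> D \<and> (\<forall>(l, l')\<in>D. l < k \<or> l = k \<and> l' \<le> k')"
proof -
  define k where "k = Max (fst ` D)"
  have k: "k \<in> fst ` D" "\<And>d. d \<in> D \<Longrightarrow> fst d \<le> k"
    using assms by (auto simp: k_def)
  define E where "E = snd ` {d \<in> D. fst d = k}"
  have E: "finite E" "E \<noteq> {}" using assms k by (auto simp: E_def)
  have "Max E \<in> E" using E by simp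
  then have "(k, Max E) \<in> D" by (auto simp: E_def)
  moreover have "l < k \<or> l = k \<and> l' \<le> Max E" if "(l, l') \<in> D" for l l'
  proof -
    have "l' \<in> E" if "l = k" using that \<open>(l, l') \<in> D\<close> by (force simp: E_def)
    then show ?thesis using k(2)[OF that] E(1) by auto
  qed
  ultimately show ?thesis by (intro exI[of _ k] exI[of _ "Max E"]) auto
qed

text \<open>Take the lexicographically largest components of \<open>a\<close> and of \<open>b\<close> among those outside of \<open>P\<close>. Modulo
  \<open>P\<close>, their product is the component of \<open>a * b\<close> in the sum of the two bidegrees.\<close>

lemma prime_ideal_of_homogeneous:
  fixes P :: "'k::field bipoly set"
  assumes P: "ideal.subspace P" "homogeneous P" "P \<noteq> UNIV"
    and prime: "\<And>k k' l l' a b. a \<in> bihom k k' \<Longrightarrow> b \<in> bihom l l' \<Longrightarrow> a * b \<in> P \<Longrightarrow> a \<in> P \<or> b \<in> P"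
  shows "prime_ideal P"
  unfolding prime_ideal_def
proof (intro conjI allI impI)
  fix a b assume ab: "a * b \<in> P"
  show "a \<in> P \<or> b \<in> P"
  proof (rule ccontr)
    assume "\<not> (a \<in> P \<or> b \<in> P)"
    then have na: "a \<notin> P" and nb: "b \<notin> P" by auto
    define D where "D c = {d \<in> bidegrees c. component d c \<notin> P}" for c
    have fD: "finite (D c)" for c by (simp add: D_def)
    have D_ne: "D c \<noteq> {}" if c: "c \<notin> P" for c
    proof -
      obtain d where "component d c \<notin> P" using homogeneous_not_mem[OF P(1) c] by blast
      moreover have "d \<in> bidegrees c"
        using calculation component_eq_0[of d c] ideal.subspace_0[OF P(1)] by metis
      ultimately have "d \<in> D c" by (simp add: D_def)
      then show ?thesis by blast
    qed
    obtain k k' where k: "(k, k') \<in> D a" "\<forall>(l, l')\<in>D a. l < k \<or> l = k \<and> l' \<le> k'"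
      using max_pair[OF fD D_ne[OF na]] by auto
    obtain m m' where m: "(m, m') \<in> D b" "\<forall>(l, l')\<in>D b. l < m \<or> l = m \<and> l' \<le> m'"
      using max_pair[OF fD D_ne[OF nb]] by auto
    have memP: "component d c \<in> P" if "d \<notin> D c" for c d
      using that component_eq_0[of d c] ideal.subspace_0[OF P(1)] by (auto simp: D_def)
    have other: "component (k + m - fst d, k' + m' - snd d) b \<in> P"
      if "d \<in> D a" "d \<noteq> (k, k')" for d
    proof (rule memP)
      obtain l l' where d: "d = (l, l')" by (cases d)
      have *: "l < k \<or> l = k \<and> l' < k'" using bspec[OF k(2) that(1)] that(2) d by auto
      show "(k + m - fst d, k' + m' - snd d) \<notin> D b"
      proof
        assume "(k + m - fst d, k' + m' - snd d) \<in> D b"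
        then have "k + m - l < m \<or> k + m - l = m \<and> k' + m' - l' \<le> m'" using bspec[OF m(2), of "(k + m - l, k' + m' - l')"] d by simp
        then show False using * by auto
      qed
    qed
    have "component (k + m, k' + m') (a * b)
        = (\<Sum>d\<in>bidegrees a. component (k + m, k' + m') (component d a * b))"
      by (subst (1) sum_component_bidegrees[of a, symmetric])
         (simp add: sum_distrib_right component_sum)
    also have "\<dots> = (\<Sum>d\<in>bidegrees a. component d a * component (k + m - fst d, k' + m' - snd d) b)"
    proof (rule sum.cong[OF refl])
      fix d assume "d \<in> bidegrees a"
      show "component (k + m, k' + m') (component d a * b)
          = component d a * component (k + m - fst d, k' + m' - snd d) b"
        by (cases d) (simp add: component_mult_bihom[OF component_in_bihom])
    qed
    also have "\<dots> = component (k, k') a * component (m, m') b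
        + (\<Sum>d\<in>bidegrees a - {(k, k')}. component d a * component (k + m - fst d, k' + m' - snd d) b)"
      using k(1) by (subst sum.remove[of _ "(k, k')"]) (auto simp: D_def)
    finally have eq: "component (k, k') a * component (m, m') b = component (k + m, k' + m') (a * b)
        - (\<Sum>d\<in>bidegrees a - {(k, k')}. component d a * component (k + m - fst d, k' + m' - snd d) b)"
      by simp
    have "(\<Sum>d\<in>bidegrees a - {(k, k')}. component d a * component (k + m - fst d, k' + m' - snd d) b) \<in> P"
    proof (rule ideal.subspace_sum[OF P(1)])
      fix d assume d: "d \<in> bidegrees a - {(k, k')}"
      show "component d a * component (k + m - fst d, k' + m' - snd d) b \<in> P"
      proof (cases "d \<in> D a")
        case True
        then show ?thesis using other d P(1) by (intro ideal_mult_left) auto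
      next
        case False
        then show ?thesis using memP P(1) by (intro ideal_mult_right) auto
      qed
    qed
    moreover have "component (k + m, k' + m') (a * b) \<in> P"
      using P(2) ab by (auto simp: homogeneous_def)
    ultimately have "component (k, k') a * component (m, m') b \<in> P"
      unfolding eq using P(1) by (intro ideal.subspace_diff)
    then have "component (k, k') a \<in> P \<or> component (m, m') b \<in> P"
      using prime component_in_bihom by blast
    then show False using k(1) m(1) by (auto simp: D_def)
  qed
qed (use P in auto)

lemma prime_idealD:
  assumes "prime_ideal P"
  shows "ideal.subspace P" "1 \<notin> P" "a * b \<in> P \<Longrightarrow> a \<in> P \<or> b \<in> P"
proof -
  show s: "ideal.subspace P" and "a * b \<in> P \<Longrightarrow> a \<in> P \<or> b \<in> P"
    using assms by (auto simp: prime_ideal_def)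
  have "UNIV \<subseteq> P" if "1 \<in> P" using ideal_mult_left[OF s that] by auto
  then show "1 \<notin> P" using assms by (auto simp: prime_ideal_def)
qed

lemma prime_ideal_power: "prime_ideal P \<Longrightarrow> a ^ n \<in> P \<Longrightarrow> a \<in> P"
  by (induction n) (auto dest: prime_idealD)

text \<open>An ideal that is maximal among the homogeneous ideals over \<open>Q\<close> without a power of \<open>\<mu>\<close> is prime:
  together with either of two homogeneous elements outside it generates a power of \<open>\<mu>\<close>, hence also
  together with their product. With \<open>\<mu>\<close> a product of two variables this is the source of points: a
  homogeneous ideal without a power of \<open>\<mu>\<close> is contained in the ideal of a point with \<open>\<mu> \<noteq> 0\<close>.\<close>

lemma homogeneous_prime_avoiding:
  fixes Q :: "'k::field bipoly set"
  assumes Q: "ideal.subspace Q" "homogeneous Q" and mu: "\<And>n. \<mu> ^ n \<notin> Q"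
  obtains P where "prime_ideal P" "homogeneous P" "Q \<subseteq> P" "\<mu> \<notin> P"
proof -
  define \<A> where "\<A> = {J. ideal.subspace J \<and> homogeneous J \<and> Q \<subseteq> J \<and> (\<forall>n. \<mu> ^ n \<notin> J)}"
  have "\<exists>M\<in>\<A>. \<forall>X\<in>\<A>. M \<subseteq> X \<longrightarrow> X = M"
  proof (rule subset_Zorn_nonempty)
    show "\<A> \<noteq> {}" using Q mu by (auto simp: \<A>_def)
  next
    fix C assume C: "C \<noteq> {}" "subset.chain \<A> C"
    then have A: "\<And>J. J \<in> C \<Longrightarrow> J \<in> \<A>" by (auto simp: subset_chain_def)
    have "ideal.subspace (\<Union>C)"
    proof (rule idealI)
      obtain J where J: "J \<in> C" using C by blast
      then show "0 \<in> \<Union>C" using A[OF J] ideal.subspace_0 by (auto simp: \<A>_def)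
      show "r * a \<in> \<Union>C" if a: "a \<in> \<Union>C" for r a
      proof -
        obtain J where J: "J \<in> C" "a \<in> J" using a by blast
        then have "r * a \<in> J" using A[OF J(1)] by (simp add: \<A>_def ideal_mult_left)
        then show ?thesis using J(1) by blast
      qed
      show "a + b \<in> \<Union>C" if ab: "a \<in> \<Union>C" "b \<in> \<Union>C" for a b
      proof -
        obtain J1 J2 where J: "J1 \<in> C" "J2 \<in> C" "a \<in> J1" "b \<in> J2" using ab by auto
        then have "J1 \<subseteq> J2 \<or> J2 \<subseteq> J1" using C(2) by (auto simp: subset_chain_def)
        then obtain J where "J \<in> C" "a \<in> J" "b \<in> J" using J by auto
        then have "a + b \<in> J" using A[of J] by (simp add: \<A>_def ideal.subspace_add)
        then show ?thesis using \<open>J \<in> C\<close> by blast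
      qed
    qed
    moreover have "homogeneous (\<Union>C)" unfolding homogeneous_def
    proof (intro ballI allI)
      fix a d assume "a \<in> \<Union>C"
      then obtain J where "J \<in> C" "a \<in> J" by blast
      moreover have "homogeneous J" using A[OF \<open>J \<in> C\<close>] by (simp add: \<A>_def)
      ultimately show "component d a \<in> \<Union>C" by (intro UnionI[of J] homogeneousD)
    qed
    moreover have "Q \<subseteq> \<Union>C"
    proof -
      obtain J where J: "J \<in> C" using C by blast
      then show ?thesis using A[OF J] by (auto simp: \<A>_def)
    qed
    moreover have "\<mu> ^ n \<notin> \<Union>C" for n
    proof
      assume "\<mu> ^ n \<in> \<Union>C"
      then obtain J where "J \<in> C" "\<mu> ^ n \<in> J" by blast
      then show False using A[of J] by (simp add: \<A>_def)
    qed
    ultimately show "\<Union>C \<in> \<A>" by (simp add: \<A>_def)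
  qed
  then obtain P where PA: "P \<in> \<A>" and max: "\<And>X. X \<in> \<A> \<Longrightarrow> P \<subseteq> X \<Longrightarrow> X = P" by blast
  have P: "ideal.subspace P" "homogeneous P" "Q \<subseteq> P" "\<And>n. \<mu> ^ n \<notin> P" using PA by (auto simp: \<A>_def)
  have avoid: "\<exists>n p r. p \<in> P \<and> \<mu> ^ n = p + r * a" if a: "a \<in> bihom k k'" "a \<notin> P" for a k k'
  proof -
    define X where "X = {p + r * a |p r. p \<in> P}"
    have "ideal.subspace X"
    proof (rule idealI)
      have "0 + 0 * a \<in> X" unfolding X_def using ideal.subspace_0[OF P(1)] by blast
      then show "0 \<in> X" by simp
    next
      fix x y assume "x \<in> X" "y \<in> X"
      then obtain p r q t where "x = p + r * a" "y = q + t * a" "p \<in> P" "q \<in> P" by (auto simp: X_def)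
      then have "x + y = (p + q) + (r + t) * a" "p + q \<in> P"
        using P(1) by (auto simp: algebra_simps ideal.subspace_add)
      then show "x + y \<in> X" unfolding X_def by blast
    next
      fix s x assume "x \<in> X"
      then obtain p r where "x = p + r * a" "p \<in> P" by (auto simp: X_def)
      then have "s * x = s * p + (s * r) * a" "s * p \<in> P"
        using ideal_mult_left[OF P(1), of p s] by (simp_all add: distrib_left mult.assoc)
      then show "s * x \<in> X" unfolding X_def by blast
    qed
    moreover have "homogeneous X" unfolding homogeneous_def
    proof (intro ballI allI)
      fix x and d :: "int \<times> int" assume "x \<in> X"
      then obtain p r where x: "x = p + r * a" "p \<in> P" by (auto simp: X_def)
      obtain l l' where d: "d = (l, l')" by (cases d)
      have "component d x = component d p + component (l - k, l' - k') r * a"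
        using component_mult_bihom[OF a(1), of l l' r] by (simp add: x d component_add mult.commute)
      moreover have "component d p \<in> P" using P(2) x(2) by (rule homogeneousD)
      ultimately show "component d x \<in> X" unfolding X_def by blast
    qed
    moreover have PX: "P \<subseteq> X"
    proof
      fix p assume "p \<in> P"
      then have "p + 0 * a \<in> X" unfolding X_def by blast
      then show "p \<in> X" by simp
    qed
    moreover have "0 + 1 * a \<in> X" unfolding X_def using ideal.subspace_0[OF P(1)] by blast
    then have "a \<in> X" by simp
    ultimately have "X \<notin> \<A>" using max[of X] a(2) \<open>a \<in> X\<close> by blast
    then obtain n where "\<mu> ^ n \<in> X"
      using \<open>ideal.subspace X\<close> \<open>homogeneous X\<close> PX P(3) unfolding \<A>_def by blast
    then show ?thesis by (auto simp: X_def)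
  qed
  have "prime_ideal P"
  proof (rule prime_ideal_of_homogeneous[OF P(1,2)])
    show "P \<noteq> UNIV" using P(4) by auto
    fix k k' l l' a b
    assume a: "a \<in> bihom k k'" and b: "b \<in> bihom l l'" and ab: "a * b \<in> P"
    show "a \<in> P \<or> b \<in> P"
    proof (rule ccontr)
      assume "\<not> ?thesis"
      then have na: "a \<notin> P" and nb: "b \<notin> P" by auto
      obtain n p r where n: "p \<in> P" "\<mu> ^ n = p + r * a" using avoid[OF a na] by blast
      obtain m q t where m: "q \<in> P" "\<mu> ^ m = q + t * b" using avoid[OF b nb] by blast
      have "\<mu> ^ (n + m) = \<mu> ^ m * p + (r * a) * q + (r * t) * (a * b)"
        unfolding power_add n(2) m(2) by (simp add: algebra_simps)
      also have "\<dots> \<in> P"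
        using ideal_mult_left[OF P(1) n(1)] ideal_mult_left[OF P(1) m(1)] ideal_mult_left[OF P(1) ab]
        by (intro ideal.subspace_add[OF P(1)])
      finally show False using P(4) by blast
    qed
  qed
  then show ?thesis using that[of P] P(2,3) P(4)[of 1] by simp
qed



section \<open>Regular sequences have only Koszul syzygies\<close>

text \<open>The diagonal is mentioned separately because the characteristic may be two.\<close>

definition alternating :: "(nat \<Rightarrow> nat \<Rightarrow> 'a::comm_ring_1) \<Rightarrow> bool" where
  "alternating w \<longleftrightarrow> (\<forall>i j. w i j = - w j i) \<and> (\<forall>i. w i i = 0)"

lemma alternatingD: "alternating w \<Longrightarrow> w i j = - w j i" "alternating w \<Longrightarrow> w i i = 0"
  unfolding alternating_def by blast+

text \<open>The local rings of the projective surface are subsets of the fraction field of the coordinate ring;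
  hence ring theory relative to a subring.\<close>

locale subring_carrier =
  fixes A :: "'a::comm_ring_1 set"
  assumes zero_closed [simp, intro]: "0 \<in> A" and one_closed [simp, intro]: "1 \<in> A"
    and add_closed [simp, intro]: "a \<in> A \<Longrightarrow> b \<in> A \<Longrightarrow> a + b \<in> A"
    and mult_closed [simp, intro]: "a \<in> A \<Longrightarrow> b \<in> A \<Longrightarrow> a * b \<in> A"
    and uminus_closed [simp, intro]: "a \<in> A \<Longrightarrow> - a \<in> A"
begin

lemma diff_closed [simp, intro]: "a \<in> A \<Longrightarrow> b \<in> A \<Longrightarrow> a - b \<in> A"
  using add_closed[of a "- b"] by simp

lemma sum_closed [simp, intro]: "(\<And>i. i \<in> S \<Longrightarrow> f i \<in> A) \<Longrightarrow> sum f S \<in> A"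
  by (induction S rule: infinite_finite_induct) auto

lemma power_closed [simp, intro]: "a \<in> A \<Longrightarrow> a ^ n \<in> A"
  by (induction n) auto

text \<open>Regularity puts the last coefficient of a relation into the ideal of the earlier elements. So
  Koszul relations that involve the last element remove this coefficient and leave a relation between
  the earlier elements.\<close>

lemma regular_sequence_syzygies:
  assumes "regular_sequence A xs" "n \<le> length xs"
    and "\<And>i. i < n \<Longrightarrow> a i \<in> A" "(\<Sum>i<n. a i * xs ! i) = 0"
  shows "\<exists>w. (\<forall>i j. w i j \<in> A) \<and> alternating w \<and>
    (\<forall>i<n. a i = (\<Sum>j<n. w i j * xs ! j))"
  using assms(2-)
proof (induction n arbitrary: a)
  case 0
  show ?case by (intro exI[of _ "\<lambda>i j. 0"]) (auto simp: alternating_def)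
next
  case (Suc n)
  have xA: "xs ! i \<in> A" if "i < length xs" for i
    using assms(1) that nth_mem unfolding regular_sequence_def by blast
  have eq: "(\<Sum>i<n. a i * xs ! i) + a n * xs ! n = 0" using Suc.prems(3) by simp
  have take: "take n xs ! i = xs ! i" if "i < n" for i using that by simp
  have len: "length (take n xs) = n" using Suc.prems(1) by simp
  have "a n * xs ! n = (\<Sum>i<n. (- a i) * xs ! i)" using eq by (simp add: sum_negf eq_neg_iff_add_eq_0 add.commute)
  also have "\<dots> = (\<Sum>i<length (take n xs). (- a i) * take n xs ! i)" unfolding len using take by simp
  finally have "a n * xs ! n \<in> generated_ideal A (take n xs)"
    unfolding generated_ideal_def using Suc.prems(2) len by (intro CollectI exI[of _ "\<lambda>i. - a i"]) auto
  then have "a n \<in> generated_ideal A (take n xs)"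
    using assms(1) Suc.prems unfolding regular_sequence_def by auto
  then obtain c where c: "a n = (\<Sum>i<n. c i * xs ! i)" "\<And>i. i < n \<Longrightarrow> c i \<in> A"
    unfolding generated_ideal_def len using take by auto
  have "(\<Sum>i<n. (a i + c i * xs ! n) * xs ! i) = (\<Sum>i<n. a i * xs ! i) + (\<Sum>i<n. c i * xs ! i) * xs ! n"
    unfolding sum_distrib_right sum.distrib[symmetric] by (intro sum.cong refl) (simp add: algebra_simps)
  also have "\<dots> = 0" using eq c(1) by simp
  finally have "(\<Sum>i<n. (a i + c i * xs ! n) * xs ! i) = 0" .
  then obtain w where w: "\<And>i j. w i j \<in> A" "alternating w"
      "\<And>i. i < n \<Longrightarrow> a i + c i * xs ! n = (\<Sum>j<n. w i j * xs ! j)"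
    using Suc.IH[of "\<lambda>i. a i + c i * xs ! n"] Suc.prems c(2) xA by auto
  define w' where "w' i j = (if i < n \<and> j < n then w i j else if i < n \<and> j = n then - c i
     else if i = n \<and> j < n then c j else 0)" for i j
  have w'_A: "w' i j \<in> A" for i j using w(1) c(2) by (auto simp: w'_def)
  have alt: "w' i j = - w' j i" for i j
  proof (cases "i = j")
    case True
    then show ?thesis by (simp add: w'_def alternatingD(2)[OF w(2)])
  next
    case False
    consider (inner) "i < n" "j < n" | (row) "i < n" "j = n" | (col) "i = n" "j < n"
      | (out) "i > n" | (out') "j > n"
      using False by linarith
    then show ?thesis
    proof cases
      case inner
      then show ?thesis unfolding w'_def using alternatingD(1)[OF w(2), of i j] by simp
    next
      case row
      then show ?thesis by (simp add: w'_def)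
    next
      case col
      then show ?thesis by (simp add: w'_def)
    next
      case out
      then show ?thesis by (simp add: w'_def)
    next
      case out'
      then show ?thesis by (simp add: w'_def)
    qed
  qed
  have w'_alt: "alternating w'"
    unfolding alternating_def
  proof (intro conjI allI)
    show "w' i i = 0" for i by (simp add: w'_def alternatingD(2)[OF w(2)])
  qed (rule alt)
  moreover have "a i = (\<Sum>j<Suc n. w' i j * xs ! j)" if "i < Suc n" for i
  proof (cases "i = n")
    case True
    then show ?thesis using c(1) by (simp add: w'_def)
  next
    case False
    then have "i < n" using that by simp
    then have "a i = (\<Sum>j<n. w i j * xs ! j) + (- c i) * xs ! n" using w(3)[of i] by (simp add: algebra_simps)
    then show ?thesis using \<open>i < n\<close> by (simp add: w'_def)
  qed
  ultimately show ?case using w'_A w'_alt by (intro exI[of _ w']) blast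
qed

text \<open>Let \<open>f\<close> and \<open>x\<close> generate the same ideal, with \<open>x\<close> regular, say \<open>f = M x\<close> and \<open>x = N f\<close>, and let
  \<open>a = b f\<close> be a syzygy of \<open>f\<close>. Then \<open>M\<^sup>T a\<close> is a syzygy of \<open>x\<close>, so \<open>M\<^sup>T a = w x = w N f\<close> with \<open>w\<close>
  alternating, and \<open>(M N)\<^sup>T a = (N\<^sup>T w N) f\<close>. The matrix \<open>E = 1 - M N\<close> annihilates \<open>f\<close>, so
  \<open>E\<^sup>T a = E\<^sup>T b f = (E\<^sup>T b - (E\<^sup>T b)\<^sup>T) f\<close>. The sum of the two equations writes \<open>a\<close> as an alternating matrix
  times \<open>f\<close>. Behind this is that the second symmetric power of an ideal generated by a regular
  sequence is the square of the ideal: both sides depend on the ideal, not on its generators.\<close>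

lemma syzygies_with_coefficients_in_ideal:
  fixes f :: "nat \<Rightarrow> 'a"
  assumes reg: "regular_sequence A xs"
    and M: "\<And>i l. i < m \<Longrightarrow> l < length xs \<Longrightarrow> M i l \<in> A"
      "\<And>i. i < m \<Longrightarrow> f i = (\<Sum>l<length xs. M i l * xs ! l)"
    and N: "\<And>l k. l < length xs \<Longrightarrow> k < m \<Longrightarrow> N l k \<in> A"
      "\<And>l. l < length xs \<Longrightarrow> xs ! l = (\<Sum>k<m. N l k * f k)"
    and b: "\<And>i k. i < m \<Longrightarrow> k < m \<Longrightarrow> b i k \<in> A"
      "\<And>i. i < m \<Longrightarrow> a i = (\<Sum>k<m. b i k * f k)"
    and aA: "\<And>i. i < m \<Longrightarrow> a i \<in> A"
    and syz: "(\<Sum>i<m. a i * f i) = 0"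
  shows "\<exists>w. (\<forall>i<m. \<forall>j<m. w i j \<in> A) \<and> alternating w \<and>
    (\<forall>i<m. a i = (\<Sum>j<m. w i j * f j))"
proof -
  define n where "n = length xs"
  define y where "y l = (\<Sum>i<m. M i l * a i)" for l
  have "y l \<in> A" if "l < n" for l unfolding y_def using M(1) aA that n_def by auto
  moreover have "(\<Sum>l<n. y l * xs ! l) = 0"
  proof -
    have "(\<Sum>l<n. y l * xs ! l) = (\<Sum>l<n. \<Sum>i<m. a i * (M i l * xs ! l))"
      unfolding y_def sum_distrib_right by (intro sum.cong refl) (simp only: mult_ac)
    also have "\<dots> = (\<Sum>i<m. \<Sum>l<n. a i * (M i l * xs ! l))" by (rule sum.swap)
    also have "\<dots> = (\<Sum>i<m. a i * f i)" using M(2) n_def by (simp add: sum_distrib_left)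
    finally show ?thesis using syz by simp
  qed
  ultimately obtain w where w: "\<And>i j. w i j \<in> A" "alternating w"
      "\<And>l. l < n \<Longrightarrow> y l = (\<Sum>j<n. w l j * xs ! j)"
    using regular_sequence_syzygies[OF reg, of n y] n_def by auto
  define MN where "MN i k = (\<Sum>l<n. M i l * N l k)" for i k
  have MN_A: "MN i k \<in> A" if "i < m" "k < m" for i k
    unfolding MN_def using M(1) N(1) that n_def by auto
  have MNf: "(\<Sum>k<m. MN i k * f k) = f i" if "i < m" for i
  proof -
    have "(\<Sum>k<m. MN i k * f k) = (\<Sum>k<m. \<Sum>l<n. M i l * (N l k * f k))"
      unfolding MN_def sum_distrib_right by (intro sum.cong refl) (simp only: mult_ac)
    also have "\<dots> = (\<Sum>l<n. \<Sum>k<m. M i l * (N l k * f k))" by (rule sum.swap)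
    also have "\<dots> = (\<Sum>l<n. M i l * xs ! l)" using N(2) n_def by (simp add: sum_distrib_left)
    finally show ?thesis using M(2)[OF that] n_def by simp
  qed
  define E where "E i k = (if i = k then 1 else 0) - MN i k" for i k
  have E_A: "E i k \<in> A" if "i < m" "k < m" for i k using MN_A[OF that] by (auto simp: E_def)
  have Ef: "(\<Sum>k<m. E i k * f k) = 0" if "i < m" for i
  proof -
    have "(\<Sum>k<m. E i k * f k) = (\<Sum>k<m. (if i = k then f k else 0)) - (\<Sum>k<m. MN i k * f k)"
      by (simp add: E_def left_diff_distrib sum_subtractf if_distrib[of "\<lambda>x. x * _"] cong: if_cong)
    then show ?thesis using MNf that by simp
  qed
  define v where "v i j = (\<Sum>l<n. \<Sum>k<n. N l i * w l k * N k j)" for i j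
  define u where "u i j = (\<Sum>k<m. E k i * b k j)" for i j
  define z where "z i j = v i j + (u i j - u j i)" for i j
  have v_alt: "v i j = - v j i" for i j
  proof -
    have "v i j = (\<Sum>k<n. \<Sum>l<n. N l i * w l k * N k j)" unfolding v_def by (rule sum.swap)
    also have "\<dots> = (\<Sum>k<n. \<Sum>l<n. - (N k j * w k l * N l i))"
    proof (intro sum.cong refl)
      fix k l show "N l i * w l k * N k j = - (N k j * w k l * N l i)"
        using alternatingD(1)[OF w(2), of l k] by (simp add: algebra_simps)
    qed
    finally show ?thesis by (simp add: v_def sum_negf)
  qed
  have v_0: "v i i = 0" for i
  proof -
    define S where "S p q = N p i * w p q * N q i" for p q
    have S: "S q p = - S p q" "S p p = 0" for p q
      using alternatingD(1)[OF w(2), of q p] alternatingD(2)[OF w(2), of p] by (simp_all add: S_def)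
    have "(\<Sum>l<n. \<Sum>k<n. S l k) = 0"
    proof (induction n)
      case (Suc n)
      have "(\<Sum>l<Suc n. \<Sum>k<Suc n. S l k)
          = (\<Sum>l<n. \<Sum>k<n. S l k) + (\<Sum>l<n. S l n) + (\<Sum>k<n. S n k) + S n n"
        by (simp add: sum.distrib algebra_simps)
      also have "(\<Sum>k<n. S n k) = - (\<Sum>k<n. S k n)" unfolding sum_negf[symmetric] by (simp add: S(1)[of n])
      finally show ?case using Suc S(2) by simp
    qed simp
    then show ?thesis by (simp add: v_def S_def)
  qed
  have "z i j \<in> A" if "i < m" "j < m" for i j
  proof -
    have "v i j \<in> A" unfolding v_def
      by (intro sum_closed mult_closed N(1) w(1)) (use that n_def in auto)
    moreover have "u i j \<in> A" "u j i \<in> A" unfolding u_def using E_A b(1) that by auto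
    ultimately show "z i j \<in> A" unfolding z_def by auto
  qed
  moreover have "alternating z"
    unfolding alternating_def
  proof (intro conjI allI)
    show "z i j = - z j i" for i j unfolding z_def using v_alt[of i j] by simp
    show "z i i = 0" for i by (simp add: z_def v_0)
  qed
  moreover have "a i = (\<Sum>j<m. z i j * f j)" if i: "i < m" for i
  proof -
    have vf: "(\<Sum>j<m. v i j * f j) = (\<Sum>k<m. MN k i * a k)"
    proof -
      have "(\<Sum>j<m. v i j * f j) = (\<Sum>j<m. \<Sum>l<n. \<Sum>k<n. N l i * w l k * (N k j * f j))"
        unfolding v_def sum_distrib_right by (intro sum.cong refl) (simp only: mult_ac)
      also have "\<dots> = (\<Sum>l<n. \<Sum>j<m. \<Sum>k<n. N l i * w l k * (N k j * f j))" by (rule sum.swap)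
      also have "\<dots> = (\<Sum>l<n. \<Sum>k<n. \<Sum>j<m. N l i * w l k * (N k j * f j))"
        by (rule sum.cong[OF refl], rule sum.swap)
      also have "\<dots> = (\<Sum>l<n. \<Sum>k<n. N l i * w l k * xs ! k)"
        using N(2) n_def by (simp add: sum_distrib_left)
      also have "\<dots> = (\<Sum>l<n. N l i * y l)" using w(3) by (simp add: sum_distrib_left mult.assoc)
      also have "\<dots> = (\<Sum>l<n. \<Sum>k<m. M k l * N l i * a k)"
        unfolding y_def sum_distrib_left by (intro sum.cong refl) (simp only: mult_ac)
      also have "\<dots> = (\<Sum>k<m. \<Sum>l<n. M k l * N l i * a k)" by (rule sum.swap)
      finally show ?thesis by (simp add: MN_def sum_distrib_right)
    qed
    have uf: "(\<Sum>j<m. u i j * f j) = (\<Sum>k<m. E k i * a k)"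
    proof -
      have "(\<Sum>j<m. u i j * f j) = (\<Sum>j<m. \<Sum>k<m. E k i * (b k j * f j))"
        unfolding u_def sum_distrib_right by (intro sum.cong refl) (simp only: mult_ac)
      also have "\<dots> = (\<Sum>k<m. \<Sum>j<m. E k i * (b k j * f j))" by (rule sum.swap)
      finally show ?thesis using b(2) by (simp add: sum_distrib_left)
    qed
    have u'f: "(\<Sum>j<m. u j i * f j) = 0"
    proof -
      have "(\<Sum>j<m. u j i * f j) = (\<Sum>j<m. \<Sum>k<m. b k i * (E k j * f j))"
        unfolding u_def sum_distrib_right by (intro sum.cong refl) (simp only: mult_ac)
      also have "\<dots> = (\<Sum>k<m. \<Sum>j<m. b k i * (E k j * f j))" by (rule sum.swap)
      also have "\<dots> = (\<Sum>k<m. b k i * (\<Sum>j<m. E k j * f j))" by (simp add: sum_distrib_left)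
      finally show ?thesis using Ef by simp
    qed
    have "(\<Sum>j<m. z i j * f j) = (\<Sum>k<m. MN k i * a k) + (\<Sum>k<m. E k i * a k)"
      unfolding z_def by (simp add: distrib_right left_diff_distrib sum.distrib sum_subtractf vf uf u'f)
    also have "\<dots> = (\<Sum>k<m. if k = i then a k else 0)"
      unfolding sum.distrib[symmetric] E_def by (intro sum.cong) (auto simp: algebra_simps)
    finally show ?thesis using i by simp
  qed
  ultimately show ?thesis by (intro exI[of _ z]) auto
qed

end


section \<open>Products of prime elements\<close>

text \<open>Factoriality of a single element, as an inductive predicate: it passes along ring isomorphisms, and
  its induction rule removes one prime factor at a time.\<close>

inductive prime_product :: "'a::idom \<Rightarrow> bool" where
  unit: "u dvd 1 \<Longrightarrow> prime_product u"
| mult: "prime_elem p \<Longrightarrow> prime_product b \<Longrightarrow> prime_product (p * b)"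

lemma prime_product_ufd:
  fixes a :: "'a::ufd"
  assumes "a \<noteq> 0"
  shows "prime_product a"
proof (cases "a dvd 1")
  case True
  then show ?thesis by (rule prime_product.unit)
next
  case False
  then obtain F where F: "mset_factors F a" using assms mset_factors_exist by blast
  have "prime_product (prod_mset G)" if "\<And>p. p \<in># G \<Longrightarrow> prime_elem p" for G :: "'a multiset"
    using that by (induction G) (auto intro: prime_product.intros)
  then show ?thesis using F by (auto simp: mset_factors_def irreducible_imp_prime_elem)
qed

definition common_prime :: "'a::idom set \<Rightarrow> bool" where
  "common_prime F \<longleftrightarrow> (\<exists>p. prime_elem p \<and> (\<forall>f\<in>F. p dvd f))"

text \<open>Every prime factor of \<open>g\<close> fails to divide some \<open>f\<close> and therefore divides \<open>a\<close>.\<close>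

lemma prime_product_cancel:
  assumes "prime_product g" "\<not> common_prime (insert g F)" "\<And>f. f \<in> F \<Longrightarrow> g dvd a * f"
  shows "g dvd a"
  using assms
proof (induction g arbitrary: a rule: prime_product.induct)
  case (unit u)
  then show ?case using dvd_trans one_dvd by blast
next
  case (mult p b)
  have p0: "p \<noteq> 0" using mult.hyps by auto
  have "\<exists>f\<in>F. \<not> p dvd f" using mult.prems(1) mult.hyps(1) by (auto simp: common_prime_def)
  then obtain f where f: "f \<in> F" "\<not> p dvd f" by blast
  have "p dvd a * f" using mult.prems(2)[OF f(1)] dvd_mult_left by blast
  then have "p dvd a" using f(2) prime_elem_dvd_multD[OF mult.hyps(1), of a f] by simp
  then obtain a' where a: "a = p * a'" by (elim dvdE)
  have "b dvd a' * f'" if "f' \<in> F" for f'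
    using mult.prems(2)[OF that] p0 unfolding a by (simp add: mult.assoc)
  moreover have "\<not> common_prime (insert b F)"
    using mult.prems(1) by (auto simp: common_prime_def)
  ultimately have "b dvd a'" using mult.IH by blast
  then show ?case unfolding a by simp
qed

lemma prime_product_gcd:
  assumes "prime_product f1"
  shows "\<exists>g f1' f2'. f1 = g * f1' \<and> f2 = g * f2' \<and> \<not> common_prime {f1', f2'}"
  using assms
proof (induction f1 arbitrary: f2 rule: prime_product.induct)
  case (unit u)
  have "\<not> common_prime {u, f2}"
  proof
    assume "common_prime {u, f2}"
    then obtain p where "prime_elem p" "p dvd u" by (auto simp: common_prime_def)
    then show False using dvd_trans[OF _ unit, of p] by (simp add: prime_elem_def)
  qed
  then show ?case by (intro exI[of _ 1] exI[of _ u] exI[of _ f2]) simp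
next
  case (mult p b)
  show ?case
  proof (cases "p dvd f2")
    case True
    then obtain f2'' where f2: "f2 = p * f2''" by (elim dvdE)
    obtain g b' f2' where "b = g * b'" "f2'' = g * f2'" "\<not> common_prime {b', f2'}"
      using mult.IH[of f2''] by blast
    then show ?thesis using f2
      by (intro exI[of _ "p * g"] exI[of _ b'] exI[of _ f2']) (simp add: mult.assoc)
  next
    case False
    obtain g b' f2' where g: "b = g * b'" "f2 = g * f2'" "\<not> common_prime {b', f2'}"
      using mult.IH[of f2] by blast
    have "\<not> common_prime {p * b', f2'}"
    proof
      assume "common_prime {p * b', f2'}"
      then obtain q where q: "prime_elem q" "q dvd p * b'" "q dvd f2'" by (auto simp: common_prime_def)
      have "\<not> q dvd b'" using g(3) q by (auto simp: common_prime_def)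
      then have "q dvd p" using prime_elem_dvd_multD[OF q(1,2)] by simp
      then obtain r where r: "p = q * r" by (elim dvdE)
      have "p dvd q \<or> p dvd r" using prime_elem_dvd_multD[OF mult.hyps(1), of q r] r by simp
      moreover have "\<not> p dvd q"
      proof
        assume "p dvd q"
        then have "p dvd f2'" using q(3) by (rule dvd_trans)
        then show False using False g(2) by simp
      qed
      ultimately obtain r' where "r = p * r'" by (elim disjE dvdE) auto
      then have "p * 1 = p * (q * r')" using r by (simp add: ac_simps)
      moreover have "p \<noteq> 0" using mult.hyps(1) by auto
      ultimately have "1 = q * r'" unfolding mult_cancel_left by blast
      then have "q dvd 1" by (rule dvdI)
      then show False using q(1) by (simp add: prime_elem_def)
    qed
    then show ?thesis using g
      by (intro exI[of _ g] exI[of _ "p * b'"] exI[of _ f2']) (simp add: ac_simps)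
  qed
qed

lemma prime_ideal_contains_prime_factor:
  assumes "prime_product a" "prime_ideal J" "a \<in> J"
  shows "\<exists>p. prime_elem p \<and> p dvd a \<and> p \<in> J"
  using assms
proof (induction rule: prime_product.induct)
  case (unit u)
  then obtain v where "1 = u * v" by (elim dvdE)
  then have "1 \<in> J" using ideal_mult_right[OF prime_idealD(1), of J u v] unit by simp
  then show ?case using prime_idealD(2)[of J] unit by simp
next
  case (mult p b)
  then consider "p \<in> J" | "b \<in> J" using prime_idealD(3)[of J p b] by auto
  then show ?case
  proof cases
    case 1
    then show ?thesis using mult.hyps(1) by auto
  next
    case 2
    then show ?thesis using mult.IH mult.prems by auto
  qed
qed


section \<open>Elimination in polynomial rings\<close>

lemma prime_factor_of_positive_degree:
  fixes h :: "'e::idom poly"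
  assumes "prime_product h" "degree h > 0"
  shows "\<exists>p. prime_elem p \<and> p dvd h \<and> degree p > 0"
  using assms
proof (induction rule: prime_product.induct)
  case (unit u)
  then show ?case by (metis dvd_imp_degree_le degree_1 leD one_neq_zero)
next
  case (mult p b)
  show ?case
  proof (cases "degree p > 0")
    case True
    then show ?thesis using mult.hyps by auto
  next
    case False
    then have "degree b > 0" using mult.prems degree_mult_le[of p b] by linarith
    then show ?thesis using mult.IH by auto
  qed
qed

lemma pseudo_division:
  fixes f h :: "'e::idom poly"
  assumes "h \<noteq> 0"
  obtains k q r where "[:lead_coeff h ^ k:] * f = h * q + r" "r = 0 \<or> degree r < degree h"
proof -
  obtain q r where "pseudo_divmod f h = (q, r)" by fastforce
  from pseudo_divmod[OF assms this] show ?thesis using that by simp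
qed

text \<open>Let \<open>h\<close> be a nonzero element of least degree in the ideal. By pseudo-division \<open>h\<close> divides a nonzero
  constant multiple of each \<open>f\<close>, so a prime factor of \<open>h\<close> of positive degree divides all \<open>f\<close>. Hence \<open>h\<close> is
  constant.\<close>

lemma eliminate_variable:
  fixes F :: "'e::ufd poly set"
  assumes F: "\<not> common_prime F" "f0 \<in> F" "f0 \<noteq> 0"
  shows "\<exists>h. h \<noteq> 0 \<and> [:h:] \<in> ideal.span F"
proof -
  define n where "n = (LEAST n. \<exists>h\<in>ideal.span F. h \<noteq> 0 \<and> degree h = n)"
  have "\<exists>n. \<exists>h\<in>ideal.span F. h \<noteq> 0 \<and> degree h = n"
    using F ideal.span_base by blast
  from LeastI_ex[OF this] obtain h where h: "h \<in> ideal.span F" "h \<noteq> 0" "degree h = n"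
    unfolding n_def by blast
  have min: "r = 0" if "r \<in> ideal.span F" "degree r < degree h \<or> r = 0" for r
  proof (rule ccontr)
    assume "r \<noteq> 0"
    then have "n \<le> degree r" unfolding n_def using that by (intro Least_le) blast
    then show False using that h \<open>r \<noteq> 0\<close> by simp
  qed
  have div: "\<exists>c. c \<noteq> 0 \<and> h dvd [:c:] * f" if f: "f \<in> F" for f
  proof -
    obtain k q r where qr: "[:lead_coeff h ^ k:] * f = h * q + r" "r = 0 \<or> degree r < degree h"
      using pseudo_division[OF h(2)] by blast
    have "r = [:lead_coeff h ^ k:] * f - q * h" using qr(1) by (simp add: algebra_simps)
    also have "\<dots> \<in> ideal.span F"
      using h(1) f by (intro ideal.span_diff ideal.span_scale) (auto intro: ideal.span_base)
    finally have "r = 0" using min qr(2) by blast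
    then show ?thesis using qr(1) h(2) by (intro exI[of _ "lead_coeff h ^ k"]) auto
  qed
  have "degree h = 0"
  proof (rule ccontr)
    assume "degree h \<noteq> 0"
    then obtain p where p: "prime_elem p" "p dvd h" "degree p > 0"
      using prime_factor_of_positive_degree[OF prime_product_ufd[OF h(2)]] by auto
    have "p dvd f" if f: "f \<in> F" for f
    proof -
      obtain c where c: "c \<noteq> 0" "h dvd [:c:] * f" using div[OF f] by blast
      then have "p dvd [:c:] * f" using p(2) dvd_trans by blast
      moreover have "\<not> p dvd [:c:]" using c(1) p(3) dvd_imp_degree_le[of p "[:c:]"] by auto
      ultimately show ?thesis using prime_elem_dvd_multD[OF p(1), of "[:c:]" f] by simp
    qed
    then show False using F(1) p(1) by (auto simp: common_prime_def)
  qed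
  then obtain c where "h = [:c:]" by (rule degree_eq_zeroE)
  then show ?thesis using h by auto
qed

lemma mem_span2:
  fixes f1 f2 :: "'a::comm_ring_1"
  shows "a \<in> ideal.span {f1, f2} \<longleftrightarrow> (\<exists>r1 r2. a = r1 * f1 + r2 * f2)"
proof -
  have "a \<in> ideal.span {f1, f2} \<longleftrightarrow> (\<exists>r1 r2. a - r1 * f1 = r2 * f2)"
    by (auto simp: ideal.span_insert[of f1] ideal.span_singleton)
  also have "\<dots> \<longleftrightarrow> (\<exists>r1 r2. a = r1 * f1 + r2 * f2)"
    by (intro ex_cong1) (auto simp: algebra_simps)
  finally show ?thesis .
qed

lemma power_add_cong:
  fixes u v :: "'a::comm_ring_1"
  shows "\<exists>g. (u + v) ^ n = u * g + v ^ n"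
proof (induction n)
  case 0
  show ?case by (intro exI[of _ 0]) simp
next
  case (Suc n)
  then obtain g where "(u + v) ^ n = u * g + v ^ n" by blast
  then have "(u + v) ^ Suc n = u * (g * (u + v) + v ^ n) + v ^ Suc n" by (simp add: algebra_simps)
  then show ?case by blast
qed

lemma divide_out_power:
  fixes h x :: "'c::idom poly"
  assumes "h \<noteq> 0" "degree x > 0"
  shows "\<exists>n h0. h = x ^ n * h0 \<and> \<not> x dvd h0"
  using assms(1)
proof (induction "degree h" arbitrary: h rule: less_induct)
  case less
  show ?case
  proof (cases "x dvd h")
    case True
    then obtain h' where h': "h = x * h'" by (elim dvdE)
    then have "degree h = degree x + degree h'" "h' \<noteq> 0"
      using less.prems by (auto intro: degree_mult_eq)
    then obtain n h0 where "h' = x ^ n * h0" "\<not> x dvd h0" using less.hyps[of h'] assms(2) by auto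
    then show ?thesis using h' by (intro exI[of _ "Suc n"] exI[of _ h0]) (simp add: mult.assoc)
  next
    case False
    then show ?thesis by (intro exI[of _ 0] exI[of _ h]) simp
  qed
qed


section \<open>Local parameters at a closed point\<close>

lemma prime_ideal_not_mem_mult: "prime_ideal P \<Longrightarrow> a \<notin> P \<Longrightarrow> b \<notin> P \<Longrightarrow> a * b \<notin> P"
  using prime_idealD(3) by blast

lemma prime_ideal_not_mem_power: "prime_ideal P \<Longrightarrow> a \<notin> P \<Longrightarrow> a ^ n \<notin> P"
  using prime_ideal_power by blast

text \<open>This says, without denominators, that the local ring at \<open>P\<close> is regular of dimension two: \<open>x, y\<close> is a
  regular sequence that generates the maximal ideal, and two elements without a common prime generate an
  ideal that contains powers of \<open>x\<close> and \<open>y\<close>.\<close>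

definition local_parameters :: "'a::idom set \<Rightarrow> 'a \<Rightarrow> 'a \<Rightarrow> bool" where
  "local_parameters P x y \<longleftrightarrow> x \<in> P \<and> y \<in> P \<and> prime_elem x \<and> \<not> x dvd y \<and>
     (\<forall>a\<in>P. \<exists>c q r. c \<notin> P \<and> c * a = q * x + r * y) \<and>
     (\<forall>f1 f2. \<not> common_prime {f1, f2} \<longrightarrow>
        (\<exists>c n p q p' q'. c \<notin> P \<and> c * x ^ n = p * f1 + q * f2 \<and> c * y ^ n = p' * f1 + q' * f2))"

text \<open>The nonzero elements of \<open>'c\<close> are units at \<open>P\<close>, so \<open>P\<close> behaves like a closed point of the affine plane
  over a field. Its projection to the line is a point: eliminating one variable from \<open>F\<close> gives a nonzero
  element of \<open>P\<close> in the other one. The equation \<open>x\<close> of this point is the first parameter; an element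
  \<open>y\<close> of least degree in \<open>P\<close> outside of the ideal of \<open>x\<close> is the second one.\<close>

lemma local_parameters_nested:
  fixes P :: "'c::ufd poly poly set"
  assumes P: "prime_ideal P" and const: "\<And>c. [:[:c:]:] \<in> P \<Longrightarrow> c = 0"
    and F: "F \<subseteq> P" "\<not> common_prime F" "f0 \<in> F" "f0 \<noteq> 0"
  shows "\<exists>x y. local_parameters P x y"
proof -
  note sub = prime_idealD(1)[OF P]
  define p where "p = {e. [:e:] \<in> P}"
  have pI: "e \<in> p \<longleftrightarrow> [:e:] \<in> P" for e by (simp add: p_def)
  have p_prime: "prime_ideal p"
    unfolding prime_ideal_def
  proof (intro conjI allI impI)
    show "ideal.subspace p"
    proof (rule idealI)
      show "0 \<in> p" using ideal.subspace_0[OF sub] by (simp add: pI)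
      show "a + b \<in> p" if "a \<in> p" "b \<in> p" for a b
        using ideal.subspace_add[OF sub, of "[:a:]" "[:b:]"] that by (simp add: pI)
      show "r * a \<in> p" if "a \<in> p" for r a
        using ideal_mult_left[OF sub, of "[:a:]" "[:r:]"] that by (simp add: pI mult.commute)
    qed
    have "1 \<notin> p" using prime_idealD(2)[OF P] by (simp add: pI pCons_one)
    then show "p \<noteq> UNIV" by auto
    show "a \<in> p \<or> b \<in> p" if "a * b \<in> p" for a b
      using prime_idealD(3)[OF P, of "[:a:]" "[:b:]"] that by (simp add: pI mult.commute)
  qed
  note psub = prime_idealD(1)[OF p_prime]
  obtain h where h: "h \<noteq> 0" "[:h:] \<in> ideal.span F" using eliminate_variable[OF F(2-)] by blast
  have "h \<in> p" using h(2) ideal.span_minimal[OF F(1) sub] by (auto simp: pI)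
  define n where "n = (LEAST n. \<exists>e\<in>p. e \<noteq> 0 \<and> degree e = n)"
  have ex: "\<exists>n. \<exists>e\<in>p. e \<noteq> 0 \<and> degree e = n" using \<open>h \<in> p\<close> h(1) by blast
  from LeastI_ex[OF this] obtain e0 where e0: "e0 \<in> p" "e0 \<noteq> 0" "degree e0 = n"
    unfolding n_def by blast
  have min: "r = 0" if "r \<in> p" "degree r < n" for r
  proof (rule ccontr)
    assume "r \<noteq> 0"
    then have "n \<le> degree r" unfolding n_def using that by (intro Least_le) blast
    then show False using that by simp
  qed
  \<comment> \<open>A prime factor \<open>x0\<close> of an element of least degree generates the contraction \<open>p\<close> of \<open>P\<close>.\<close>
  obtain x0 where x0: "prime_elem x0" "x0 dvd e0" "x0 \<in> p"
    using prime_ideal_contains_prime_factor[OF prime_product_ufd[OF e0(2)] p_prime e0(1)]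
    by (elim exE conjE) (rule that)
  have x0_deg: "degree x0 \<le> n" using dvd_imp_degree_le[OF x0(2) e0(2)] e0(3) by simp
  have x0_0: "x0 \<noteq> 0" using x0(1) by auto
  have x0_pos: "degree x0 > 0"
  proof (rule ccontr)
    assume "\<not> ?thesis"
    then obtain c where c: "x0 = [:c:]" using degree_eq_zeroE by blast
    then have "c = 0" using const x0(3) by (simp add: pI)
    then show False using c x0_0 by simp
  qed
  have p_iff: "e \<in> p \<longleftrightarrow> x0 dvd e" for e
  proof
    assume e: "e \<in> p"
    obtain k q r where qr: "[:lead_coeff x0 ^ k:] * e = x0 * q + r" "r = 0 \<or> degree r < degree x0"
      using pseudo_division[OF x0_0] by blast
    have "r = [:lead_coeff x0 ^ k:] * e - q * x0" using qr(1) by (simp add: algebra_simps)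
    also have "\<dots> \<in> p" using e x0(3) psub by (intro ideal.subspace_diff ideal_mult_left)
    finally have "r \<in> p" .
    then have "r = 0" using qr(2) min[of r] x0_deg by auto
    then have "x0 dvd [:lead_coeff x0 ^ k:] * e" using qr(1) by simp
    moreover have "\<not> x0 dvd [:lead_coeff x0 ^ k:]"
      using dvd_imp_degree_le[of x0 "[:lead_coeff x0 ^ k:]"] x0_pos x0_0 by auto
    ultimately show "x0 dvd e"
      using prime_elem_dvd_multD[OF x0(1), of "[:lead_coeff x0 ^ k:]" e] by simp
  next
    assume "x0 dvd e"
    then show "e \<in> p" using ideal_mult_right[OF psub x0(3)] by (elim dvdE) simp
  qed
  define x where "x = [:x0:]"
  have x_prime: "prime_elem x" unfolding x_def by (rule lift_prime_elem_poly[OF x0(1)])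
  have xP: "x \<in> P" using x0(3) by (simp add: pI x_def)
  have x_const: "x dvd [:e:] \<longleftrightarrow> [:e:] \<in> P" for e
    unfolding pI[symmetric] p_iff x_def by (simp add: const_poly_dvd)
  define m where "m = (LEAST m. \<exists>a\<in>P. \<not> x dvd a \<and> degree a = m)"
  have "\<exists>f\<in>F. \<not> x dvd f" using F(2) x_prime by (auto simp: common_prime_def)
  then have ex: "\<exists>m. \<exists>a\<in>P. \<not> x dvd a \<and> degree a = m" using F(1) by blast
  from LeastI_ex[OF this] obtain y where y: "y \<in> P" "\<not> x dvd y" "degree y = m"
    unfolding m_def by blast
  have ymin: "x dvd r" if "r \<in> P" "degree r < m" for r
  proof (rule ccontr)
    assume "\<not> x dvd r"
    then have "m \<le> degree r" unfolding m_def using that by (intro Least_le) blast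
    then show False using that by simp
  qed
  have y0: "y \<noteq> 0" using y(2) by auto
  have y_pos: "degree y > 0"
  proof (rule ccontr)
    assume "\<not> ?thesis"
    then obtain e where "y = [:e:]" using degree_eq_zeroE by blast
    then show False using y x_const by auto
  qed
  \<comment> \<open>The leading coefficient of \<open>y\<close> is a unit at \<open>P\<close>, for otherwise \<open>x\<close> divides the leading term and
    the remaining terms contradict the choice of \<open>y\<close>. So division by \<open>y\<close> is possible at \<open>P\<close>.\<close>
  define l where "l = lead_coeff y"
  have l: "[:l:] \<notin> P"
  proof
    assume "[:l:] \<in> P"
    then have "x0 dvd l" using pI p_iff by simp
    then obtain l' where l': "l = x0 * l'" by (elim dvdE)
    have mon: "monom l (degree y) = x * monom l' (degree y)" by (simp add: l' x_def smult_monom)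
    define y' where "y' = y - monom l (degree y)"
    have "y' \<in> P" unfolding y'_def mon using y(1) xP sub by (intro ideal.subspace_diff ideal_mult_right)
    moreover have "degree y' < degree y"
    proof (rule degree_lessI)
      show "\<forall>k\<ge>degree y. coeff y' k = 0"
        by (auto simp: y'_def l_def coeff_eq_0 le_less)
    qed (use y_pos in auto)
    ultimately have "x dvd y'" using ymin y(3) by simp
    then have "x dvd y' + x * monom l' (degree y)" by simp
    then show False using y(2) by (simp add: y'_def mon)
  qed
  have l_power: "[:l ^ k:] \<notin> P" for k
    using prime_ideal_not_mem_power[OF P l, of k] by (simp add: poly_const_pow)
  have reduce: "\<exists>k q r. [:l ^ k:] * a = y * q + x * r \<and> (\<not> x dvd a \<longrightarrow> degree q < degree a \<and> \<not> x dvd q)"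
    if a: "a \<in> P" for a
  proof -
    obtain k q r where qr: "[:l ^ k:] * a = y * q + r" "r = 0 \<or> degree r < degree y"
      using pseudo_division[OF y0, of a] unfolding l_def by blast
    have "r = [:l ^ k:] * a - q * y" using qr(1) by (simp add: algebra_simps)
    also have "\<dots> \<in> P" using a y(1) sub by (intro ideal.subspace_diff ideal_mult_left)
    finally have "r \<in> P" .
    then have "x dvd r" using qr(2) ymin y(3) by auto
    then obtain r' where r': "r = x * r'" by (elim dvdE)
    have "degree q < degree a \<and> \<not> x dvd q" if na: "\<not> x dvd a"
    proof
      show nq: "\<not> x dvd q"
      proof
        assume "x dvd q"
        then have "x dvd [:l ^ k:] * a" using qr(1) \<open>x dvd r\<close> by simp
        then show False using na prime_elem_dvd_multD[OF x_prime, of "[:l ^ k:]" a] x_const[of "l ^ k"] l_power[of k] by simp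
      qed
      then have q0: "q \<noteq> 0" by auto
      have yq: "degree (y * q) = degree y + degree q" using degree_mult_eq[OF y0 q0] .
      have "degree (y * q + r) = degree y + degree q"
        using qr(2) y_pos yq by (auto simp: degree_add_eq_left)
      moreover have "degree ([:l ^ k:] * a) = degree a" using y0 by (simp add: l_def)
      ultimately have "degree a = degree y + degree q" unfolding qr(1) by linarith
      then show "degree q < degree a" using y_pos by simp
    qed
    then show ?thesis using qr(1) r' by blast
  qed
  \<comment> \<open>Modulo \<open>x\<close> the element \<open>f\<close> is a power of \<open>y\<close> times a unit, because dividing by \<open>y\<close> lowers the degree.\<close>
  have y_power: "\<exists>i w a b. w \<notin> P \<and> y ^ i * w = a * f + b * x" if "\<not> x dvd f" for f
    using that
  proof (induction "degree f" arbitrary: f rule: less_induct)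
    case less
    show ?case
    proof (cases "f \<in> P")
      case False
      then show ?thesis by (intro exI[of _ 0] exI[of _ f] exI[of _ 1]) simp
    next
      case True
      obtain k q r where kqr: "[:l ^ k:] * f = y * q + x * r" "degree q < degree f" "\<not> x dvd q"
        using reduce[OF True] less.prems by blast
      obtain i w a b where w: "w \<notin> P" "y ^ i * w = a * q + b * x" using less.hyps[OF kqr(2,3)] by blast
      have "y ^ Suc i * w = a * (y * q) + b * y * x" using arg_cong[OF w(2), of "\<lambda>t. y * t"] by (simp add: algebra_simps)
      also have "y * q = [:l ^ k:] * f - x * r" using kqr(1) by (simp only: add_diff_cancel_right')
      finally have "y ^ Suc i * w = (a * [:l ^ k:]) * f + (b * y - a * r) * x" by (simp add: algebra_simps)
      then show ?thesis using w(1) by blast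
    qed
  qed
  have gen: "\<exists>c q r. c \<notin> P \<and> c * a = q * x + r * y" if "a \<in> P" for a
  proof -
    obtain k q r where "[:l ^ k:] * a = y * q + x * r" using reduce[OF \<open>a \<in> P\<close>] by blast
    then show ?thesis using l_power by (metis add.commute mult.commute)
  qed
  have prim: "\<exists>c n p q p' q'. c \<notin> P \<and> c * x ^ n = p * f1 + q * f2 \<and> c * y ^ n = p' * f1 + q' * f2"
    if f: "\<not> common_prime {f1, f2}" for f1 f2
  proof -
    have "\<not> x dvd f1 \<or> \<not> x dvd f2" using f x_prime by (auto simp: common_prime_def)
    then obtain f where f12: "f \<in> {f1, f2}" "\<not> x dvd f" by blast
    then have "f \<noteq> 0" by auto
    obtain h where h: "h \<noteq> 0" "[:h:] \<in> ideal.span {f1, f2}"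
      using eliminate_variable[OF f f12(1) \<open>f \<noteq> 0\<close>] by blast
    obtain p q where pq: "[:h:] = p * f1 + q * f2" using h(2) mem_span2 by blast
    obtain n h0 where h0: "h = x0 ^ n * h0" "\<not> x0 dvd h0" using divide_out_power[OF h(1) x0_pos] by blast
    have h0P: "[:h0:] \<notin> P" using h0(2) pI p_iff by blast
    have hx: "[:h:] = [:h0:] * x ^ n" unfolding h0(1) x_def by (simp add: poly_const_pow mult.commute)
    obtain i w a b where w: "w \<notin> P" "y ^ i * w = a * f + b * x" using y_power[OF f12(2)] by blast
    obtain g where g: "(a * f + b * x) ^ n = (a * f) * g + (b * x) ^ n" using power_add_cong by blast
    define c where "c = [:h0:] * w ^ n"
    have cP: "c \<notin> P" unfolding c_def
      using prime_ideal_not_mem_mult[OF P h0P prime_ideal_not_mem_power[OF P w(1)]] .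
    \<comment> \<open>\<open>x ^ n\<close> is in the ideal of \<open>f1, f2\<close> up to a unit, and \<open>y ^ i\<close> is up to a unit in the ideal of \<open>f\<close> and
      \<open>x\<close>; so the \<open>n\<close>-th power of \<open>y ^ i\<close> is in the ideal of \<open>f\<close> and \<open>x ^ n\<close>.\<close>
    have "c * x ^ (n + i * n) = (w ^ n * x ^ (i * n)) * [:h:]"
      unfolding c_def hx by (simp add: power_add algebra_simps)
    then have 1: "c * x ^ (n + i * n) = (w ^ n * x ^ (i * n) * p) * f1 + (w ^ n * x ^ (i * n) * q) * f2"
      unfolding pq by (simp add: algebra_simps)
    have "c * y ^ (n + i * n) = y ^ n * [:h0:] * (y ^ i * w) ^ n"
      unfolding c_def by (simp add: power_add power_mult power_mult_distrib algebra_simps)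
    also have "\<dots> = y ^ n * [:h0:] * a * g * f + y ^ n * b ^ n * ([:h0:] * x ^ n)"
      unfolding w(2) g by (simp add: power_mult_distrib algebra_simps)
    also have "\<dots> = y ^ n * [:h0:] * a * g * f + y ^ n * b ^ n * (p * f1 + q * f2)"
      unfolding hx[symmetric] pq ..
    finally have "c * y ^ (n + i * n) = y ^ n * [:h0:] * a * g * f + y ^ n * b ^ n * (p * f1 + q * f2)" .
    also have "\<dots> \<in> ideal.span {f1, f2}"
    proof (rule ideal.span_add)
      show "y ^ n * [:h0:] * a * g * f \<in> ideal.span {f1, f2}"
        using f12(1) by (intro ideal.span_scale ideal.span_base)
      show "y ^ n * b ^ n * (p * f1 + q * f2) \<in> ideal.span {f1, f2}"
        using mem_span2 by (intro ideal.span_scale) blast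
    qed
    finally obtain p' q' where "c * y ^ (n + i * n) = p' * f1 + q' * f2" using mem_span2 by blast
    then show ?thesis using 1 cP by (intro exI conjI)
  qed
  have "local_parameters P x y"
    unfolding local_parameters_def
    by (intro conjI ballI allI impI xP y(1) y(2) x_prime gen prim)
  then show ?thesis by blast
qed


section \<open>Bigraded polynomials as nested univariate polynomials\<close>

locale idom_iso =
  fixes \<phi> :: "'a::idom \<Rightarrow> 'b::idom"
  assumes hom_add: "\<phi> (a + b) = \<phi> a + \<phi> b" and hom_mult: "\<phi> (a * b) = \<phi> a * \<phi> b"
    and bij: "bij \<phi>"
begin

lemma hom_0: "\<phi> 0 = 0"
  by (metis hom_add add_0 add_cancel_left_left)

lemma hom_1: "\<phi> 1 = 1"
proof -
  obtain a where "\<phi> a = 1" using bij by (metis bij_pointE)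
  then show ?thesis using hom_mult[of 1 a] by simp
qed

lemma hom_eq_iff: "\<phi> a = \<phi> b \<longleftrightarrow> a = b"
  using bij by (simp add: bij_def inj_eq)

lemma hom_power: "\<phi> (a ^ n) = \<phi> a ^ n"
  by (induction n) (simp_all add: hom_1 hom_mult)

lemma preimage: obtains a where "\<phi> a = b"
  using bij by (metis bij_pointE)

lemma hom_dvd_iff: "\<phi> a dvd \<phi> b \<longleftrightarrow> a dvd b"
proof
  assume "\<phi> a dvd \<phi> b"
  then obtain c where "\<phi> b = \<phi> a * c" by (elim dvdE)
  moreover obtain c' where "\<phi> c' = c" by (rule preimage)
  ultimately have "b = a * c'" by (metis hom_mult hom_eq_iff)
  then show "a dvd b" by simp
qed (auto simp: hom_mult elim!: dvdE)

lemma hom_prime_elem_iff: "prime_elem (\<phi> p) \<longleftrightarrow> prime_elem p"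
proof
  assume p: "prime_elem (\<phi> p)"
  show "prime_elem p"
  proof (rule prime_elemI)
    show "p \<noteq> 0" using p hom_0 by auto
    show "\<not> p dvd 1" using p hom_dvd_iff[of p 1] hom_1 by (simp add: prime_elem_def)
    show "p dvd a \<or> p dvd b" if "p dvd a * b" for a b
      using prime_elem_dvd_multD[OF p, of "\<phi> a" "\<phi> b"] that
      by (simp add: hom_dvd_iff flip: hom_mult)
  qed
next
  assume p: "prime_elem p"
  show "prime_elem (\<phi> p)"
  proof (rule prime_elemI)
    show "\<phi> p \<noteq> 0" using p hom_0 hom_eq_iff[of p 0] by auto
    show "\<not> \<phi> p dvd 1" using p hom_dvd_iff[of p 1] hom_1 by (simp add: prime_elem_def)
    fix a b assume ab: "\<phi> p dvd a * b"
    obtain a' b' where a'b': "\<phi> a' = a" "\<phi> b' = b" by (metis preimage)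
    have "p dvd a' * b'" using ab unfolding a'b'[symmetric] hom_mult[symmetric] hom_dvd_iff .
    then show "\<phi> p dvd a \<or> \<phi> p dvd b"
      using prime_elem_dvd_multD[OF p, of a' b'] unfolding a'b'[symmetric] hom_dvd_iff by blast
  qed
qed

lemma hom_prime_product:
  assumes "prime_product (\<phi> a)"
  shows "prime_product a"
proof -
  have "prime_product a" if "prime_product z" "z = \<phi> a" for z a
    using that
  proof (induction z arbitrary: a rule: prime_product.induct)
    case (unit u)
    then show ?case using hom_dvd_iff[of a 1] hom_1 by (auto intro: prime_product.unit)
  next
    case (mult p b)
    obtain p' b' where *: "\<phi> p' = p" "\<phi> b' = b" by (metis preimage)
    then have "a = p' * b'" using mult.prems by (metis hom_mult hom_eq_iff)
    then show ?case using mult.hyps(1) mult.IH[of b'] *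
      by (auto intro!: prime_product.mult simp: hom_prime_elem_iff)
  qed
  then show ?thesis using assms by blast
qed

lemma hom_common_prime: "common_prime (\<phi> ` F) \<longleftrightarrow> common_prime F"
proof
  assume "common_prime (\<phi> ` F)"
  then obtain p where p: "prime_elem p" "\<And>f. f \<in> F \<Longrightarrow> p dvd \<phi> f" by (auto simp: common_prime_def)
  obtain q where "\<phi> q = p" by (rule preimage)
  then show "common_prime F" using p unfolding common_prime_def
    by (intro exI[of _ q]) (auto simp: hom_prime_elem_iff hom_dvd_iff)
next
  assume "common_prime F"
  then obtain p where "prime_elem p" "\<And>f. f \<in> F \<Longrightarrow> p dvd f" by (auto simp: common_prime_def)
  then show "common_prime (\<phi> ` F)" unfolding common_prime_def
    by (intro exI[of _ "\<phi> p"]) (auto simp: hom_prime_elem_iff hom_dvd_iff)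
qed

lemma hom_mem_image: "\<phi> a \<in> \<phi> ` P \<longleftrightarrow> a \<in> P"
  using hom_eq_iff by auto

lemma hom_prime_ideal:
  assumes "prime_ideal P"
  shows "prime_ideal (\<phi> ` P)"
  unfolding prime_ideal_def
proof (intro conjI allI impI)
  note sub = prime_idealD(1)[OF assms]
  show "ideal.subspace (\<phi> ` P)"
  proof (rule idealI)
    show "0 \<in> \<phi> ` P" using hom_mem_image[of 0] hom_0 ideal.subspace_0[OF sub] by simp
    show "a + b \<in> \<phi> ` P" if "a \<in> \<phi> ` P" "b \<in> \<phi> ` P" for a b
      using that ideal.subspace_add[OF sub] by (auto simp: hom_mem_image simp flip: hom_add)
    fix r a assume "a \<in> \<phi> ` P"
    then obtain a' where "a = \<phi> a'" "a' \<in> P" by blast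
    moreover obtain r' where "\<phi> r' = r" by (rule preimage)
    ultimately show "r * a \<in> \<phi> ` P"
      using ideal_mult_left[OF sub, of a' r'] by (auto simp: hom_mem_image simp flip: hom_mult)
  qed
  have "\<phi> 1 \<notin> \<phi> ` P" using hom_mem_image prime_idealD(2)[OF assms] by blast
  then show "\<phi> ` P \<noteq> UNIV" by blast
  fix a b assume ab: "a * b \<in> \<phi> ` P"
  obtain a' where a': "\<phi> a' = a" by (rule preimage)
  obtain b' where b': "\<phi> b' = b" by (rule preimage)
  have "a' * b' \<in> P" using ab a' b' hom_mem_image[of "a' * b'" P] by (simp add: hom_mult)
  then show "a \<in> \<phi> ` P \<or> b \<in> \<phi> ` P" using prime_idealD(3)[OF assms] a' b' by blast
qed

lemma local_parameters_preimage:
  assumes "local_parameters (\<phi> ` P) (\<phi> x) (\<phi> y)"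
  shows "local_parameters P x y"
proof -
  note lp = assms[unfolded local_parameters_def]
  have 1: "x \<in> P" "y \<in> P" "prime_elem x" "\<not> x dvd y"
    using lp by (auto simp: hom_mem_image hom_prime_elem_iff hom_dvd_iff)
  have 2: "\<exists>c q r. c \<notin> P \<and> c * a = q * x + r * y" if "a \<in> P" for a
  proof -
    have "\<phi> a \<in> \<phi> ` P" using that by simp
    then obtain c q r where c: "c \<notin> \<phi> ` P" "c * \<phi> a = q * \<phi> x + r * \<phi> y" using lp by meson
    obtain c' where c': "\<phi> c' = c" by (rule preimage)
    obtain q' where q': "\<phi> q' = q" by (rule preimage)
    obtain r' where r': "\<phi> r' = r" by (rule preimage)
    have "\<phi> (c' * a) = \<phi> (q' * x + r' * y)" using c(2) c' q' r' by (simp add: hom_mult hom_add)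
    moreover have "c' \<notin> P" using c(1) c' by blast
    ultimately show ?thesis using hom_eq_iff by blast
  qed
  have 3: "\<exists>c n p q p' q'. c \<notin> P \<and> c * x ^ n = p * f1 + q * f2 \<and> c * y ^ n = p' * f1 + q' * f2"
    if "\<not> common_prime {f1, f2}" for f1 f2
  proof -
    have "\<not> common_prime {\<phi> f1, \<phi> f2}" using that hom_common_prime[of "{f1, f2}"] by simp
    then obtain c n p q p' q' where c: "c \<notin> \<phi> ` P" "c * \<phi> x ^ n = p * \<phi> f1 + q * \<phi> f2"
        "c * \<phi> y ^ n = p' * \<phi> f1 + q' * \<phi> f2"
      using lp by meson
    obtain c0 where c0: "\<phi> c0 = c" by (rule preimage)
    obtain p0 where p0: "\<phi> p0 = p" by (rule preimage)
    obtain q0 where q0: "\<phi> q0 = q" by (rule preimage)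
    obtain p1 where p1: "\<phi> p1 = p'" by (rule preimage)
    obtain q1 where q1: "\<phi> q1 = q'" by (rule preimage)
    have "\<phi> (c0 * x ^ n) = \<phi> (p0 * f1 + q0 * f2)" "\<phi> (c0 * y ^ n) = \<phi> (p1 * f1 + q1 * f2)"
      using c(2,3) c0 p0 q0 p1 q1 by (simp_all add: hom_mult hom_add hom_power)
    moreover have "c0 \<notin> P" using c(1) c0 by blast
    ultimately show ?thesis using hom_eq_iff by blast
  qed
  show ?thesis unfolding local_parameters_def by (intro conjI ballI allI impI 1 2 3)
qed

end

lemma sum_single: "(\<Sum>e\<in>Poly_Mapping.keys f. Poly_Mapping.single e (Poly_Mapping.lookup f e)) = f"
  by (rule poly_mapping_eqI)
    (auto simp: lookup_sum lookup_single when_def in_keys_iff)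

context
  fixes x y z w :: bivar
  assumes vars: "{x, y, z, w} = UNIV"
begin

text \<open>The variables \<open>x\<close> and \<open>y\<close> form the constants \<open>'k poly poly\<close>, and \<open>z\<close> and \<open>w\<close> are the two outer
  variables. At a point where \<open>x\<close> and \<open>y\<close> do not vanish, \<open>z / x\<close> and \<open>w / y\<close> are affine coordinates.\<close>

definition nested_monom :: "(bivar \<Rightarrow>\<^sub>0 nat) \<Rightarrow> 'k::field \<Rightarrow> 'k poly poly poly poly" where
  "nested_monom e c = monom (monom (monom (monom c (Poly_Mapping.lookup e x)) (Poly_Mapping.lookup e y))
     (Poly_Mapping.lookup e z)) (Poly_Mapping.lookup e w)"

definition nested :: "'k::field bipoly \<Rightarrow> 'k poly poly poly poly" where
  "nested f = (\<Sum>e\<in>Poly_Mapping.keys f. nested_monom e (Poly_Mapping.lookup f e))"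

lemma nested_monom_0 [simp]: "nested_monom e 0 = 0"
  by (simp add: nested_monom_def)

lemma nested_monom_add: "nested_monom e (a + b) = nested_monom e a + nested_monom e b"
  by (simp add: nested_monom_def add_monom)

lemma nested_superset:
  assumes "finite S" "Poly_Mapping.keys f \<subseteq> S"
  shows "nested f = (\<Sum>e\<in>S. nested_monom e (Poly_Mapping.lookup f e))"
  unfolding nested_def using assms by (intro sum.mono_neutral_left) (auto simp: in_keys_iff)

lemma nested_add: "nested (f + g) = nested f + nested g"
proof -
  let ?S = "Poly_Mapping.keys f \<union> Poly_Mapping.keys g"
  have "nested (f + g) = (\<Sum>e\<in>?S. nested_monom e (Poly_Mapping.lookup (f + g) e))"
    by (rule nested_superset) (simp_all add: keys_add)
  also have "\<dots> = nested f + nested g"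
    by (simp add: lookup_add nested_monom_add sum.distrib nested_superset[of ?S])
  finally show ?thesis .
qed

lemma nested_sum: "nested (sum f A) = (\<Sum>a\<in>A. nested (f a))"
  by (induction A rule: infinite_finite_induct) (simp_all add: nested_add nested_def[of 0])

lemma nested_single: "nested (Poly_Mapping.single e c) = nested_monom e c"
  by (cases "c = 0") (simp_all add: nested_def)

lemma nested_mult:
  fixes f g :: "'k::field bipoly"
  shows "nested (f * g) = nested f * nested g"
proof -
  let ?l = Poly_Mapping.lookup
  have single: "nested_monom (e + e') (c * c') = nested_monom e c * nested_monom e' c'" for e e' and c c' :: 'k
    by (simp add: nested_monom_def mult_monom lookup_add)
  have "f * g = (\<Sum>e\<in>Poly_Mapping.keys f. Poly_Mapping.single e (?l f e))
      * (\<Sum>e\<in>Poly_Mapping.keys g. Poly_Mapping.single e (?l g e))"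
    by (simp only: sum_single)
  also have "\<dots> = (\<Sum>e\<in>Poly_Mapping.keys f. \<Sum>e'\<in>Poly_Mapping.keys g. Poly_Mapping.single (e + e') (?l f e * ?l g e'))"
    by (simp only: sum_product mult_single)
  finally have "nested (f * g)
      = (\<Sum>e\<in>Poly_Mapping.keys f. \<Sum>e'\<in>Poly_Mapping.keys g. nested_monom e (?l f e) * nested_monom e' (?l g e'))"
    by (simp only: nested_sum nested_single single)
  then show ?thesis by (simp only: nested_def sum_product)
qed

lemma exponent_eqI:
  assumes "Poly_Mapping.lookup e x = Poly_Mapping.lookup e' x" "Poly_Mapping.lookup e y = Poly_Mapping.lookup e' y"
    "Poly_Mapping.lookup e z = Poly_Mapping.lookup e' z" "Poly_Mapping.lookup e w = Poly_Mapping.lookup e' w"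
  shows "e = e'"
proof (rule poly_mapping_eqI)
  fix v
  have "v \<in> {x, y, z, w}" using vars by simp
  then show "Poly_Mapping.lookup e v = Poly_Mapping.lookup e' v" using assms by auto
qed

lemma coeff_nested:
  "coeff (coeff (coeff (coeff (nested f) (Poly_Mapping.lookup e w)) (Poly_Mapping.lookup e z))
     (Poly_Mapping.lookup e y)) (Poly_Mapping.lookup e x) = Poly_Mapping.lookup f e"
proof -
  let ?C = "\<lambda>q. coeff (coeff (coeff (coeff q (Poly_Mapping.lookup e w)) (Poly_Mapping.lookup e z))
     (Poly_Mapping.lookup e y)) (Poly_Mapping.lookup e x)"
  have "?C (nested f) = (\<Sum>e'\<in>Poly_Mapping.keys f. ?C (nested_monom e' (Poly_Mapping.lookup f e')))"
    by (simp add: nested_def coeff_sum)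
  also have "\<dots> = (\<Sum>e'\<in>Poly_Mapping.keys f. if e' = e then Poly_Mapping.lookup f e else 0)"
  proof (rule sum.cong[OF refl])
    fix e'
    show "?C (nested_monom e' (Poly_Mapping.lookup f e')) = (if e' = e then Poly_Mapping.lookup f e else 0)"
      using exponent_eqI[of e' e] by (auto simp: nested_monom_def)
  qed
  also have "\<dots> = Poly_Mapping.lookup f e" by (simp add: in_keys_iff)
  finally show ?thesis .
qed

text \<open>Applied to one layer of coefficients at a time, this shows that monomials span the nested ring.\<close>

lemma additive_poly_image:
  fixes h :: "'a::comm_monoid_add poly \<Rightarrow> 'b::comm_monoid_add"
  assumes S: "0 \<in> S" "\<And>a b. a \<in> S \<Longrightarrow> b \<in> S \<Longrightarrow> a + b \<in> S"
    and h: "h 0 = 0" "\<And>p q. h (p + q) = h p + h q" "\<And>c i. h (monom c i) \<in> S"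
  shows "h p \<in> S"
proof -
  have hs: "h (sum f A) = (\<Sum>a\<in>A. h (f a))" for f and A :: "nat set"
    by (induction A rule: infinite_finite_induct) (simp_all add: h)
  have "(\<Sum>i\<in>A. h (monom (coeff p i) i)) \<in> S" for A :: "nat set"
    by (induction A rule: infinite_finite_induct) (auto intro: S h(3))
  then show ?thesis using hs[of "\<lambda>i. monom (coeff p i) i" "{..degree p}"]
    by (simp add: poly_as_sum_of_monoms)
qed

lemma nested_surj: "\<exists>f. nested f = q"
proof -
  let ?S = "range (nested :: 'k::field bipoly \<Rightarrow> _)"
  have S0: "0 \<in> ?S" using nested_def[of 0] by (auto intro!: image_eqI[of _ _ 0])
  have S_add: "a + b \<in> ?S" if "a \<in> ?S" "b \<in> ?S" for a b
    using that by (auto simp flip: nested_add)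
  have monom_S: "monom (monom (monom (monom c i) j) k) l \<in> ?S" for c i j k l
  proof -
    define e where "e = Poly_Mapping.single x i + Poly_Mapping.single y j
      + Poly_Mapping.single z k + Poly_Mapping.single w l"
    have U: "(UNIV :: bivar set) = {Var_s, Var_u, Var_t, Var_v}" using bivar.exhaust by auto
    have "card (UNIV :: bivar set) = 4" unfolding U by simp
    then have "card (set [x, y, z, w]) = length [x, y, z, w]" using vars by simp
    then have "distinct [x, y, z, w]" by (rule card_distinct)
    then have "nested_monom e c = monom (monom (monom (monom c i) j) k) l"
      by (auto simp: nested_monom_def e_def lookup_add lookup_single when_def)
    then show ?thesis using nested_single[of e c] by (metis rangeI)
  qed
  have 1: "monom (monom (monom q j) k) l \<in> ?S" for q j k l
    by (rule additive_poly_image[OF S0 S_add, where h = "\<lambda>q. monom (monom (monom q j) k) l"])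
      (simp_all add: monom_S add_monom[symmetric])
  have 2: "monom (monom q k) l \<in> ?S" for q k l
    by (rule additive_poly_image[OF S0 S_add, where h = "\<lambda>q. monom (monom q k) l"])
      (simp_all add: 1 add_monom[symmetric])
  have 3: "monom q l \<in> ?S" for q l
    by (rule additive_poly_image[OF S0 S_add, where h = "\<lambda>q. monom q l"])
      (simp_all add: 2 add_monom[symmetric])
  have "q \<in> ?S"
    by (rule additive_poly_image[OF S0 S_add, where h = "\<lambda>q. q"]) (simp_all add: 3)
  then show ?thesis by auto
qed

lemma nested_iso: "idom_iso (nested :: 'k::field bipoly \<Rightarrow> _)"
proof
  show "bij (nested :: 'k bipoly \<Rightarrow> _)"
  proof (rule bijI)
    show "inj (nested :: 'k bipoly \<Rightarrow> _)"
      by (rule injI, rule poly_mapping_eqI) (metis coeff_nested)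
    show "surj (nested :: 'k bipoly \<Rightarrow> _)" unfolding surj_def using nested_surj by metis
  qed
qed (rule nested_add nested_mult)+

lemma nested_constant:
  assumes "nested f = [:[:c:]:]" "e \<in> Poly_Mapping.keys f"
  shows "Poly_Mapping.lookup e z = 0" "Poly_Mapping.lookup e w = 0"
proof -
  have "coeff (coeff (coeff (coeff (nested f) (Poly_Mapping.lookup e w)) (Poly_Mapping.lookup e z))
     (Poly_Mapping.lookup e y)) (Poly_Mapping.lookup e x) \<noteq> 0"
    using assms(2) by (simp add: coeff_nested in_keys_iff)
  then show "Poly_Mapping.lookup e z = 0" "Poly_Mapping.lookup e w = 0"
    unfolding assms(1) by (cases "Poly_Mapping.lookup e w"; cases "Poly_Mapping.lookup e z"; simp)+
qed

end

lemma prime_product_bipoly: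
  fixes f :: "'k::field bipoly"
  assumes "f \<noteq> 0"
  shows "prime_product f"
proof -
  have vars: "{Var_s, Var_u, Var_t, Var_v} = UNIV" using bivar.exhaust by auto
  interpret idom_iso "nested Var_s Var_u Var_t Var_v :: 'k bipoly \<Rightarrow> _" by (rule nested_iso[OF vars])
  have "nested Var_s Var_u Var_t Var_v f \<noteq> 0" using assms hom_eq_iff[of f 0] hom_0 by simp
  then show ?thesis using hom_prime_product prime_product_ufd by blast
qed

lemma var_power: "var v ^ n = Poly_Mapping.single (Poly_Mapping.single v n) 1"
  by (induction n) (simp_all add: var_def mult_single single_add[symmetric])

text \<open>A bihomogeneous polynomial in \<open>x\<close> and \<open>y\<close> alone is a multiple of a monomial \<open>x ^ i * y ^ j\<close> and does
  not vanish at \<open>P\<close>. As \<open>P\<close> is homogeneous, it contains no nonzero polynomial in \<open>x\<close> and \<open>y\<close> alone.\<close>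

lemma local_parameters_exist:
  fixes P :: "'k::field bipoly set"
  assumes P: "prime_ideal P" "homogeneous P"
    and x: "(x, z) \<in> {(Var_s, Var_u), (Var_u, Var_s)}" "var x \<notin> P"
    and y: "(y, w) \<in> {(Var_t, Var_v), (Var_v, Var_t)}" "var y \<notin> P"
    and F: "F \<subseteq> P" "\<not> common_prime F" "f0 \<in> F" "f0 \<noteq> 0"
  shows "\<exists>a b. local_parameters P a b"
proof -
  have vars: "{x, y, z, w} = UNIV" using x(1) y(1) bivar.exhaust by auto
  interpret idom_iso "nested x y z w :: 'k bipoly \<Rightarrow> _" by (rule nested_iso[OF vars])
  let ?n = "nested x y z w :: 'k bipoly \<Rightarrow> _"
  have const: "c = 0" if c: "[:[:c:]:] \<in> ?n ` P" for c
  proof -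
    obtain f where f: "f \<in> P" "?n f = [:[:c:]:]" using c by auto
    have e0: "Poly_Mapping.lookup e z = 0" "Poly_Mapping.lookup e w = 0" if "e \<in> Poly_Mapping.keys f" for e
      using nested_constant[OF vars f(2) that] by auto
    have "Poly_Mapping.keys f = {}"
    proof (rule ccontr)
      assume "\<not> ?thesis"
      then obtain e where e: "e \<in> Poly_Mapping.keys f" by blast
      define r where "r = Poly_Mapping.lookup f e"
      have r0: "r \<noteq> 0" using e by (simp add: r_def in_keys_iff)
      have deg: "bidegree d = (int (Poly_Mapping.lookup d x + Poly_Mapping.lookup d z),
          int (Poly_Mapping.lookup d y + Poly_Mapping.lookup d w))" for d
        using x(1) y(1) by (auto simp: bidegree_def)
      have eq: "d = e" if "d \<in> Poly_Mapping.keys f" "bidegree d = bidegree e" for d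
        using that e0[OF that(1)] e0[OF e] deg[of d] deg[of e] by (intro exponent_eqI[OF vars]) auto
      have "component (bidegree e) f = Poly_Mapping.single e r"
        by (rule poly_mapping_eqI)
          (use eq in \<open>auto simp: lookup_component lookup_single when_def r_def in_keys_iff\<close>)
      then have "Poly_Mapping.single e r \<in> P" using homogeneousD[OF P(2) f(1), of "bidegree e"] by simp
      then have "Poly_Mapping.single 0 (inverse r) * Poly_Mapping.single e r \<in> P"
        by (rule ideal_mult_left[OF prime_idealD(1)[OF P(1)]])
      then have "Poly_Mapping.single e 1 \<in> P" using r0 by (simp add: mult_single)
      moreover have "e = Poly_Mapping.single x (Poly_Mapping.lookup e x) + Poly_Mapping.single y (Poly_Mapping.lookup e y)"
        using x(1) y(1) e0[OF e]
        by (intro exponent_eqI[OF vars]) (auto simp: lookup_add lookup_single when_def)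
      ultimately have "var x ^ Poly_Mapping.lookup e x * var y ^ Poly_Mapping.lookup e y \<in> P"
        by (simp add: var_power mult_single)
      then show False
        using prime_ideal_not_mem_mult[OF P(1) prime_ideal_not_mem_power[OF P(1) x(2)]
          prime_ideal_not_mem_power[OF P(1) y(2)]] by blast
    qed
    then show ?thesis using f(2) hom_0 by simp
  qed
  have "\<exists>a b. local_parameters (?n ` P) a b"
  proof (rule local_parameters_nested[OF hom_prime_ideal[OF P(1)] const])
    show "?n ` F \<subseteq> ?n ` P" using F(1) by blast
    show "\<not> common_prime (?n ` F)" using F(2) hom_common_prime by blast
    show "?n f0 \<in> ?n ` F" using F(3) by blast
    show "?n f0 \<noteq> 0" using F(4) hom_eq_iff[of f0 0] hom_0 by simp
  qed
  then obtain a b where ab: "local_parameters (?n ` P) a b" by blast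
  obtain a' where "?n a' = a" by (rule preimage)
  moreover obtain b' where "?n b' = b" by (rule preimage)
  ultimately show ?thesis using ab local_parameters_preimage by blast
qed


section \<open>Three-generated ideals in a two-dimensional regular local ring\<close>

text \<open>The local ring \<open>A\<close>, inside its fraction field, of a closed point on a regular surface, with maximal
  ideal \<open>M\<close> and parameters \<open>x, y\<close>. The last assumption combines two facts. Two elements have a greatest
  common divisor \<open>d\<close>; the cofactors \<open>f', g'\<close> then form a regular sequence or generate the unit ideal. And
  an ideal generated by such a pair contains a power of \<open>M\<close>.\<close>

locale regular_surface_point = subring_carrier A for A :: "'f::field set" +
  fixes M :: "'f set" and x y :: 'f
  assumes M_add: "a \<in> M \<Longrightarrow> b \<in> M \<Longrightarrow> a + b \<in> M"
    and M_mult: "r \<in> A \<Longrightarrow> a \<in> M \<Longrightarrow> r * a \<in> M"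
    and M_sub: "M \<subseteq> A" and one_notin_M: "1 \<notin> M"
    and unit: "a \<in> A \<Longrightarrow> a \<notin> M \<Longrightarrow> inverse a \<in> A"
    and xM: "x \<in> M" and yM: "y \<in> M" and x_nonzero: "x \<noteq> 0" and y_nonzero: "y \<noteq> 0"
    and M_gen: "a \<in> M \<Longrightarrow> \<exists>p\<in>A. \<exists>q\<in>A. a = x * p + y * q"
    and regular: "a \<in> A \<Longrightarrow> b \<in> A \<Longrightarrow> x * a = y * b \<Longrightarrow> \<exists>c\<in>A. a = y * c \<and> b = x * c"
    and common_factor: "f \<in> A \<Longrightarrow> g \<in> A \<Longrightarrow> f \<noteq> 0 \<or> g \<noteq> 0 \<Longrightarrow>
      \<exists>d\<in>A. \<exists>f'\<in>A. \<exists>g'\<in>A. f = d * f' \<and> g = d * g' \<and>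
        (\<forall>a\<in>A. \<forall>b\<in>A. a * f' = b * g' \<longrightarrow> (\<exists>c\<in>A. a = c * g' \<and> b = c * f')) \<and>
        (\<exists>n. (\<exists>p\<in>A. \<exists>q\<in>A. x ^ n = p * f' + q * g') \<and> (\<exists>p\<in>A. \<exists>q\<in>A. y ^ n = p * f' + q * g'))"
begin

lemma xA [simp]: "x \<in> A" and yA [simp]: "y \<in> A"
  using xM yM M_sub by auto

lemma MA: "a \<in> M \<Longrightarrow> a \<in> A"
  using M_sub by auto

text \<open>Multiply \<open>f3\<close> by \<open>x\<close> and then by \<open>y\<close> as often as it stays outside of the ideal of \<open>f1, f2\<close>.\<close>

lemma socle_element:
  assumes f3: "f3 \<in> A" and nin: "\<not> (\<exists>p\<in>A. \<exists>q\<in>A. f3 = p * f1 + q * f2)"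
    and n: "\<exists>p\<in>A. \<exists>q\<in>A. x ^ n = p * f1 + q * f2" "\<exists>p\<in>A. \<exists>q\<in>A. y ^ n = p * f1 + q * f2"
  shows "\<exists>r\<in>A. \<not> (\<exists>p\<in>A. \<exists>q\<in>A. r * f3 = p * f1 + q * f2) \<and>
    (\<exists>p\<in>A. \<exists>q\<in>A. x * (r * f3) = p * f1 + q * f2) \<and> (\<exists>p\<in>A. \<exists>q\<in>A. y * (r * f3) = p * f1 + q * f2)"
proof -
  define I where "I = {p * f1 + q * f2 |p q. p \<in> A \<and> q \<in> A}"
  have I_iff: "(\<exists>p\<in>A. \<exists>q\<in>A. a = p * f1 + q * f2) \<longleftrightarrow> a \<in> I" for a by (auto simp: I_def)
  have I_mult: "r * a \<in> I" if "r \<in> A" "a \<in> I" for r a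
  proof -
    obtain p q where "a = p * f1 + q * f2" "p \<in> A" "q \<in> A" using \<open>a \<in> I\<close> by (auto simp: I_def)
    then have "r * a = (r * p) * f1 + (r * q) * f2" "r * p \<in> A" "r * q \<in> A"
      using \<open>r \<in> A\<close> by (auto simp: algebra_simps)
    then show ?thesis unfolding I_def by blast
  qed
  have step: "\<exists>i. z ^ i * a \<notin> I \<and> z * (z ^ i * a) \<in> I" if "z \<in> A" "z ^ n \<in> I" "a \<in> A" "a \<notin> I" for z a
  proof -
    define k where "k = (LEAST k. z ^ k * a \<in> I)"
    have "z ^ n * a \<in> I" using I_mult[OF that(3,2)] by (simp add: mult.commute)
    then have "z ^ k * a \<in> I" unfolding k_def by (rule LeastI)
    moreover have "k \<noteq> 0" using calculation that(4) by (intro notI) simp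
    then obtain i where i: "k = Suc i" using not0_implies_Suc by blast
    moreover have "z ^ i * a \<notin> I" using not_less_Least[of i "\<lambda>k. z ^ k * a \<in> I"] i by (simp add: k_def)
    ultimately show ?thesis by (intro exI[of _ i]) (simp add: mult.assoc)
  qed
  have xn: "x ^ n \<in> I" and yn: "y ^ n \<in> I" and f3I: "f3 \<notin> I" using n nin by (auto simp: I_iff)
  obtain i where i: "x ^ i * f3 \<notin> I" "x * (x ^ i * f3) \<in> I" using step[OF xA xn f3 f3I] by blast
  have "x ^ i * f3 \<in> A" using f3 by simp
  from step[OF yA yn this i(1)]
  obtain j where j: "y ^ j * (x ^ i * f3) \<notin> I" "y * (y ^ j * (x ^ i * f3)) \<in> I" by blast
  have "y ^ j * (x * (x ^ i * f3)) \<in> I" using I_mult[OF _ i(2)] by simp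
  then have "x * (y ^ j * (x ^ i * f3)) \<in> I" by (simp only: mult.left_commute)
  then show ?thesis unfolding I_iff using j
    by (intro bexI[of _ "y ^ j * x ^ i"]) (simp_all add: mult.assoc)
qed

text \<open>The Koszul syzygy \<open>(f2, -f1, 0)\<close> is \<open>x p + y q\<close> with syzygies \<open>p, q\<close>, so it lies in \<open>M\<close> times the
  module of syzygies.\<close>

definition koszul_reducible :: "'f \<Rightarrow> 'f \<Rightarrow> 'f \<Rightarrow> bool" where
  "koszul_reducible f1 f2 f3 \<longleftrightarrow> (\<exists>p1\<in>A. \<exists>p2\<in>A. \<exists>p3\<in>A. \<exists>q1\<in>A. \<exists>q2\<in>A. \<exists>q3\<in>A.
     p1 * f1 + p2 * f2 + p3 * f3 = 0 \<and> q1 * f1 + q2 * f2 + q3 * f3 = 0 \<and>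
     f2 = x * p1 + y * q1 \<and> - f1 = x * p2 + y * q2 \<and> 0 = x * p3 + y * q3)"

text \<open>Write \<open>f1 = x a1 + y b1\<close> and \<open>f2 = x a2 + y b2\<close>. Then \<open>(f2, -f1, 0) = x (a2, -a1, 0) + y (b2, -b1, 0)\<close>, but
  the two vectors pair with \<open>f\<close> to \<open>y D\<close> and \<open>- x D\<close>, where \<open>D = a1 b2 - a2 b1\<close>. They can be corrected to
  syzygies if \<open>D\<close> lies in the ideal of \<open>f1, f2, f3\<close>. A common factor of \<open>f1\<close> and \<open>f2\<close> in \<open>M\<close> makes the
  Koszul syzygy reducible at once. Otherwise \<open>f1, f2\<close> is a regular sequence, and \<open>D\<close> generates the socle
  modulo \<open>f1, f2\<close>, because the quotient is Gorenstein; so \<open>D\<close> lies in every strictly larger ideal.\<close>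

lemma generator_redundant:
  assumes f: "f1 \<in> M" "f2 \<in> M" "f3 \<in> M" and nred: "\<not> koszul_reducible f1 f2 f3"
  shows "\<exists>p\<in>A. \<exists>q\<in>A. f3 = p * f1 + q * f2"
proof (rule ccontr)
  assume nin: "\<not> ?thesis"
  have "f1 \<noteq> 0 \<or> f2 \<noteq> 0"
  proof (rule ccontr)
    assume "\<not> ?thesis"
    then have "koszul_reducible f1 f2 f3" unfolding koszul_reducible_def
      by (intro bexI[of _ 0] conjI) simp_all
    then show False using nred by blast
  qed
  from common_factor[OF MA[OF f(1)] MA[OF f(2)] this]
  obtain d g1 g2 where d: "d \<in> A" "g1 \<in> A" "g2 \<in> A" "f1 = d * g1" "f2 = d * g2"
    and cop: "\<forall>a\<in>A. \<forall>b\<in>A. a * g1 = b * g2 \<longrightarrow> (\<exists>c\<in>A. a = c * g2 \<and> b = c * g1)"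
    and "\<exists>n. (\<exists>p\<in>A. \<exists>q\<in>A. x ^ n = p * g1 + q * g2) \<and> (\<exists>p\<in>A. \<exists>q\<in>A. y ^ n = p * g1 + q * g2)"
    by (elim bexE conjE) (rule that)
  then obtain n where n: "\<exists>p\<in>A. \<exists>q\<in>A. x ^ n = p * g1 + q * g2"
      "\<exists>p\<in>A. \<exists>q\<in>A. y ^ n = p * g1 + q * g2"
    by (elim exE conjE) (rule that)
  have "d \<notin> M"
  proof
    assume "d \<in> M"
    then obtain a b where ab: "a \<in> A" "b \<in> A" "d = x * a + y * b" using M_gen by blast
    have "koszul_reducible f1 f2 f3" unfolding koszul_reducible_def
      by (rule bexI[of _ "a * g2"], rule bexI[of _ "- (a * g1)"], rule bexI[of _ 0],
          rule bexI[of _ "b * g2"], rule bexI[of _ "- (b * g1)"], rule bexI[of _ 0])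
        (use d ab in \<open>auto simp: algebra_simps\<close>)
    then show False using nred by blast
  qed
  then have d': "inverse d \<in> A" "d \<noteq> 0" using unit[OF d(1)] M_mult[of 0 x] xM by auto
  have g: "g1 = inverse d * f1" "g2 = inverse d * f2" using d d'(2) by simp_all
  have fA: "f1 \<in> A" "f2 \<in> A" "f3 \<in> A" using f MA by auto
  have cop: "\<exists>c\<in>A. a = c * f2 \<and> b = c * f1" if ab: "a \<in> A" "b \<in> A" "a * f1 = b * f2" for a b
  proof -
    have "a * g1 = b * g2" using ab(3) by (simp add: g mult.left_commute)
    then have "\<exists>c\<in>A. a = c * g2 \<and> b = c * g1" by (rule cop[rule_format, OF ab(1,2)])
    then obtain c where "c \<in> A" "a = c * g2" "b = c * g1" by (elim bexE conjE) (rule that)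
    then show ?thesis using d'(1) by (intro bexI[of _ "c * inverse d"]) (simp_all add: g mult.assoc)
  qed
  have pow: "\<exists>p\<in>A. \<exists>q\<in>A. a = p * f1 + q * f2" if h: "\<exists>p\<in>A. \<exists>q\<in>A. a = p * g1 + q * g2" for a
  proof -
    obtain p q where "p \<in> A" "q \<in> A" "a = p * g1 + q * g2" using h by blast
    then show ?thesis using d'(1)
      by (intro bexI[of _ "p * inverse d"] bexI[of _ "q * inverse d"]) (simp_all add: g mult.assoc)
  qed
  \<comment> \<open>The socle element \<open>r * f3\<close> turns out to be \<open>c * D\<close> modulo \<open>f1, f2\<close>. Since \<open>x * D\<close> and \<open>y * D\<close> are in the
    ideal of \<open>f1, f2\<close> but \<open>r * f3\<close> is not, \<open>c\<close> is a unit.\<close>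
  obtain r p1 q1 p2 q2 where r: "r \<in> A" "\<not> (\<exists>p\<in>A. \<exists>q\<in>A. r * f3 = p * f1 + q * f2)"
    and z: "p1 \<in> A" "q1 \<in> A" "p2 \<in> A" "q2 \<in> A"
      "x * (r * f3) = p1 * f1 + q1 * f2" "y * (r * f3) = p2 * f1 + q2 * f2"
    using socle_element[OF fA(3) nin pow[OF n(1)] pow[OF n(2)]]
    by (elim bexE conjE) (rule that)
  obtain a1 b1 where ab1: "a1 \<in> A" "b1 \<in> A" "f1 = x * a1 + y * b1" using M_gen[OF f(1)] by blast
  obtain a2 b2 where ab2: "a2 \<in> A" "b2 \<in> A" "f2 = x * a2 + y * b2" using M_gen[OF f(2)] by blast
  define D where "D = a1 * b2 - a2 * b1"
  have xD: "x * D = b2 * f1 - b1 * f2" and yD: "y * D = a1 * f2 - a2 * f1"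
    by (simp_all add: D_def ab1(3) ab2(3) algebra_simps)
  have "(y * p1 - x * p2) * f1 = (x * q2 - y * q1) * f2"
  proof -
    have "y * (p1 * f1 + q1 * f2) = x * (p2 * f1 + q2 * f2)" using z(5,6) by (simp add: mult.left_commute flip: z(5,6))
    then show ?thesis by (simp add: algebra_simps)
  qed
  then obtain c where c: "c \<in> A" "y * p1 - x * p2 = c * f2" "x * q2 - y * q1 = c * f1"
    using cop[of "y * p1 - x * p2" "x * q2 - y * q1"] z by auto
  have "x * (- p2 - c * a2) = y * (c * b2 - p1)" using c(2) by (simp add: ab2(3) algebra_simps)
  then obtain p where p: "p \<in> A" "c * b2 - p1 = x * p"
    using regular[of "- p2 - c * a2" "c * b2 - p1"] z c(1) ab2 by auto
  have "x * (q2 - c * a1) = y * (c * b1 + q1)" using c(3) by (simp add: ab1(3) algebra_simps)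
  then obtain q where q: "q \<in> A" "c * b1 + q1 = x * q"
    using regular[of "q2 - c * a1" "c * b1 + q1"] z c(1) ab1 by auto
  have "x * (r * f3) = x * (c * D - p * f1 + q * f2)"
  proof -
    have p1: "p1 = c * b2 - x * p" and q1: "q1 = x * q - c * b1"
      using p(2) q(2) by (simp_all add: algebra_simps)
    have "x * (r * f3) = c * (b2 * f1 - b1 * f2) + x * (q * f2 - p * f1)"
      unfolding z(5) p1 q1 by (simp add: algebra_simps)
    then show ?thesis unfolding xD[symmetric] by (simp add: algebra_simps)
  qed
  then have rf3: "r * f3 = c * D - p * f1 + q * f2" using x_nonzero by (simp only: mult_cancel_left) simp
  have "c \<notin> M"
  proof
    assume "c \<in> M"
    then obtain a b where ab: "a \<in> A" "b \<in> A" "c = x * a + y * b" using M_gen by blast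
    have "c * D = a * (x * D) + b * (y * D)" by (simp add: ab(3) algebra_simps)
    then have "r * f3 = (a * b2 - b * a2 - p) * f1 + (b * a1 - a * b1 + q) * f2"
      unfolding rf3 xD yD by (simp add: algebra_simps)
    moreover have "a * b2 - b * a2 - p \<in> A" "b * a1 - a * b1 + q \<in> A" using ab ab1 ab2 p q by auto
    ultimately show False using r(2) by blast
  qed
  then have c': "inverse c \<in> A" "c \<noteq> 0" using unit[OF c(1)] M_mult[of 0 x] xM by auto
  have "c * D = p * f1 - q * f2 + r * f3" using rf3 by simp
  then have D: "D = inverse c * p * f1 - inverse c * q * f2 + inverse c * r * f3"
    using c'(2) by (simp add: field_simps)
  define e1 e2 e3 where "e1 = inverse c * p" and "e2 = - (inverse c * q)" and "e3 = inverse c * r"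
  have eA: "e1 \<in> A" "e2 \<in> A" "e3 \<in> A" using c' p q r by (auto simp: e1_def e2_def e3_def)
  have De: "D = e1 * f1 + e2 * f2 + e3 * f3" unfolding D e1_def e2_def e3_def by simp
  have "koszul_reducible f1 f2 f3" unfolding koszul_reducible_def
  proof (intro bexI conjI)
    show "(a2 + y * e1) * f1 + (- a1 + y * e2) * f2 + (y * e3) * f3 = 0"
    proof -
      have "(a2 + y * e1) * f1 + (- a1 + y * e2) * f2 + (y * e3) * f3 = a2 * f1 - a1 * f2 + y * D"
        unfolding De by (simp add: algebra_simps)
      then show ?thesis unfolding yD by simp
    qed
    show "(b2 - x * e1) * f1 + (- b1 - x * e2) * f2 + (- (x * e3)) * f3 = 0"
    proof -
      have "(b2 - x * e1) * f1 + (- b1 - x * e2) * f2 + (- (x * e3)) * f3 = b2 * f1 - b1 * f2 - x * D"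
        unfolding De by (simp add: algebra_simps)
      then show ?thesis unfolding xD by simp
    qed
    show "f2 = x * (a2 + y * e1) + y * (b2 - x * e1)" "- f1 = x * (- a1 + y * e2) + y * (- b1 - x * e2)"
      "0 = x * (y * e3) + y * (- (x * e3))"
      by (simp_all add: ab1(3) ab2(3) algebra_simps)
  qed (use ab1 ab2 eA in auto)
  then show False using nred by blast
qed


text \<open>Let \<open>\<Phi>\<close> be the alternating matrix whose rows are the Koszul syzygies. Its multiples are the only
  alternating matrices with syzygies as rows, so \<open>0 \<rightarrow> A \<Phi> \<rightarrow> {matrices with syzygies as rows} \<rightarrow> {quadratic
  forms} \<rightarrow> I\<^sup>2 \<rightarrow> 0\<close> is exact on the left; here a matrix goes to its quadratic form, and a form to its value
  at \<open>f\<close>. The assumption \<open>kos\<close> is exactness at the quadratic forms. If \<open>\<Phi>\<close> were divisible by \<open>M\<close>, then \<open>\<Phi>\<close>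
  would give a nonzero element of \<open>Tor\<^sub>2(I\<^sup>2, A / M)\<close>; the Koszul complex of \<open>x, y\<close> computes this group
  as the part of \<open>I\<^sup>2\<close> killed by \<open>x\<close> and \<open>y\<close>, which is zero. The proof is the diagram chase that
  compares the two resolutions: if \<open>\<Phi> = x P + y Q\<close>, then the forms of \<open>P\<close> and \<open>Q\<close> are \<open>y T\<close> and \<open>- x T\<close>,
  the form \<open>T\<close> vanishes at \<open>f\<close> and hence comes from a matrix \<open>U\<close> of syzygies, and \<open>P - y U = l \<Phi>\<close> and
  \<open>Q + x U = m \<Phi>\<close>, so \<open>\<Phi> = (x l + y m) \<Phi>\<close>.\<close>

lemma not_all_koszul_reducible:
  assumes f: "f1 \<in> M" "f2 \<in> M" "f3 \<in> M" and nz: "f1 \<noteq> 0 \<or> f2 \<noteq> 0 \<or> f3 \<noteq> 0"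
    and frac: "\<And>r. r * f1 \<in> A \<Longrightarrow> r * f2 \<in> A \<Longrightarrow> r * f3 \<in> A \<Longrightarrow> r \<in> A"
    and kos: "\<And>a1 a2 a3. a1 \<in> I \<Longrightarrow> a2 \<in> I \<Longrightarrow> a3 \<in> I \<Longrightarrow> a1 * f1 + a2 * f2 + a3 * f3 = 0 \<Longrightarrow>
      \<exists>c1\<in>A. \<exists>c2\<in>A. \<exists>c3\<in>A. a1 = c1 * f2 + c2 * f3 \<and> a2 = - c1 * f1 + c3 * f3 \<and> a3 = - c2 * f1 - c3 * f2"
    and I: "\<And>a. a \<in> I \<longleftrightarrow> (\<exists>p\<in>A. \<exists>q\<in>A. \<exists>r\<in>A. a = p * f1 + q * f2 + r * f3)"
    and red: "koszul_reducible f1 f2 f3" "koszul_reducible f1 f3 f2" "koszul_reducible f2 f3 f1"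
  shows False
proof -
  obtain p11 p12 p13 q11 q12 q13 where A1: "p11 \<in> A" "p12 \<in> A" "p13 \<in> A" "q11 \<in> A" "q12 \<in> A" "q13 \<in> A"
    and s1: "p11 * f1 + p12 * f2 + p13 * f3 = 0" "q11 * f1 + q12 * f2 + q13 * f3 = 0"
    and e1: "f2 = x * p11 + y * q11" "- f1 = x * p12 + y * q12" "0 = x * p13 + y * q13"
    using red(1) unfolding koszul_reducible_def by (elim bexE conjE) (rule that)
  obtain p21 p23 p22 q21 q23 q22 where A2: "p21 \<in> A" "p23 \<in> A" "p22 \<in> A" "q21 \<in> A" "q23 \<in> A" "q22 \<in> A"
    and s2: "p21 * f1 + p23 * f3 + p22 * f2 = 0" "q21 * f1 + q23 * f3 + q22 * f2 = 0"
    and e2: "f3 = x * p21 + y * q21" "- f1 = x * p23 + y * q23" "0 = x * p22 + y * q22"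
    using red(2) unfolding koszul_reducible_def by (elim bexE conjE) (rule that)
  obtain p32 p33 p31 q32 q33 q31 where A3: "p32 \<in> A" "p33 \<in> A" "p31 \<in> A" "q32 \<in> A" "q33 \<in> A" "q31 \<in> A"
    and s3: "p32 * f2 + p33 * f3 + p31 * f1 = 0" "q32 * f2 + q33 * f3 + q31 * f1 = 0"
    and e3: "f3 = x * p32 + y * q32" "- f2 = x * p33 + y * q33" "0 = x * p31 + y * q31"
    using red(3) unfolding koszul_reducible_def by (elim bexE conjE) (rule that)
  \<comment> \<open>The rows of \<open>P\<close> are \<open>(p31, p32, p33)\<close>, \<open>-(p21, p22, p23)\<close> and \<open>(p11, p12, p13)\<close>, those of \<open>Q\<close> likewise, and
    \<open>\<Phi>\<close> has the rows \<open>(0, f3, -f2)\<close>, \<open>(-f3, 0, f1)\<close> and \<open>(f2, -f1, 0)\<close>. The numbers \<open>t11\<close> to \<open>t33\<close> are the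
    coefficients of \<open>T\<close>.\<close>
  have split: "\<exists>c\<in>A. a = y * c \<and> b = - (x * c)" if ab: "a \<in> A" "b \<in> A" "x * a + y * b = 0" for a b
  proof -
    have "x * a = y * (- b)" using ab(3) by (simp add: eq_neg_iff_add_eq_0)
    moreover have "- b \<in> A" using ab(2) by simp
    ultimately obtain c where "c \<in> A" "a = y * c" "- b = x * c" using regular[OF ab(1)] by blast
    moreover have "b = - (x * c)" using \<open>- b = x * c\<close> by (metis minus_minus)
    ultimately show ?thesis by blast
  qed
  obtain t11 where t11: "t11 \<in> A" "p31 = y * t11" "q31 = - (x * t11)"
    using split[OF A3(3) A3(6) e3(3)[symmetric]] by (elim bexE conjE) (rule that)
  obtain t22 where t22: "t22 \<in> A" "- p22 = y * t22" "- q22 = - (x * t22)"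
  proof -
    have "x * (- p22) + y * (- q22) = - (x * p22 + y * q22)" by simp
    also have "\<dots> = 0" unfolding e2(3)[symmetric] by simp
    finally have "x * (- p22) + y * (- q22) = 0" .
    from split[OF uminus_closed[OF A2(3)] uminus_closed[OF A2(6)] this] show thesis
      by (elim bexE conjE) (rule that)
  qed
  obtain t33 where t33: "t33 \<in> A" "p13 = y * t33" "q13 = - (x * t33)"
    using split[OF A1(3) A1(6) e1(3)[symmetric]] by (elim bexE conjE) (rule that)
  have "x * (p32 - p21) + y * (q32 - q21) = 0" using e3(1) e2(1) by (simp add: algebra_simps)
  then obtain t12 where t12: "t12 \<in> A" "p32 - p21 = y * t12" "q32 - q21 = - (x * t12)"
    using split[of "p32 - p21" "q32 - q21"] A2 A3 by auto
  have "x * (p33 + p11) + y * (q33 + q11) = 0"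
  proof -
    have "x * (p33 + p11) + y * (q33 + q11) = (x * p33 + y * q33) + (x * p11 + y * q11)" by (simp add: algebra_simps)
    then show ?thesis unfolding e3(2)[symmetric] e1(1)[symmetric] by simp
  qed
  then obtain t13 where t13: "t13 \<in> A" "p33 + p11 = y * t13" "q33 + q11 = - (x * t13)"
    using split[of "p33 + p11" "q33 + q11"] A1 A3 by auto
  have "x * (p12 - p23) + y * (q12 - q23) = 0"
  proof -
    have "x * (p12 - p23) + y * (q12 - q23) = (x * p12 + y * q12) - (x * p23 + y * q23)" by (simp add: algebra_simps)
    then show ?thesis unfolding e1(2)[symmetric] e2(2)[symmetric] by simp
  qed
  then obtain t23 where t23: "t23 \<in> A" "p12 - p23 = y * t23" "q12 - q23 = - (x * t23)"
    using split[of "p12 - p23" "q12 - q23"] A1 A2 by auto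
  \<comment> \<open>\<open>T\<close> as a relation with coefficients \<open>a1, a2, a3\<close> in the ideal\<close>
  define a1 a2 a3 where "a1 = t11 * f1 + t12 * f2 + t13 * f3" and "a2 = t22 * f2 + t23 * f3"
    and "a3 = t33 * f3"
  have "y * (a1 * f1 + a2 * f2 + a3 * f3) = (y * t11) * f1 * f1 + (y * t12) * f1 * f2 + (y * t13) * f1 * f3
      + (y * t22) * f2 * f2 + (y * t23) * f2 * f3 + (y * t33) * f3 * f3"
    by (simp add: a1_def a2_def a3_def algebra_simps)
  also have "\<dots> = f1 * (p32 * f2 + p33 * f3 + p31 * f1) - f2 * (p21 * f1 + p23 * f3 + p22 * f2)
      + f3 * (p11 * f1 + p12 * f2 + p13 * f3)"
    unfolding t11(2)[symmetric] t12(2)[symmetric] t13(2)[symmetric] t22(2)[symmetric] t23(2)[symmetric] t33(2)[symmetric]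
    by (simp add: algebra_simps)
  also have "\<dots> = 0" unfolding s1 s2 s3 by simp
  finally have syz: "a1 * f1 + a2 * f2 + a3 * f3 = 0" using y_nonzero by simp
  have aI: "a1 \<in> I" "a2 \<in> I" "a3 \<in> I"
  proof -
    show "a1 \<in> I" unfolding I a1_def using t11(1) t12(1) t13(1) by blast
    have "a2 = 0 * f1 + t22 * f2 + t23 * f3" "a3 = 0 * f1 + 0 * f2 + t33 * f3" by (simp_all add: a2_def a3_def)
    then show "a2 \<in> I" "a3 \<in> I" unfolding I using t22(1) t23(1) t33(1) zero_closed by blast+
  qed
  from kos[OF aI syz] obtain c1 c2 c3 where cA: "c1 \<in> A" "c2 \<in> A" "c3 \<in> A"
    and c: "a1 = c1 * f2 + c2 * f3" "a2 = - c1 * f1 + c3 * f3" "a3 = - c2 * f1 - c3 * f2"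
    by (elim bexE conjE) (rule that)
  \<comment> \<open>\<open>U\<close> has the rows \<open>(t11, t12 - c1, t13 - c2)\<close>, \<open>(c1, t22, t23 - c3)\<close> and \<open>(c2, c3, t33)\<close>.\<close>
  have alt: "\<exists>r\<in>A. w1 = r * f1 \<and> w2 = r * f2 \<and> w3 = r * f3"
    if w: "w1 \<in> A" "w2 \<in> A" "w3 \<in> A"
      and eq: "w3 * f2 = w2 * f3" "w3 * f1 = w1 * f3" "w2 * f1 = w1 * f2" for w1 w2 w3
  proof -
    obtain r where r: "w1 = r * f1" "w2 = r * f2" "w3 = r * f3"
    proof -
      consider "f1 \<noteq> 0" | "f2 \<noteq> 0" | "f3 \<noteq> 0" using nz by blast
      then show thesis
      proof cases
        case 1
        then show thesis using that[of "w1 / f1"] eq by (simp add: field_simps)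
      next
        case 2
        then show thesis using that[of "w2 / f2"] eq by (simp add: field_simps)
      next
        case 3
        then show thesis using that[of "w3 / f3"] eq by (simp add: field_simps)
      qed
    qed
    moreover have "r \<in> A" using w unfolding r by (rule frac)
    ultimately show ?thesis by blast
  qed
  have c_eq: "t11 * f1 + (t12 - c1) * f2 + (t13 - c2) * f3 = 0" "c1 * f1 + t22 * f2 + (t23 - c3) * f3 = 0"
      "c2 * f1 + c3 * f2 + t33 * f3 = 0"
  proof -
    have "t11 * f1 + (t12 - c1) * f2 + (t13 - c2) * f3 = a1 - (c1 * f2 + c2 * f3)"
      by (simp add: a1_def algebra_simps)
    then show "t11 * f1 + (t12 - c1) * f2 + (t13 - c2) * f3 = 0" unfolding c(1) by simp
    have "c1 * f1 + t22 * f2 + (t23 - c3) * f3 = a2 - (- c1 * f1 + c3 * f3)"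
      by (simp add: a2_def algebra_simps)
    then show "c1 * f1 + t22 * f2 + (t23 - c3) * f3 = 0" unfolding c(2) by simp
    have "c2 * f1 + c3 * f2 + t33 * f3 = a3 - (- c2 * f1 - c3 * f2)"
      by (simp add: a3_def algebra_simps)
    then show "c2 * f1 + c3 * f2 + t33 * f3 = 0" unfolding c(3) by simp
  qed
  have row: "(p32 - y * (t12 - c1)) * f2 + (p33 - y * (t13 - c2)) * f3 = 0"
    "(q32 + x * (t12 - c1)) * f2 + (q33 + x * (t13 - c2)) * f3 = 0"
    "(p21 + y * c1) * f1 + (p23 + y * (t23 - c3)) * f3 = 0"
    "(q21 - x * c1) * f1 + (q23 - x * (t23 - c3)) * f3 = 0"
    "(p11 - y * c2) * f1 + (p12 - y * c3) * f2 = 0"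
    "(q11 + x * c2) * f1 + (q12 + x * c3) * f2 = 0"
  proof -
    have "(p32 - y * (t12 - c1)) * f2 + (p33 - y * (t13 - c2)) * f3
       = (p32 * f2 + p33 * f3 + p31 * f1) - y * (t11 * f1 + (t12 - c1) * f2 + (t13 - c2) * f3)"
      unfolding t11(2) by (simp add: algebra_simps)
    then show "(p32 - y * (t12 - c1)) * f2 + (p33 - y * (t13 - c2)) * f3 = 0" unfolding s3 c_eq by simp
    have "(q32 + x * (t12 - c1)) * f2 + (q33 + x * (t13 - c2)) * f3
       = (q32 * f2 + q33 * f3 + q31 * f1) + x * (t11 * f1 + (t12 - c1) * f2 + (t13 - c2) * f3)"
      unfolding t11(3) by (simp add: algebra_simps)
    then show "(q32 + x * (t12 - c1)) * f2 + (q33 + x * (t13 - c2)) * f3 = 0" unfolding s3 c_eq by simp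
    have "- p22 = y * t22" "q22 = x * t22" using t22 by simp_all
    then have p22: "p22 = - (y * t22)" "q22 = x * t22" by (metis minus_minus)+
    have "(p21 + y * c1) * f1 + (p23 + y * (t23 - c3)) * f3
       = (p21 * f1 + p23 * f3 + p22 * f2) + y * (c1 * f1 + t22 * f2 + (t23 - c3) * f3)"
      unfolding p22 by (simp add: algebra_simps)
    then show "(p21 + y * c1) * f1 + (p23 + y * (t23 - c3)) * f3 = 0" unfolding s2 c_eq by simp
    have "(q21 - x * c1) * f1 + (q23 - x * (t23 - c3)) * f3
       = (q21 * f1 + q23 * f3 + q22 * f2) - x * (c1 * f1 + t22 * f2 + (t23 - c3) * f3)"
      unfolding p22 by (simp add: algebra_simps)
    then show "(q21 - x * c1) * f1 + (q23 - x * (t23 - c3)) * f3 = 0" unfolding s2 c_eq by simp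
    have "(p11 - y * c2) * f1 + (p12 - y * c3) * f2
       = (p11 * f1 + p12 * f2 + p13 * f3) - y * (c2 * f1 + c3 * f2 + t33 * f3)"
      unfolding t33(2) by (simp add: algebra_simps)
    then show "(p11 - y * c2) * f1 + (p12 - y * c3) * f2 = 0" unfolding s1 c_eq by simp
    have "(q11 + x * c2) * f1 + (q12 + x * c3) * f2
       = (q11 * f1 + q12 * f2 + q13 * f3) + x * (c2 * f1 + c3 * f2 + t33 * f3)"
      unfolding t33(3) by (simp add: algebra_simps)
    then show "(q11 + x * c2) * f1 + (q12 + x * c3) * f2 = 0" unfolding s1 c_eq by simp
  qed
  have ent: "p32 - y * (t12 - c1) = p21 + y * c1" "p33 - y * (t13 - c2) = - (p11 - y * c2)"
      "p23 + y * (t23 - c3) = p12 - y * c3"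
      "q32 + x * (t12 - c1) = q21 - x * c1" "q33 + x * (t13 - c2) = - (q11 + x * c2)"
      "q23 - x * (t23 - c3) = q12 + x * c3"
  proof -
    have "q33 + q11 + x * t13 = 0" unfolding t13(3) by simp
    then have "(q33 + x * (t13 - c2)) + (q11 + x * c2) = 0" by (simp add: algebra_simps)
    then show "q33 + x * (t13 - c2) = - (q11 + x * c2)" by (simp only: eq_neg_iff_add_eq_0)
  qed (use t12(2,3) t13(2) t23(2,3) in \<open>simp_all add: algebra_simps\<close>)
  have eq1: "a * g = b * g' \<longleftrightarrow> a * g + - b * g' = 0" for a b g g' :: 'f by simp
  have eq2: "- (- a) = a" for a :: 'f by simp
  obtain l where l: "l \<in> A" "- (p12 - y * c3) = l * f1" "p11 - y * c2 = l * f2" "p21 + y * c1 = l * f3"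
  proof -
    have eqs: "(p21 + y * c1) * f2 = (p11 - y * c2) * f3" "(p21 + y * c1) * f1 = - (p12 - y * c3) * f3"
        "(p11 - y * c2) * f1 = - (p12 - y * c3) * f2"
      using row(1,3,5) unfolding ent by (simp_all only: eq1 eq2)
    have "- (p12 - y * c3) \<in> A" "p11 - y * c2 \<in> A" "p21 + y * c1 \<in> A" using A1 A2 cA by auto
    from alt[OF this eqs] show thesis by (elim bexE conjE) (rule that)
  qed
  obtain m where m: "m \<in> A" "- (q12 + x * c3) = m * f1" "q11 + x * c2 = m * f2" "q21 - x * c1 = m * f3"
  proof -
    have eqs: "(q21 - x * c1) * f2 = (q11 + x * c2) * f3" "(q21 - x * c1) * f1 = - (q12 + x * c3) * f3"
        "(q11 + x * c2) * f1 = - (q12 + x * c3) * f2"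
      using row(2,4,6) unfolding ent by (simp_all only: eq1 eq2)
    have "- (q12 + x * c3) \<in> A" "q11 + x * c2 \<in> A" "q21 - x * c1 \<in> A" using A1 A2 cA by auto
    from alt[OF this eqs] show thesis by (elim bexE conjE) (rule that)
  qed
  have "f1 = (x * l + y * m) * f1"
  proof -
    have "(x * l + y * m) * f1 = x * (l * f1) + y * (m * f1)" by (simp add: algebra_simps)
    also have "\<dots> = - (x * p12 + y * q12)" unfolding l(2)[symmetric] m(2)[symmetric] by (simp add: algebra_simps)
    finally show ?thesis unfolding e1(2)[symmetric] by simp
  qed
  moreover have "f2 = (x * l + y * m) * f2"
  proof -
    have "(x * l + y * m) * f2 = x * (l * f2) + y * (m * f2)" by (simp add: algebra_simps)
    also have "\<dots> = x * p11 + y * q11" unfolding l(3)[symmetric] m(3)[symmetric] by (simp add: algebra_simps)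
    finally show ?thesis unfolding e1(1)[symmetric] by simp
  qed
  moreover have "f3 = (x * l + y * m) * f3"
  proof -
    have "(x * l + y * m) * f3 = x * (l * f3) + y * (m * f3)" by (simp add: algebra_simps)
    also have "\<dots> = x * p21 + y * q21" unfolding l(4)[symmetric] m(4)[symmetric] by (simp add: algebra_simps)
    finally show ?thesis unfolding e2(1)[symmetric] by simp
  qed
  ultimately have "x * l + y * m = 1" using nz by (metis mult_cancel_right mult_1)
  moreover have "x * l + y * m \<in> M"
    using M_add[of "x * l" "y * m"] M_mult[OF l(1) xM] M_mult[OF m(1) yM] by (simp add: mult.commute)
  ultimately show False using one_notin_M by simp
qed

end


section \<open>The local ring of a prime ideal\<close>

definition localization :: "'a::idom set \<Rightarrow> 'a fract set" where
  "localization P = {to_fract a / to_fract b |a b. b \<notin> P}"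

definition localized_ideal :: "'a::idom set \<Rightarrow> 'a set \<Rightarrow> 'a fract set" where
  "localized_ideal J P = {to_fract a / to_fract b |a b. a \<in> J \<and> b \<notin> P}"

lemma local_parametersD:
  assumes "local_parameters P x y"
  shows "x \<in> P" "y \<in> P" "prime_elem x" "\<not> x dvd y"
    "\<forall>a\<in>P. \<exists>c q r. c \<notin> P \<and> c * a = q * x + r * y"
    "\<forall>f1 f2. \<not> common_prime {f1, f2} \<longrightarrow>
        (\<exists>c n p q p' q'. c \<notin> P \<and> c * x ^ n = p * f1 + q * f2 \<and> c * y ^ n = p' * f1 + q' * f2)"
proof -
  note 1 = assms[unfolded local_parameters_def]
  note 2 = conjunct2[OF 1]
  note 3 = conjunct2[OF 2]
  note 4 = conjunct2[OF 3]
  note 5 = conjunct2[OF 4]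
  show "x \<in> P" "y \<in> P" "prime_elem x" "\<not> x dvd y"
    by (fact conjunct1[OF 1] conjunct1[OF 2] conjunct1[OF 3] conjunct1[OF 4])+
  show "\<forall>a\<in>P. \<exists>c q r. c \<notin> P \<and> c * a = q * x + r * y" by (fact conjunct1[OF 5])
  show "\<forall>f1 f2. \<not> common_prime {f1, f2} \<longrightarrow>
        (\<exists>c n p q p' q'. c \<notin> P \<and> c * x ^ n = p * f1 + q * f2 \<and> c * y ^ n = p' * f1 + q' * f2)"
    by (fact conjunct2[OF 5])
qed

text \<open>If one of \<open>f, g\<close> is zero, the other one is a unit, as every prime divides zero.\<close>

lemma coprime_cross_cancel:
  fixes f g :: "'a::idom"
  assumes pp: "\<And>a :: 'a. a \<noteq> 0 \<Longrightarrow> prime_product a" and nz: "f \<noteq> 0 \<or> g \<noteq> 0"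
    and cop: "\<not> common_prime {f, g}" and eq: "a * f = b * g"
  shows "\<exists>c. a = c * g \<and> b = c * f"
proof (cases "g = 0")
  case False
  have "g dvd a"
  proof (rule prime_product_cancel[OF pp[OF False], of "{f}"])
    show "\<not> common_prime (insert g {f})" using cop by (simp add: insert_commute)
    show "g dvd a * f'" if "f' \<in> {f}" for f' using that eq by simp
  qed
  then obtain c where c: "a = c * g" by (metis dvdE mult.commute)
  then have "b * g = (c * f) * g" using eq unfolding c by (simp only: ac_simps)
  then have "b = c * f" using False unfolding mult_cancel_right by blast
  then show ?thesis using c by blast
next
  case True
  then have f0: "f \<noteq> 0" using nz by simp
  have "f dvd b"
  proof (rule prime_product_cancel[OF pp[OF f0], of "{g}"])
    show "\<not> common_prime (insert f {g})" using cop by simp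
    show "f dvd b * g'" if "g' \<in> {g}" for g' using that eq[symmetric] by simp
  qed
  then obtain c where c: "b = c * f" by (metis dvdE mult.commute)
  then have "a * f = (c * g) * f" using eq unfolding c by (simp only: ac_simps)
  then have "a = c * g" using f0 unfolding mult_cancel_right by blast
  then show ?thesis using c by blast
qed

context
  fixes P :: "'a::idom set"
  assumes P: "prime_ideal P"
begin

lemma not_mem_nonzero: "b \<notin> P \<Longrightarrow> b \<noteq> 0"
  using ideal.subspace_0[OF prime_idealD(1)[OF P]] by auto

lemma localizationE:
  assumes "z \<in> localization P"
  obtains a b where "b \<notin> P" "b \<noteq> 0" "z = to_fract a / to_fract b"
  using assms not_mem_nonzero by (auto simp: localization_def)

lemma localizationI: "b \<notin> P \<Longrightarrow> z = to_fract a / to_fract b \<Longrightarrow> z \<in> localization P"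
  by (auto simp: localization_def)

lemma subring_localization: "subring_carrier (localization P)"
proof
  have one: "1 \<notin> P" by (rule prime_idealD(2)[OF P])
  show "0 \<in> localization P" by (rule localizationI[OF one, of _ 0]) simp
  show "1 \<in> localization P" by (rule localizationI[OF one, of _ 1]) simp
next
  fix z z' assume "z \<in> localization P" "z' \<in> localization P"
  then obtain a b a' b' where z: "b \<notin> P" "b \<noteq> 0" "z = to_fract a / to_fract b"
      and z': "b' \<notin> P" "b' \<noteq> 0" "z' = to_fract a' / to_fract b'"
    by (elim localizationE) (rule that)
  have bb: "b * b' \<notin> P" by (rule prime_ideal_not_mem_mult[OF P z(1) z'(1)])
  have "z + z' = to_fract (a * b' + a' * b) / to_fract (b * b')"
    using z z' by (simp add: field_simps)
  then show "z + z' \<in> localization P" by (rule localizationI[OF bb])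
  have "z * z' = to_fract (a * a') / to_fract (b * b')" using z z' by simp
  then show "z * z' \<in> localization P" by (rule localizationI[OF bb])
next
  fix z assume "z \<in> localization P"
  then obtain a b where z: "b \<notin> P" "b \<noteq> 0" "z = to_fract a / to_fract b" by (elim localizationE) (rule that)
  then have "- z = to_fract (- a) / to_fract b" by simp
  then show "- z \<in> localization P" by (rule localizationI[OF z(1)])
qed

lemma to_fract_localization: "to_fract a \<in> localization P"
  by (rule localizationI[OF prime_idealD(2)[OF P], of _ a]) simp

lemma localization_point:
  assumes pp: "\<And>a :: 'a. a \<noteq> 0 \<Longrightarrow> prime_product a" and lp: "local_parameters P x y"
  shows "regular_surface_point (localization P) (localized_ideal P P) (to_fract x) (to_fract y)"
proof -
  interpret subring_carrier "localization P" by (rule subring_localization)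
  note sub = prime_idealD(1)[OF P]
  note xyP = local_parametersD(1,2)[OF lp]
  note x = local_parametersD(3,4)[OF lp]
  have x0: "x \<noteq> 0" and y0: "y \<noteq> 0" using x by auto
  have one: "1 \<notin> P" by (rule prime_idealD(2)[OF P])
  have M_E: thesis if "z \<in> localized_ideal P P"
      "\<And>a b. a \<in> P \<Longrightarrow> b \<notin> P \<Longrightarrow> b \<noteq> 0 \<Longrightarrow> z = to_fract a / to_fract b \<Longrightarrow> thesis" for z thesis
    using that not_mem_nonzero by (auto simp: localized_ideal_def)
  have M_I: "z \<in> localized_ideal P P" if "a \<in> P" "b \<notin> P" "z = to_fract a / to_fract b" for z a b
    using that by (auto simp: localized_ideal_def)
  show ?thesis
  proof
    fix z z' assume "z \<in> localized_ideal P P" "z' \<in> localized_ideal P P"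
    then obtain a b a' b' where z: "a \<in> P" "b \<notin> P" "b \<noteq> 0" "z = to_fract a / to_fract b"
        and z': "a' \<in> P" "b' \<notin> P" "b' \<noteq> 0" "z' = to_fract a' / to_fract b'"
      by (elim M_E) (rule that)
    have "z + z' = to_fract (a * b' + a' * b) / to_fract (b * b')"
      using z z' by (simp add: field_simps)
    moreover have "a * b' + a' * b \<in> P"
      by (intro ideal.subspace_add[OF sub] ideal_mult_right[OF sub] z z')
    ultimately show "z + z' \<in> localized_ideal P P"
      by (intro M_I[OF _ prime_ideal_not_mem_mult[OF P z(2) z'(2)]])
  next
    fix z z' assume "z \<in> localization P" "z' \<in> localized_ideal P P"
    then obtain a b a' b' where z: "b \<notin> P" "b \<noteq> 0" "z = to_fract a / to_fract b"
        and z': "a' \<in> P" "b' \<notin> P" "b' \<noteq> 0" "z' = to_fract a' / to_fract b'"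
      by (elim M_E localizationE) (rule that)
    have "z * z' = to_fract (a * a') / to_fract (b * b')" using z z' by simp
    then show "z * z' \<in> localized_ideal P P"
      by (rule M_I[OF ideal_mult_left[OF sub z'(1)] prime_ideal_not_mem_mult[OF P z(1) z'(2)]])
  next
    show "localized_ideal P P \<subseteq> localization P" by (auto simp: localized_ideal_def localization_def)
    show "1 \<notin> localized_ideal P P"
    proof
      assume "1 \<in> localized_ideal P P"
      then obtain a b where ab: "a \<in> P" "b \<notin> P" "b \<noteq> 0" "1 = to_fract a / to_fract b" by (elim M_E) (rule that)
      then have "to_fract a = to_fract b" by (simp add: field_simps)
      then show False using ab by simp
    qed
  next
    fix z assume "z \<in> localization P" "z \<notin> localized_ideal P P"
    then obtain a b where z: "b \<notin> P" "b \<noteq> 0" "z = to_fract a / to_fract b" by (elim localizationE) (rule that)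
    then have "a \<notin> P" using M_I \<open>z \<notin> localized_ideal P P\<close> by blast
    moreover have "inverse z = to_fract b / to_fract a" using z by simp
    ultimately show "inverse z \<in> localization P" by (rule localizationI)
  next
    show "to_fract x \<in> localized_ideal P P" by (rule M_I[OF xyP(1) one]) simp
    show "to_fract y \<in> localized_ideal P P" by (rule M_I[OF xyP(2) one]) simp
    show "to_fract x \<noteq> 0" "to_fract y \<noteq> 0" using x0 y0 by simp_all
  next
    fix z assume "z \<in> localized_ideal P P"
    then obtain a b where z: "a \<in> P" "b \<notin> P" "b \<noteq> 0" "z = to_fract a / to_fract b" by (elim M_E) (rule that)
    have "\<forall>a\<in>P. \<exists>c q r. c \<notin> P \<and> c * a = q * x + r * y"
      by (rule local_parametersD(5)[OF lp])
    then obtain c q r where c: "c \<notin> P" "c * a = q * x + r * y" using z(1) by blast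
    have c0: "c \<noteq> 0" by (rule not_mem_nonzero[OF c(1)])
    have cb: "c * b \<notin> P" by (rule prime_ideal_not_mem_mult[OF P c(1) z(2)])
    have "to_fract c * to_fract a = to_fract q * to_fract x + to_fract r * to_fract y"
      using arg_cong[OF c(2), of to_fract] by simp
    then have ta: "to_fract a = (to_fract q * to_fract x + to_fract r * to_fract y) / to_fract c"
      using c0 by (simp add: field_simps)
    have "z = to_fract x * (to_fract q / to_fract (c * b)) + to_fract y * (to_fract r / to_fract (c * b))"
      unfolding z(4) ta by (simp add: add_divide_distrib mult.commute)
    then show "\<exists>p\<in>localization P. \<exists>q\<in>localization P. z = to_fract x * p + to_fract y * q"
      using localizationI[OF cb refl] by blast
  next
    fix z z' assume "z \<in> localization P" "z' \<in> localization P" and eq: "to_fract x * z = to_fract y * z'"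
    then obtain a b a' b' where z: "b \<notin> P" "b \<noteq> 0" "z = to_fract a / to_fract b"
        and z': "b' \<notin> P" "b' \<noteq> 0" "z' = to_fract a' / to_fract b'"
      by (elim localizationE) (rule that)
    have "to_fract (x * (a * b')) = to_fract (y * (a' * b))"
      using eq z z' by (simp add: field_simps)
    then have eq': "x * (a * b') = y * (a' * b)" by (simp only: to_fract_eq_iff)
    then have "x dvd y * (a' * b)" by (metis dvd_triv_left)
    then have "x dvd a' * b" using prime_elem_dvd_multD[OF x(1)] x(2) by blast
    moreover have "\<not> x dvd b" using z(1) ideal_mult_right[OF sub xyP(1)] by (auto elim!: dvdE)
    ultimately have "x dvd a'" using prime_elem_dvd_multD[OF x(1)] by blast
    then obtain e where e: "a' = x * e" by (elim dvdE)
    have "x * (a * b') = x * (y * (e * b))" using eq' unfolding e by (simp add: ac_simps)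
    then have "a * b' = y * (e * b)" using x0 by simp
    then have "to_fract a * to_fract b' = to_fract y * (to_fract e * to_fract b)"
      by (metis to_fract_mult)
    then have ta: "to_fract a = to_fract y * (to_fract e * to_fract b) / to_fract b'"
      using z'(2) by (simp add: field_simps)
    have "z = to_fract y * (to_fract e / to_fract b')" unfolding z(3) ta using z(2) by simp
    moreover have "z' = to_fract x * (to_fract e / to_fract b')" using z' e by simp
    ultimately show "\<exists>c\<in>localization P. z = to_fract y * c \<and> z' = to_fract x * c"
      using localizationI[OF z'(1) refl] by blast
  next
    fix z z' assume "z \<in> localization P" "z' \<in> localization P" and nz: "z \<noteq> 0 \<or> z' \<noteq> 0"
    then obtain a b a' b' where z: "b \<notin> P" "b \<noteq> 0" "z = to_fract a / to_fract b"
        and z': "b' \<notin> P" "b' \<noteq> 0" "z' = to_fract a' / to_fract b'"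
      by (elim localizationE) (rule that)
    have nz': "a \<noteq> 0 \<or> a' \<noteq> 0" using nz z z' by auto
    have "\<exists>d g g'. a = d * g \<and> a' = d * g' \<and> \<not> common_prime {g, g'}"
    proof (cases "a = 0")
      case False
      then show ?thesis using prime_product_gcd[OF pp[OF False]] by blast
    next
      case True
      then have "a' \<noteq> 0" using nz' by simp
      from prime_product_gcd[OF pp[OF this], of a] obtain d g g' where
        "a' = d * g" "a = d * g'" "\<not> common_prime {g, g'}" by (elim exE conjE) (rule that)
      then show ?thesis by (intro exI[of _ d] exI[of _ g'] exI[of _ g]) (simp add: insert_commute)
    qed
    then obtain d g g' where d: "a = d * g" "a' = d * g'" "\<not> common_prime {g, g'}"
      by (elim exE conjE) (rule that)
    have gnz: "g \<noteq> 0 \<or> g' \<noteq> 0" using d nz' by auto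
    have cross: "\<exists>c. p = c * g' \<and> q = c * g" if "p * g = q * g'" for p q
      by (rule coprime_cross_cancel[OF pp gnz d(3) that])
    define h h' where "h = to_fract g / to_fract b" and "h' = to_fract g' / to_fract b'"
    have 1: "\<exists>c\<in>localization P. p = c * h' \<and> q = c * h"
      if "p \<in> localization P" "q \<in> localization P" and eq: "p * h = q * h'" for p q
    proof -
      obtain p1 p2 where p: "p2 \<notin> P" "p2 \<noteq> 0" "p = to_fract p1 / to_fract p2"
        using \<open>p \<in> localization P\<close> by (elim localizationE) (rule that)
      obtain q1 q2 where q: "q2 \<notin> P" "q2 \<noteq> 0" "q = to_fract q1 / to_fract q2"
        using \<open>q \<in> localization P\<close> by (elim localizationE) (rule that)
      have "to_fract ((p1 * q2 * b') * g) = to_fract ((q1 * p2 * b) * g')"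
        using eq p q z z' by (simp add: h_def h'_def field_simps)
      then have "(p1 * q2 * b') * g = (q1 * p2 * b) * g'" by (simp only: to_fract_eq_iff)
      then have "\<exists>c. p1 * q2 * b' = c * g' \<and> q1 * p2 * b = c * g"
        by (rule cross)
      then obtain c where c: "p1 * q2 * b' = c * g'" "q1 * p2 * b = c * g"
        by (elim exE conjE) (rule that)
      have c': "to_fract p1 * to_fract q2 * to_fract b' = to_fract c * to_fract g'"
          "to_fract q1 * to_fract p2 * to_fract b = to_fract c * to_fract g"
        using arg_cong[OF c(1), of to_fract] arg_cong[OF c(2), of to_fract] by simp_all
      have "p = to_fract c / to_fract (p2 * q2) * h'"
      proof -
        have "p = (to_fract p1 * to_fract q2 * to_fract b') / (to_fract p2 * to_fract q2 * to_fract b')"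
          using p q z' by simp
        then show ?thesis unfolding c' h'_def by simp
      qed
      moreover have "q = to_fract c / to_fract (p2 * q2) * h"
      proof -
        have "q = (to_fract q1 * to_fract p2 * to_fract b) / (to_fract p2 * to_fract q2 * to_fract b)"
          using p q z by simp
        then show ?thesis unfolding c' h_def by simp
      qed
      ultimately show ?thesis
        using localizationI[OF prime_ideal_not_mem_mult[OF P p(1) q(1)] refl] by blast
    qed
    have 2: "\<exists>p\<in>localization P. \<exists>q\<in>localization P. to_fract w ^ n = p * h + q * h'"
      if "c \<notin> P" "c * w ^ n = p * g + q * g'" for c w n p q
    proof -
      have c0: "c \<noteq> 0" by (rule not_mem_nonzero[OF \<open>c \<notin> P\<close>])
      have pw: "to_fract (w ^ n) = to_fract w ^ n" by (induction n) simp_all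
      have "to_fract c * to_fract w ^ n = to_fract p * to_fract g + to_fract q * to_fract g'"
        using arg_cong[OF that(2), of to_fract] by (simp add: pw)
      then have "to_fract w ^ n = (to_fract p * to_fract g + to_fract q * to_fract g') / to_fract c"
        using c0 by (simp add: field_simps)
      also have "\<dots> = to_fract (p * b) / to_fract c * h + to_fract (q * b') / to_fract c * h'"
        using c0 z z' by (simp add: h_def h'_def add_divide_distrib)
      finally show ?thesis using localizationI[OF \<open>c \<notin> P\<close> refl] by blast
    qed
    have "\<forall>f1 f2. \<not> common_prime {f1, f2} \<longrightarrow>
        (\<exists>c n p q p' q'. c \<notin> P \<and> c * x ^ n = p * f1 + q * f2 \<and> c * y ^ n = p' * f1 + q' * f2)"
      by (rule local_parametersD(6)[OF lp])
    then obtain c n p q p' q' where c: "c \<notin> P" "c * x ^ n = p * g + q * g'" "c * y ^ n = p' * g + q' * g'"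
      using d(3) by blast
    have 3: "\<exists>n. (\<exists>p\<in>localization P. \<exists>q\<in>localization P. to_fract x ^ n = p * h + q * h') \<and>
        (\<exists>p\<in>localization P. \<exists>q\<in>localization P. to_fract y ^ n = p * h + q * h')"
      using 2[OF c(1,2)] 2[OF c(1,3)] by blast
    have "z = to_fract d * h" "z' = to_fract d * h'" using z z' d by (simp_all add: h_def h'_def)
    moreover have "h \<in> localization P" "h' \<in> localization P"
      unfolding h_def h'_def using localizationI[OF z(1) refl] localizationI[OF z'(1) refl] by blast+
    ultimately show "\<exists>d\<in>localization P. \<exists>f'\<in>localization P. \<exists>g'\<in>localization P. z = d * f' \<and> z' = d * g' \<and>
        (\<forall>a\<in>localization P. \<forall>b\<in>localization P. a * f' = b * g' \<longrightarrow> (\<exists>c\<in>localization P. a = c * g' \<and> b = c * f')) \<and>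
        (\<exists>n. (\<exists>p\<in>localization P. \<exists>q\<in>localization P. to_fract x ^ n = p * f' + q * g') \<and>
             (\<exists>p\<in>localization P. \<exists>q\<in>localization P. to_fract y ^ n = p * f' + q * g'))"
      by (intro bexI[of _ "to_fract d"] bexI[of _ h] bexI[of _ h'] conjI ballI impI 1 3 to_fract_localization)
  qed
qed

text \<open>A fraction with poles on a curve cannot be multiplied into the local ring by all of \<open>F\<close>, because
  some element of \<open>F\<close> does not vanish on the curve.\<close>

lemma localization_normal:
  assumes pp: "\<And>a :: 'a. a \<noteq> 0 \<Longrightarrow> prime_product a" and F: "finite F" "\<not> common_prime F"
    and r: "\<And>f. f \<in> F \<Longrightarrow> r * to_fract f \<in> localization P"
  shows "r \<in> localization P"
proof -
  have "\<exists>b. b \<notin> P \<and> (\<forall>f\<in>G. \<exists>a. to_fract b * r * to_fract f = to_fract a)" if "G \<subseteq> F" for G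
    using finite_subset[OF that F(1)] that
  proof (induction G rule: finite_induct)
    case empty
    then show ?case using prime_idealD(2)[OF P] by blast
  next
    case (insert f G)
    then obtain b where b: "b \<notin> P" "\<And>g. g \<in> G \<Longrightarrow> \<exists>a. to_fract b * r * to_fract g = to_fract a" by auto
    have "f \<in> F" using insert.prems by simp
    from r[OF this] obtain a' b' where b': "b' \<notin> P" "b' \<noteq> 0" "r * to_fract f = to_fract a' / to_fract b'"
      by (elim localizationE) (rule that)
    have "\<exists>a. to_fract (b * b') * r * to_fract g = to_fract a" if g: "g \<in> insert f G" for g
    proof (cases "g = f")
      case True
      have "to_fract (b * b') * r * to_fract f = to_fract b * to_fract b' * (r * to_fract f)" by (simp add: ac_simps)
      also have "\<dots> = to_fract (b * a')" unfolding b'(3) using b'(2) by simp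
      finally show ?thesis using True by blast
    next
      case False
      then obtain a where "to_fract b * r * to_fract g = to_fract a" using b(2) g by blast
      then have "to_fract (b * b') * r * to_fract g = to_fract (b' * a)" by (simp add: ac_simps)
      then show ?thesis by blast
    qed
    then show ?case using prime_ideal_not_mem_mult[OF P b(1) b'(1)] by blast
  qed
  from this[OF subset_refl] obtain b where b: "b \<notin> P"
      "\<And>f. f \<in> F \<Longrightarrow> \<exists>a. to_fract b * r * to_fract f = to_fract a" by (elim exE conjE) (rule that, auto)
  obtain n m where nm: "r = Fract n m" "m \<noteq> 0" by (cases r)
  have r_eq: "r = to_fract n / to_fract m" using nm by (simp add: Fract_conv_to_fract)
  have "m dvd b * n"
  proof (rule prime_product_cancel[OF pp[OF nm(2)]])
    show "\<not> common_prime (insert m F)" using F(2) by (auto simp: common_prime_def)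
    fix f assume "f \<in> F"
    then obtain a where "to_fract b * r * to_fract f = to_fract a" using b(2) by blast
    then have "to_fract (b * n * f) = to_fract (m * a)" using nm(2) by (simp add: r_eq field_simps)
    then show "m dvd b * n * f" by (simp only: to_fract_eq_iff) simp
  qed
  then obtain c where "b * n = m * c" by (elim dvdE)
  then have "to_fract b * to_fract n = to_fract m * to_fract c" by (metis to_fract_mult)
  then have "to_fract n = to_fract m * to_fract c / to_fract b"
    using not_mem_nonzero[OF b(1)] by (simp add: field_simps)
  then have "r = to_fract c / to_fract b" unfolding r_eq using nm(2) by simp
  then show ?thesis by (rule localizationI[OF b(1)])
qed

end


section \<open>Ideals of codimension two\<close>

lemma mem_span_singleton:
  fixes p :: "'a::comm_ring_1"
  shows "a \<in> ideal.span {p} \<longleftrightarrow> p dvd a"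
  by (auto simp: ideal.span_singleton dvd_def mult.commute image_iff)

text \<open>A nonzero prime ideal inside \<open>(p)\<close> contains a prime element, which is associated to \<open>p\<close>.\<close>

lemma height_principal_prime:
  fixes p :: "'k::field bipoly"
  assumes p: "prime_elem p"
  shows "height (ideal.span {p}) \<le> 1"
  unfolding height_def
proof (rule Sup_least, clarify)
  fix n :: nat and C :: "nat \<Rightarrow> 'k bipoly set"
  assume C: "\<forall>i\<le>n. prime_ideal (C i)" "\<forall>i<n. C i \<subset> C (Suc i)" "C n = ideal.span {p}"
  show "enat n \<le> 1"
  proof (rule ccontr)
    assume "\<not> enat n \<le> 1"
    then have "n \<ge> 2" by (simp add: one_enat_def)
    define m where "m = n - 2"
    then have m: "n = Suc (Suc m)" using \<open>n \<ge> 2\<close> by simp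
    have J: "prime_ideal (C (Suc m))" and J0: "prime_ideal (C m)" using C(1) m by auto
    have "C (Suc m) \<subset> ideal.span {p}" "C m \<subset> C (Suc m)" using C(2,3) m by auto
    from this(2) obtain q where q: "q \<in> C (Suc m)" "q \<notin> C m" by (elim psubsetE) blast
    then have q0: "q \<noteq> 0" using ideal.subspace_0[OF prime_idealD(1)[OF J0]] by metis
    obtain r where r: "prime_elem r" "r \<in> C (Suc m)"
      using prime_ideal_contains_prime_factor[OF prime_product_bipoly[OF q0] J q(1)]
      by (elim exE conjE) (rule that)
    have "r \<in> ideal.span {p}" using r(2) \<open>C (Suc m) \<subset> ideal.span {p}\<close> by blast
    then obtain t where t: "r = t * p" by (auto simp: ideal.span_singleton)
    have "r dvd t \<or> r dvd p" using prime_elem_dvd_multD[OF r(1), of t p] t by simp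
    moreover have "\<not> r dvd t"
    proof
      assume "r dvd t"
      then obtain w where "t = r * w" by (elim dvdE)
      then have "r * 1 = r * (w * p)" using t by (metis mult.assoc mult_1_right)
      then have "1 = w * p" using r(1) unfolding mult_cancel_left by auto
      then have "p dvd 1" by (metis dvd_triv_right)
      then show False using p by (simp add: prime_elem_def)
    qed
    ultimately have "r dvd p" by simp
    then have "p \<in> C (Suc m)" using ideal_mult_right[OF prime_idealD(1)[OF J] r(2)] by (elim dvdE) simp
    then have "ideal.span {p} \<subseteq> C (Suc m)"
      by (intro ideal.span_minimal prime_idealD(1)[OF J]) simp
    then show False using \<open>C (Suc m) \<subset> ideal.span {p}\<close> by blast
  qed
qed

lemma prime_ideal_principal:
  fixes p :: "'a::idom"
  assumes "prime_elem p"
  shows "prime_ideal (ideal.span {p})"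
proof -
  note mem = mem_span_singleton
  show ?thesis
    unfolding prime_ideal_def
  proof (intro conjI allI impI)
    have "1 \<notin> ideal.span {p}" unfolding mem using assms by (simp add: prime_elem_def)
    then show "ideal.span {p} \<noteq> UNIV" by blast
    show "a \<in> ideal.span {p} \<or> b \<in> ideal.span {p}" if "a * b \<in> ideal.span {p}" for a b
      using prime_elem_dvd_multD[OF assms, of a b] that unfolding mem by blast
  qed (rule ideal.subspace_span)
qed

lemma codimension_two_no_common_prime:
  fixes F :: "'k::field bipoly set"
  assumes "codimension (ideal.span F) = 2"
  shows "\<not> common_prime F" "\<exists>f\<in>F. f \<noteq> 0"
proof -
  have le: "2 \<le> height P" if "prime_ideal P" "ideal.span F \<subseteq> P" for P
    using assms that Inf_lower[of "height P" "{height P |P. prime_ideal P \<and> ideal.span F \<subseteq> P}"]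
    unfolding codimension_def by auto
  show "\<not> common_prime F"
  proof
    assume "common_prime F"
    then obtain p where p: "prime_elem p" "\<And>f. f \<in> F \<Longrightarrow> p dvd f" by (auto simp: common_prime_def)
    have "F \<subseteq> ideal.span {p}"
      using p(2) by (auto simp: mem_span_singleton)
    then have "ideal.span F \<subseteq> ideal.span {p}" by (intro ideal.span_minimal ideal.subspace_span)
    from order_trans[OF le[OF prime_ideal_principal[OF p(1)] this] height_principal_prime[OF p(1)]]
    show False by (simp add: one_enat_def numeral_eq_enat)
  qed
  show "\<exists>f\<in>F. f \<noteq> 0"
  proof (rule ccontr)
    assume "\<not> ?thesis"
    then have "F \<subseteq> {0}" by blast
    then have "ideal.span F \<subseteq> {0}"
      by (intro ideal.span_minimal) (auto simp: ideal.subspace_def)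
    moreover have "prime_ideal {0 :: 'k bipoly}"
      unfolding prime_ideal_def
    proof (intro conjI allI impI)
      show "{0 :: 'k bipoly} \<noteq> UNIV" by (metis UNIV_I singletonD zero_neq_one)
    qed (auto simp: ideal.subspace_def)
    ultimately have "2 \<le> height {0 :: 'k bipoly}" using le by blast
    moreover have "height {0 :: 'k bipoly} \<le> 0"
      unfolding height_def
    proof (rule Sup_least, clarify)
      fix n :: nat and C :: "nat \<Rightarrow> 'k bipoly set"
      assume C: "\<forall>i\<le>n. prime_ideal (C i)" "\<forall>i<n. C i \<subset> C (Suc i)" "C n = {0}"
      have "n = 0"
      proof (rule ccontr)
        assume "n \<noteq> 0"
        then obtain m where m: "n = Suc m" using not0_implies_Suc by blast
        have "prime_ideal (C m)" "C m \<subset> {0}" using C m by auto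
        then show False using ideal.subspace_0[OF prime_idealD(1)] by blast
      qed
      then show "enat n \<le> 0" by (simp add: zero_enat_def)
    qed
    ultimately have "(2 :: enat) \<le> 0" by (rule order_trans)
    then show False by (simp add: numeral_eq_enat zero_enat_def)
  qed
qed


section \<open>Divisibility by powers of a variable\<close>

lemma lookup_var_power_mult:
  "Poly_Mapping.lookup (var z ^ N * f) (Poly_Mapping.single z N + e) = Poly_Mapping.lookup f e"
proof -
  have "var z ^ N * f = (\<Sum>e'\<in>Poly_Mapping.keys f. Poly_Mapping.single (Poly_Mapping.single z N + e') (Poly_Mapping.lookup f e'))"
    by (subst (1) sum_single[of f, symmetric]) (simp add: var_power sum_distrib_left mult_single)
  then show ?thesis by (simp add: lookup_sum lookup_single when_def in_keys_iff)
qed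

lemma lookup_var_power_mult_0:
  assumes "Poly_Mapping.lookup e z < N"
  shows "Poly_Mapping.lookup (var z ^ N * f) e = 0"
proof (rule ccontr)
  assume "\<not> ?thesis"
  then have "e \<in> Poly_Mapping.keys (var z ^ N * f)" by (simp add: in_keys_iff)
  then obtain a b where "a \<in> Poly_Mapping.keys (var z ^ N :: 'a bipoly)" "e = a + b"
    using keys_mult[of "var z ^ N" f] by blast
  then show False using assms by (auto simp: var_power lookup_add split: if_splits)
qed

lemma restricted_sum_divisible:
  assumes "\<And>e. e \<in> S \<Longrightarrow> N \<le> Poly_Mapping.lookup e z"
  shows "\<exists>g. (\<Sum>e\<in>S. Poly_Mapping.single e (c e)) = var z ^ N * (g :: 'k::field bipoly)"
proof -
  have "(\<Sum>e\<in>S. Poly_Mapping.single e (c e))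
      = (\<Sum>e\<in>S. var z ^ N * Poly_Mapping.single (e - Poly_Mapping.single z N) (c e))"
  proof (rule sum.cong[OF refl])
    fix e assume "e \<in> S"
    then have "Poly_Mapping.single z N + (e - Poly_Mapping.single z N) = e"
      using assms by (intro poly_mapping_eqI) (auto simp: lookup_add lookup_minus lookup_single when_def)
    then show "Poly_Mapping.single e (c e) = var z ^ N * Poly_Mapping.single (e - Poly_Mapping.single z N) (c e)"
      by (simp add: var_power mult_single)
  qed
  then show ?thesis by (auto simp flip: sum_distrib_left)
qed

lemma var_power_dvd:
  assumes "\<And>e. e \<in> Poly_Mapping.keys r \<Longrightarrow> N \<le> Poly_Mapping.lookup e z"
  shows "\<exists>g. r = var z ^ N * (g :: 'k::field bipoly)"
proof -
  have "\<exists>g. (\<Sum>e\<in>Poly_Mapping.keys r. Poly_Mapping.single e (Poly_Mapping.lookup r e)) = var z ^ N * g"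
    by (rule restricted_sum_divisible) (rule assms)
  then show ?thesis by (simp add: sum_single)
qed

lemma split_by_var_powers:
  fixes r :: "'k::field bipoly"
  assumes "\<And>e. e \<in> Poly_Mapping.keys r \<Longrightarrow> N \<le> Poly_Mapping.lookup e z \<or> N \<le> Poly_Mapping.lookup e w"
  shows "\<exists>p q. r = var w ^ N * p - var z ^ N * q"
proof -
  define S where "S = {e \<in> Poly_Mapping.keys r. N \<le> Poly_Mapping.lookup e w}"
  let ?c = "\<lambda>e. Poly_Mapping.single e (Poly_Mapping.lookup r e)"
  have "r = (\<Sum>e\<in>S. ?c e) + (\<Sum>e\<in>Poly_Mapping.keys r - S. ?c e)"
    by (subst (1) sum_single[of r, symmetric], subst sum.subset_diff[of S]) (auto simp: S_def add.commute)
  moreover obtain p where "(\<Sum>e\<in>S. ?c e) = var w ^ N * p"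
    using restricted_sum_divisible[of S N w] by (auto simp: S_def)
  moreover obtain q where "(\<Sum>e\<in>Poly_Mapping.keys r - S. ?c e) = var z ^ N * q"
    using restricted_sum_divisible[of "Poly_Mapping.keys r - S" N z] assms by (auto simp: S_def)
  ultimately have "r = var w ^ N * p - var z ^ N * (- q)" by simp
  then show ?thesis by blast
qed

text \<open>Divisibility by a power of a variable can be read off from the exponents, and multiplication by
  \<open>var w ^ N\<close> does not change the exponent of \<open>z\<close>.\<close>

lemma var_power_coprime:
  fixes g h :: "'k::field bipoly"
  assumes "z \<noteq> w" "var w ^ N * g = var z ^ N * h"
  shows "\<exists>g'. g = var z ^ N * g'"
proof (rule var_power_dvd)
  fix e assume e: "e \<in> Poly_Mapping.keys g"
  show "N \<le> Poly_Mapping.lookup e z"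
  proof (rule ccontr)
    assume "\<not> ?thesis"
    then have "Poly_Mapping.lookup (Poly_Mapping.single w N + e) z < N"
      using assms(1) by (simp add: lookup_add lookup_single)
    then have "Poly_Mapping.lookup (var z ^ N * h) (Poly_Mapping.single w N + e) = 0"
      by (rule lookup_var_power_mult_0)
    then have "Poly_Mapping.lookup g e = 0" unfolding assms(2)[symmetric] lookup_var_power_mult .
    then show False using e by (simp add: in_keys_iff)
  qed
qed

lemma var_nonzero: "var z \<noteq> (0 :: 'k::field bipoly)"
  by (metis lookup_single_eq lookup_zero one_neq_zero var_def)

lemma var_bihom: "var Var_s \<in> bihom 1 0" "var Var_u \<in> bihom 1 0" "var Var_t \<in> bihom 0 1" "var Var_v \<in> bihom 0 1"
  by (simp_all add: var_def bihom_def bidegree_def lookup_single)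

lemma bihom_keys:
  assumes "r \<in> bihom k k'" "e \<in> Poly_Mapping.keys r"
  shows "int (Poly_Mapping.lookup e Var_s) + int (Poly_Mapping.lookup e Var_u) = k"
    "int (Poly_Mapping.lookup e Var_t) + int (Poly_Mapping.lookup e Var_v) = k'"
  using assms by (auto simp: bihom_def bidegree_def)


section \<open>Koszul syzygies and the vanishing of cohomology\<close>

locale bihom_triple =
  fixes f1 f2 f3 :: "'k::field bipoly" and d1 d2 d3 d1' d2' d3' :: int
  assumes f1: "f1 \<in> bihom d1 d1'" and f2: "f2 \<in> bihom d2 d2'" and f3: "f3 \<in> bihom d3 d3'"
    and no_common_prime: "\<not> common_prime {f1, f2, f3}" and not_all_zero: "f1 \<noteq> 0 \<or> f2 \<noteq> 0 \<or> f3 \<noteq> 0"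
begin

abbreviation "I \<equiv> ideal.span {f1, f2, f3}"

text \<open>\<open>c1, c2, c3\<close> are the coefficients with respect to the three Koszul generators.\<close>

definition koszul_with :: "'k bipoly \<Rightarrow> 'k bipoly \<Rightarrow> 'k bipoly \<Rightarrow> 'k bipoly \<Rightarrow> 'k bipoly \<Rightarrow> 'k bipoly \<Rightarrow> bool" where
  "koszul_with c1 c2 c3 v1 v2 v3 \<longleftrightarrow>
     v1 = c1 * f2 + c2 * f3 \<and> v2 = - c1 * f1 + c3 * f3 \<and> v3 = - c2 * f1 - c3 * f2"

definition koszul :: "'k bipoly \<Rightarrow> 'k bipoly \<Rightarrow> 'k bipoly \<Rightarrow> bool" where
  "koszul v1 v2 v3 \<longleftrightarrow> (\<exists>c1 c2 c3. koszul_with c1 c2 c3 v1 v2 v3)"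

lemma koszulI: "koszul_with c1 c2 c3 v1 v2 v3 \<Longrightarrow> koszul v1 v2 v3"
  unfolding koszul_def by blast

lemma koszul_with_add:
  assumes "koszul_with c1 c2 c3 a1 a2 a3" "koszul_with e1 e2 e3 b1 b2 b3"
  shows "koszul_with (c1 + e1) (c2 + e2) (c3 + e3) (a1 + b1) (a2 + b2) (a3 + b3)"
  using assms unfolding koszul_with_def by (elim conjE, hypsubst) (simp add: algebra_simps)

lemma koszul_with_scale:
  assumes "koszul_with c1 c2 c3 a1 a2 a3"
  shows "koszul_with (r * c1) (r * c2) (r * c3) (r * a1) (r * a2) (r * a3)"
  using assms unfolding koszul_with_def by (elim conjE, hypsubst) (simp add: algebra_simps)

lemma koszul_add:
  assumes "koszul a1 a2 a3" "koszul b1 b2 b3"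
  shows "koszul (a1 + b1) (a2 + b2) (a3 + b3)"
proof -
  obtain c1 c2 c3 where c: "koszul_with c1 c2 c3 a1 a2 a3"
    using assms(1) unfolding koszul_def by (elim exE) (rule that)
  obtain e1 e2 e3 where e: "koszul_with e1 e2 e3 b1 b2 b3"
    using assms(2) unfolding koszul_def by (elim exE) (rule that)
  show ?thesis by (rule koszulI[OF koszul_with_add[OF c e]])
qed

lemma koszul_scale:
  assumes "koszul a1 a2 a3"
  shows "koszul (r * a1) (r * a2) (r * a3)"
proof -
  obtain c1 c2 c3 where c: "koszul_with c1 c2 c3 a1 a2 a3"
    using assms unfolding koszul_def by (elim exE) (rule that)
  show ?thesis by (rule koszulI[OF koszul_with_scale[OF c]])
qed

lemma koszul_0: "koszul 0 0 0"
  by (rule koszulI[of 0 0 0]) (simp add: koszul_with_def)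

lemma mem_koszul_syzygies: "(v1, v2, v3) \<in> koszul_syzygies f1 f2 f3 \<longleftrightarrow> koszul v1 v2 v3"
proof
  let ?S = "{(v1, v2, v3). koszul v1 v2 v3}"
  have "free3.subspace ?S"
    unfolding free3.subspace_def
  proof (intro conjI ballI allI)
    show "0 \<in> ?S" using koszul_0 by (simp add: zero_prod_def)
    show "a + b \<in> ?S" if "a \<in> ?S" "b \<in> ?S" for a b
      using that by (auto intro: koszul_add)
    show "scale3 r a \<in> ?S" if "a \<in> ?S" for r a
      using that by (auto simp: scale3_def intro: koszul_scale)
  qed
  moreover have "{(f2, - f1, 0), (f3, 0, - f1), (0, f3, - f2)} \<subseteq> ?S"
    using koszulI[of 1 0 0 f2 "- f1" 0] koszulI[of 0 1 0 f3 0 "- f1"] koszulI[of 0 0 1 0 f3 "- f2"]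
    by (simp add: koszul_with_def)
  ultimately have "koszul_syzygies f1 f2 f3 \<subseteq> ?S"
    unfolding koszul_syzygies_def by (intro free3.span_minimal)
  then show "koszul v1 v2 v3" if "(v1, v2, v3) \<in> koszul_syzygies f1 f2 f3" using that by blast
next
  assume "koszul v1 v2 v3"
  then obtain c1 c2 c3 where c: "koszul_with c1 c2 c3 v1 v2 v3" by (auto simp: koszul_def)
  have "(v1, v2, v3) = scale3 c1 (f2, - f1, 0) + (scale3 c2 (f3, 0, - f1) + scale3 c3 (0, f3, - f2))"
    using c by (simp add: koszul_with_def scale3_def)
  also have "\<dots> \<in> koszul_syzygies f1 f2 f3"
    unfolding koszul_syzygies_def by (intro free3.span_add free3.span_scale free3.span_base) auto
  finally show "(v1, v2, v3) \<in> koszul_syzygies f1 f2 f3" .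
qed

lemma koszul_with_component:
  assumes "koszul_with c1 c2 c3 v1 v2 v3"
  shows "koszul_with (component (k - d1 - d2, k' - d1' - d2') c1) (component (k - d1 - d3, k' - d1' - d3') c2)
    (component (k - d2 - d3, k' - d2' - d3') c3)
    (component (k - d1, k' - d1') v1) (component (k - d2, k' - d2') v2) (component (k - d3, k' - d3') v3)"
proof -
  have cm: "component (m, m') (c * f) = component (m - l, m' - l') c * f" if "f \<in> bihom l l'" for m m' c f l l'
    using component_mult_bihom[OF that, of m m' c] by (simp add: mult.commute)
  have diff: "k - d2 - d1 = k - d1 - d2" "k' - d2' - d1' = k' - d1' - d2'" "k - d3 - d1 = k - d1 - d3"
    "k' - d3' - d1' = k' - d1' - d3'" "k - d3 - d2 = k - d2 - d3" "k' - d3' - d2' = k' - d2' - d3'" by simp_all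
  have v: "v1 = c1 * f2 + c2 * f3" "v2 = - c1 * f1 + c3 * f3" "v3 = - c2 * f1 + - c3 * f2"
    using assms by (simp_all add: koszul_with_def)
  show ?thesis
    unfolding koszul_with_def v component_add cm[OF f1] cm[OF f2] cm[OF f3] component_uminus diff by simp
qed

lemma koszul_homogeneous:
  assumes "koszul v1 v2 v3" "v1 \<in> bihom (k - d1) (k' - d1')" "v2 \<in> bihom (k - d2) (k' - d2')"
    "v3 \<in> bihom (k - d3) (k' - d3')"
  obtains c1 c2 c3 where "koszul_with c1 c2 c3 v1 v2 v3" "c1 \<in> bihom (k - d1 - d2) (k' - d1' - d2')"
    "c2 \<in> bihom (k - d1 - d3) (k' - d1' - d3')" "c3 \<in> bihom (k - d2 - d3) (k' - d2' - d3')"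
proof -
  obtain c1 c2 c3 where "koszul_with c1 c2 c3 v1 v2 v3"
    using assms(1) unfolding koszul_def by (elim exE) (rule that)
  from koszul_with_component[OF this, of k k'] show thesis
    unfolding component_bihom[OF assms(2)] component_bihom[OF assms(3)] component_bihom[OF assms(4)]
    by (rule that) (rule component_in_bihom)+
qed

text \<open>The middle of the Koszul complex is exact: \<open>c\<close> is a rational multiple \<open>r\<close> of \<open>(f3, -f2, f1)\<close>, and
  \<open>r\<close> is a polynomial since \<open>f1, f2, f3\<close> have no common prime that could be its denominator.\<close>

lemma koszul_kernel:
  assumes "koszul_with c1 c2 c3 0 0 0"
  shows "\<exists>r. c1 = r * f3 \<and> c2 = - (r * f2) \<and> c3 = r * f1"
proof -
  have e: "c1 * f2 = - (c2 * f3)" "c1 * f1 = c3 * f3" "c2 * f1 = - (c3 * f2)"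
  proof -
    have "c1 * f2 + c2 * f3 = 0" "- c1 * f1 + c3 * f3 = 0" "- c2 * f1 - c3 * f2 = 0"
      using assms by (simp_all add: koszul_with_def)
    then have "c1 * f2 + c2 * f3 = 0" "c3 * f3 = c1 * f1" "- (c2 * f1) = c3 * f2" by simp_all
    then show "c1 * f2 = - (c2 * f3)" "c1 * f1 = c3 * f3" "c2 * f1 = - (c3 * f2)"
      by (simp only: eq_neg_iff_add_eq_0, simp only:, metis minus_minus)
  qed
  have cop: "\<not> common_prime (insert g {f1, f2, f3})" for g
    using no_common_prime by (auto simp: common_prime_def)
  have e': "c2 * f3 = - (c1 * f2)" "c3 * f2 = - (c2 * f1)" "c3 * f3 = c1 * f1"
    by (simp_all add: e)
  consider "f3 \<noteq> 0" | "f2 \<noteq> 0" | "f1 \<noteq> 0" using not_all_zero by blast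
  then show ?thesis
  proof cases
    case 1
    have "f3 dvd c1 * f" if "f \<in> {f1, f2, f3}" for f using that by (auto simp: e)
    then have "f3 dvd c1" by (rule prime_product_cancel[OF prime_product_bipoly[OF 1] cop])
    then obtain r where r: "c1 = r * f3" by (metis dvdE mult.commute)
    have "c2 * f3 = - (r * f2) * f3" "c3 * f3 = (r * f1) * f3"
      unfolding e' r by (simp_all add: mult_ac)
    then show ?thesis using r 1 unfolding mult_cancel_right by blast
  next
    case 2
    have "f2 dvd c2 * f" if "f \<in> {f1, f2, f3}" for f using that by (auto simp: e(3) e'(1))
    then have "f2 dvd c2" by (rule prime_product_cancel[OF prime_product_bipoly[OF 2] cop])
    then obtain r where r: "c2 = r * f2" by (metis dvdE mult.commute)
    have "c1 * f2 = (- r * f3) * f2" "c3 * f2 = (- r * f1) * f2"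
      unfolding e(1) e'(2) r by (simp_all add: mult_ac)
    then have "c1 = - r * f3" "c3 = - r * f1" using 2 unfolding mult_cancel_right by blast+
    then show ?thesis using r by (intro exI[of _ "- r"]) simp
  next
    case 3
    have "f1 dvd c3 * f" if "f \<in> {f1, f2, f3}" for f using that by (auto simp: e'(2,3))
    then have "f1 dvd c3" by (rule prime_product_cancel[OF prime_product_bipoly[OF 3] cop])
    then obtain r where r: "c3 = r * f1" by (metis dvdE mult.commute)
    have "c1 * f1 = (r * f3) * f1" "c2 * f1 = - (r * f2) * f1"
      unfolding e(2,3) r by (simp_all add: mult_ac)
    then show ?thesis using r 3 unfolding mult_cancel_right by blast
  qed
qed

lemma kernel_degree:
  assumes "c1 = r * f3" "c2 = - (r * f2)" "c3 = r * f1"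
    and "c1 \<in> bihom (k - d1 - d2) (k' - d1' - d2')"
    "c2 \<in> bihom (k - d1 - d3) (k' - d1' - d3')" "c3 \<in> bihom (k - d2 - d3) (k' - d2' - d3')"
  shows "r \<in> bihom (k - d1 - d2 - d3) (k' - d1' - d2' - d3')"
proof -
  have gen: "r \<in> bihom (m - l) (m' - l')" if f: "f \<in> bihom l l'" "f \<noteq> 0" "r * f \<in> bihom m m'" for f l l' m m'
  proof -
    have "r * f = component (m, m') (f * r)" using component_bihom[OF f(3)] by (simp add: mult.commute)
    also have "\<dots> = component (m - l, m' - l') r * f" using component_mult_bihom[OF f(1), of m m' r] by (simp add: mult.commute)
    finally have "r = component (m - l, m' - l') r" using f(2) unfolding mult_cancel_right by blast
    then show ?thesis by (metis component_in_bihom)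
  qed
  consider "f3 \<noteq> 0" | "f2 \<noteq> 0" | "f1 \<noteq> 0" using not_all_zero by blast
  then show ?thesis
  proof cases
    case 1
    then show ?thesis using gen[OF f3] assms(1,4) by simp
  next
    case 2
    have "r * f2 \<in> bihom (k - d1 - d3) (k' - d1' - d3')" using bihom_uminus[OF assms(5)] assms(2) by simp
    from gen[OF f2 2 this] show ?thesis by (simp add: algebra_simps)
  next
    case 3
    have "r * f1 \<in> bihom (k - d2 - d3) (k' - d2' - d3')" using assms(3,6) by simp
    from gen[OF f1 3 this] have "r \<in> bihom (k - d2 - d3 - d1) (k' - d2' - d3' - d1')" .
    moreover have "k - d2 - d3 - d1 = k - d1 - d2 - d3" "k' - d2' - d3' - d1' = k' - d1' - d2' - d3'" by simp_all
    ultimately show ?thesis by (simp only:)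
  qed
qed

text \<open>On the open sets \<open>z \<noteq> 0\<close> and \<open>w \<noteq> 0\<close> the syzygy \<open>v\<close> has Koszul coefficients \<open>c / z ^ N\<close> and \<open>e / w ^ N\<close>. Their
  difference is a multiple of \<open>(f3, -f2, f1)\<close>, and they can be glued if the factor \<open>r\<close>, a cocycle, splits.\<close>

lemma koszul_descent:
  assumes zw: "z \<noteq> w"
    and c: "koszul_with c1 c2 c3 (var z ^ N * v1) (var z ^ N * v2) (var z ^ N * v3)"
    and e: "koszul_with e1 e2 e3 (var w ^ N * v1) (var w ^ N * v2) (var w ^ N * v3)"
    and r: "var w ^ N * c1 - var z ^ N * e1 = r * f3" "var w ^ N * c2 - var z ^ N * e2 = - (r * f2)"
      "var w ^ N * c3 - var z ^ N * e3 = r * f1"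
    and split: "r = var w ^ N * p - var z ^ N * q"
  shows "koszul v1 v2 v3"
proof -
  have "var w ^ N * (c1 - p * f3) = var z ^ N * (e1 - q * f3)"
    using r(1) unfolding split by (simp add: algebra_simps)
  then obtain h1 where h1: "c1 - p * f3 = var z ^ N * h1" using var_power_coprime[OF zw] by blast
  have "var w ^ N * (c2 + p * f2) = var z ^ N * (e2 + q * f2)"
    using r(2) unfolding split by (simp add: algebra_simps)
  then obtain h2 where h2: "c2 + p * f2 = var z ^ N * h2" using var_power_coprime[OF zw] by blast
  have "var w ^ N * (c3 - p * f1) = var z ^ N * (e3 - q * f1)"
    using r(3) unfolding split by (simp add: algebra_simps)
  then obtain h3 where h3: "c3 - p * f1 = var z ^ N * h3" using var_power_coprime[OF zw] by blast
  have c': "c1 = var z ^ N * h1 + p * f3" "c2 = var z ^ N * h2 - p * f2" "c3 = var z ^ N * h3 + p * f1"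
    using h1 h2 h3 by (simp_all add: algebra_simps)
  have z0: "var z ^ N \<noteq> (0 :: 'k bipoly)" using var_nonzero[where 'k = 'k, of z] by (rule power_not_zero)
  have "var z ^ N * v1 = var z ^ N * (h1 * f2 + h2 * f3)" "var z ^ N * v2 = var z ^ N * (- h1 * f1 + h3 * f3)"
    "var z ^ N * v3 = var z ^ N * (- h2 * f1 - h3 * f2)"
    using c unfolding koszul_with_def c' by (simp_all add: algebra_simps)
  then have "koszul_with h1 h2 h3 v1 v2 v3" unfolding koszul_with_def using z0 unfolding mult_cancel_left by blast
  then show ?thesis by (rule koszulI)
qed

lemma kernel_of_difference:
  assumes "koszul_with c1 c2 c3 v1 v2 v3" "koszul_with e1 e2 e3 v1 v2 v3"
    and "c1 \<in> bihom (k - d1 - d2) (k' - d1' - d2')" "c2 \<in> bihom (k - d1 - d3) (k' - d1' - d3')"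
      "c3 \<in> bihom (k - d2 - d3) (k' - d2' - d3')"
    and "e1 \<in> bihom (k - d1 - d2) (k' - d1' - d2')" "e2 \<in> bihom (k - d1 - d3) (k' - d1' - d3')"
      "e3 \<in> bihom (k - d2 - d3) (k' - d2' - d3')"
  obtains r where "r \<in> bihom (k - d1 - d2 - d3) (k' - d1' - d2' - d3')"
    "c1 - e1 = r * f3" "c2 - e2 = - (r * f2)" "c3 - e3 = r * f1"
proof -
  have "koszul_with (c1 - e1) (c2 - e2) (c3 - e3) 0 0 0"
    using koszul_with_add[OF assms(1) koszul_with_scale[OF assms(2), of "- 1"]] by simp
  from koszul_kernel[OF this] obtain r where r: "c1 - e1 = r * f3" "c2 - e2 = - (r * f2)" "c3 - e3 = r * f1"
    by (elim exE conjE) (rule that)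
  have "r \<in> bihom (k - d1 - d2 - d3) (k' - d1' - d2' - d3')"
    by (rule kernel_degree[OF r]) (intro bihom_diff assms)+
  then show ?thesis using r by (rule that)
qed

definition twisted :: "'k bipoly \<Rightarrow> 'k bipoly \<Rightarrow> 'k bipoly \<Rightarrow> int \<Rightarrow> int \<Rightarrow> bool" where
  "twisted v1 v2 v3 k k' \<longleftrightarrow> v1 \<in> bihom (k - d1) (k' - d1') \<and> v2 \<in> bihom (k - d2) (k' - d2') \<and>
     v3 \<in> bihom (k - d3) (k' - d3')"

text \<open>The bidegrees of the Koszul coefficients of a syzygy of bidegree \<open>(k, k')\<close>.\<close>

definition coefficients :: "'k bipoly \<Rightarrow> 'k bipoly \<Rightarrow> 'k bipoly \<Rightarrow> int \<Rightarrow> int \<Rightarrow> bool" where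
  "coefficients c1 c2 c3 k k' \<longleftrightarrow> c1 \<in> bihom (k - d1 - d2) (k' - d1' - d2') \<and>
    c2 \<in> bihom (k - d1 - d3) (k' - d1' - d3') \<and> c3 \<in> bihom (k - d2 - d3) (k' - d2' - d3')"

lemma koszul_coefficients:
  assumes "koszul v1 v2 v3" "twisted v1 v2 v3 k k'"
  obtains c1 c2 c3 where "koszul_with c1 c2 c3 v1 v2 v3" "coefficients c1 c2 c3 k k'"
  using koszul_homogeneous[OF assms(1), of k k'] assms(2) unfolding twisted_def coefficients_def by metis

lemma twisted_scale:
  assumes "twisted v1 v2 v3 k k'" "a \<in> bihom l l'"
  shows "twisted (a * v1) (a * v2) (a * v3) (k + l) (k' + l')"
  using assms bihom_mult[OF assms(2), of v1 "k - d1" "k' - d1'"] bihom_mult[OF assms(2), of v2 "k - d2" "k' - d2'"]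
    bihom_mult[OF assms(2), of v3 "k - d3" "k' - d3'"]
  unfolding twisted_def by (simp add: algebra_simps)

lemma coefficients_scale:
  assumes "coefficients v1 v2 v3 k k'" "a \<in> bihom l l'"
  shows "coefficients (a * v1) (a * v2) (a * v3) (k + l) (k' + l')"
  using assms bihom_mult[OF assms(2), of v1 "k - d1 - d2" "k' - d1' - d2'"]
    bihom_mult[OF assms(2), of v2 "k - d1 - d3" "k' - d1' - d3'"]
    bihom_mult[OF assms(2), of v3 "k - d2 - d3" "k' - d2' - d3'"]
  unfolding coefficients_def by (simp add: algebra_simps)

lemma difference_multiple:
  assumes "koszul_with c1 c2 c3 (a * v1) (a * v2) (a * v3)" "coefficients c1 c2 c3 (k + l) (k' + l')"
    and "koszul_with e1 e2 e3 (b * v1) (b * v2) (b * v3)" "coefficients e1 e2 e3 (k + l) (k' + l')"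
    and "a \<in> bihom l l'" "b \<in> bihom l l'"
  obtains r where "r \<in> bihom (k + 2 * l - d1 - d2 - d3) (k' + 2 * l' - d1' - d2' - d3')"
    "b * c1 - a * e1 = r * f3" "b * c2 - a * e2 = - (r * f2)" "b * c3 - a * e3 = r * f1"
proof -
  have k: "koszul_with (b * c1) (b * c2) (b * c3) (a * b * v1) (a * b * v2) (a * b * v3)"
    "koszul_with (a * e1) (a * e2) (a * e3) (a * b * v1) (a * b * v2) (a * b * v3)"
    using koszul_with_scale[OF assms(1), of b] koszul_with_scale[OF assms(3), of a] by (simp_all add: mult_ac)
  have deg: "coefficients (b * c1) (b * c2) (b * c3) (k + 2 * l) (k' + 2 * l')"
    "coefficients (a * e1) (a * e2) (a * e3) (k + 2 * l) (k' + 2 * l')"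
    using coefficients_scale[OF assms(2,6)] coefficients_scale[OF assms(4,5)] by (simp_all add: algebra_simps)
  show ?thesis
    by (rule kernel_of_difference[OF k, of "k + 2 * l" "k' + 2 * l'"])
      (use deg that in \<open>auto simp: coefficients_def\<close>)
qed

lemma keys_of_combination:
  fixes r r' g g' :: "'k bipoly"
  assumes eq: "var y ^ N * r = var w ^ N * r' + (var u ^ N * g + var s ^ N * g')"
    and neq: "y \<noteq> w" "u \<noteq> y" "s \<noteq> y" and e: "e \<in> Poly_Mapping.keys r" "Poly_Mapping.lookup e w < N"
  shows "N \<le> Poly_Mapping.lookup e s \<or> N \<le> Poly_Mapping.lookup e u"
proof (rule ccontr)
  assume "\<not> ?thesis"
  then have lt: "Poly_Mapping.lookup (Poly_Mapping.single y N + e) s < N"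
    "Poly_Mapping.lookup (Poly_Mapping.single y N + e) u < N"
    "Poly_Mapping.lookup (Poly_Mapping.single y N + e) w < N"
    using neq e(2) by (auto simp: lookup_add lookup_single)
  have "Poly_Mapping.lookup r e = Poly_Mapping.lookup (var y ^ N * r) (Poly_Mapping.single y N + e)"
    by (simp only: lookup_var_power_mult)
  also have "\<dots> = 0" unfolding eq lookup_add using lt by (simp add: lookup_var_power_mult_0)
  finally show False using e(1) by (simp add: in_keys_iff)
qed

text \<open>The four products of two variables give an open cover of the surface. The obstruction to gluing the
  Koszul coefficients of \<open>v\<close> lies in \<open>H\<^sup>1\<close> of the line bundle of bidegree \<open>(a, a')\<close>, where
  \<open>a = k - d1 - d2 - d3\<close> and \<open>a' = k' - d1' - d2' - d3'\<close>. By the Kuenneth formula this group is nonzero only if one of \<open>a, a'\<close>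
  is at least \<open>0\<close> and the other one at most \<open>-2\<close>, which the sign condition excludes. In terms of monomials:
  if \<open>a \<ge> -1\<close>, a cocycle in \<open>s, u\<close> has degree \<open>a + 2 * N \<ge> 2 * N - 1\<close>, so each of its monomials is divisible
  by \<open>s ^ N\<close> or \<open>u ^ N\<close>, and it splits; the same holds for \<open>t, v\<close>. If \<open>a\<close> and \<open>a'\<close> are at most \<open>-1\<close>, then the
  cocycle condition of the cover forces the cocycles in \<open>s, u\<close> to split, and the one that is left over in \<open>t, v\<close> has
  negative degree in \<open>s, u\<close>, so it is zero.\<close>

lemma koszul_saturated:
  assumes v: "twisted v1 v2 v3 k k'"
    and loc: "\<And>x y. x \<in> {Var_s, Var_u} \<Longrightarrow> y \<in> {Var_t, Var_v} \<Longrightarrow>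
      koszul (var x ^ N * (var y ^ N * v1)) (var x ^ N * (var y ^ N * v2)) (var x ^ N * (var y ^ N * v3))"
    and deg: "(k - (d1 + d2 + d3) + 1) * (k' - (d1' + d2' + d3') + 1) \<ge> 0"
  shows "koszul v1 v2 v3"
proof -
  define n where "n = int N"
  define a a' where "a = k - d1 - d2 - d3" and "a' = k' - d1' - d2' - d3'"
  have cases: "a \<ge> -1 \<and> a' \<ge> -1 \<or> a \<le> -1 \<and> a' \<le> -1"
    using deg unfolding a_def a'_def zero_le_mult_iff by auto
  have bs: "var x ^ N \<in> (bihom n 0 :: 'k bipoly set)" if "x \<in> {Var_s, Var_u}" for x
    using that bihom_power[OF var_bihom(1), of N] bihom_power[OF var_bihom(2), of N] by (auto simp: n_def)
  have bt: "var y ^ N \<in> (bihom 0 n :: 'k bipoly set)" if "y \<in> {Var_t, Var_v}" for y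
    using that bihom_power[OF var_bihom(3), of N] bihom_power[OF var_bihom(4), of N] by (auto simp: n_def)
  have "\<exists>c1 c2 c3. koszul_with c1 c2 c3 (var x ^ N * (var y ^ N * v1)) (var x ^ N * (var y ^ N * v2))
      (var x ^ N * (var y ^ N * v3)) \<and> coefficients c1 c2 c3 (k + n) (k' + n)"
    if "x \<in> {Var_s, Var_u}" "y \<in> {Var_t, Var_v}" for x y
  proof -
    have "twisted (var x ^ N * (var y ^ N * v1)) (var x ^ N * (var y ^ N * v2)) (var x ^ N * (var y ^ N * v3)) (k + n) (k' + n)"
      using twisted_scale[OF twisted_scale[OF v bt[OF \<open>y \<in> {Var_t, Var_v}\<close>]] bs[OF \<open>x \<in> {Var_s, Var_u}\<close>]] by simp
    then show ?thesis using koszul_coefficients[OF loc[OF \<open>x \<in> {Var_s, Var_u}\<close> \<open>y \<in> {Var_t, Var_v}\<close>]] by metis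
  qed
  then obtain c1 c2 c3 where c: "\<And>x y. x \<in> {Var_s, Var_u} \<Longrightarrow> y \<in> {Var_t, Var_v} \<Longrightarrow>
      koszul_with (c1 x y) (c2 x y) (c3 x y) (var x ^ N * (var y ^ N * v1)) (var x ^ N * (var y ^ N * v2))
      (var x ^ N * (var y ^ N * v3))"
    and cd: "\<And>x y. x \<in> {Var_s, Var_u} \<Longrightarrow> y \<in> {Var_t, Var_v} \<Longrightarrow> coefficients (c1 x y) (c2 x y) (c3 x y) (k + n) (k' + n)"
    by metis
  have "\<exists>r. r \<in> bihom (a + 2 * n) (a' + n) \<and>
      var Var_u ^ N * c1 Var_s y - var Var_s ^ N * c1 Var_u y = r * f3 \<and>
      var Var_u ^ N * c2 Var_s y - var Var_s ^ N * c2 Var_u y = - (r * f2) \<and>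
      var Var_u ^ N * c3 Var_s y - var Var_s ^ N * c3 Var_u y = r * f1" if y: "y \<in> {Var_t, Var_v}" for y
  proof -
    obtain r where r: "r \<in> bihom (k + 2 * n - d1 - d2 - d3) ((k' + n) + 2 * 0 - d1' - d2' - d3')"
      "var Var_u ^ N * c1 Var_s y - var Var_s ^ N * c1 Var_u y = r * f3"
      "var Var_u ^ N * c2 Var_s y - var Var_s ^ N * c2 Var_u y = - (r * f2)"
      "var Var_u ^ N * c3 Var_s y - var Var_s ^ N * c3 Var_u y = r * f1"
      by (rule difference_multiple[OF c[of Var_s y] _ c[of Var_u y] _ bs[of Var_s] bs[of Var_u], of k "k' + n"])
        (use y cd in auto)
    have "r \<in> bihom (a + 2 * n) (a' + n)" using r(1) by (simp add: a_def a'_def algebra_simps)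
    then show ?thesis using r(2-) by blast
  qed
  then obtain r where r: "\<And>y. y \<in> {Var_t, Var_v} \<Longrightarrow> r y \<in> bihom (a + 2 * n) (a' + n)"
    "\<And>y. y \<in> {Var_t, Var_v} \<Longrightarrow> var Var_u ^ N * c1 Var_s y - var Var_s ^ N * c1 Var_u y = r y * f3"
    "\<And>y. y \<in> {Var_t, Var_v} \<Longrightarrow> var Var_u ^ N * c2 Var_s y - var Var_s ^ N * c2 Var_u y = - (r y * f2)"
    "\<And>y. y \<in> {Var_t, Var_v} \<Longrightarrow> var Var_u ^ N * c3 Var_s y - var Var_s ^ N * c3 Var_u y = r y * f1"
    by metis
  have "\<exists>r. r \<in> bihom (a + n) (a' + 2 * n) \<and>
      var Var_v ^ N * c1 x Var_t - var Var_t ^ N * c1 x Var_v = r * f3 \<and>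
      var Var_v ^ N * c2 x Var_t - var Var_t ^ N * c2 x Var_v = - (r * f2) \<and>
      var Var_v ^ N * c3 x Var_t - var Var_t ^ N * c3 x Var_v = r * f1" if x: "x \<in> {Var_s, Var_u}" for x
  proof -
    have c': "koszul_with (c1 x y) (c2 x y) (c3 x y) (var y ^ N * (var x ^ N * v1)) (var y ^ N * (var x ^ N * v2))
      (var y ^ N * (var x ^ N * v3))" if "y \<in> {Var_t, Var_v}" for y
      using c[OF x that] by (simp only: mult.left_commute)
    obtain r where r: "r \<in> bihom ((k + n) + 2 * 0 - d1 - d2 - d3) (k' + 2 * n - d1' - d2' - d3')"
      "var Var_v ^ N * c1 x Var_t - var Var_t ^ N * c1 x Var_v = r * f3"
      "var Var_v ^ N * c2 x Var_t - var Var_t ^ N * c2 x Var_v = - (r * f2)"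
      "var Var_v ^ N * c3 x Var_t - var Var_t ^ N * c3 x Var_v = r * f1"
      by (rule difference_multiple[OF c'[of Var_t] _ c'[of Var_v] _ bt[of Var_t] bt[of Var_v], of "k + n" k'])
        (use x cd in auto)
    have "r \<in> bihom (a + n) (a' + 2 * n)" using r(1) by (simp add: a_def a'_def algebra_simps)
    then show ?thesis using r(2-) by blast
  qed
  then obtain r' where r': "\<And>x. x \<in> {Var_s, Var_u} \<Longrightarrow> r' x \<in> bihom (a + n) (a' + 2 * n)"
    "\<And>x. x \<in> {Var_s, Var_u} \<Longrightarrow> var Var_v ^ N * c1 x Var_t - var Var_t ^ N * c1 x Var_v = r' x * f3"
    "\<And>x. x \<in> {Var_s, Var_u} \<Longrightarrow> var Var_v ^ N * c2 x Var_t - var Var_t ^ N * c2 x Var_v = - (r' x * f2)"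
    "\<And>x. x \<in> {Var_s, Var_u} \<Longrightarrow> var Var_v ^ N * c3 x Var_t - var Var_t ^ N * c3 x Var_v = r' x * f1"
    by metis
  define S U T W where "S = (var Var_s ^ N :: 'k bipoly)" and "U = (var Var_u ^ N :: 'k bipoly)"
    and "T = (var Var_t ^ N :: 'k bipoly)" and "W = (var Var_v ^ N :: 'k bipoly)"
  have cocycle: "W * r Var_t - T * r Var_v = U * r' Var_s - S * r' Var_u"
  proof -
    have gen: "(W * r Var_t - T * r Var_v) * f = (U * r' Var_s - S * r' Var_u) * f"
      if e: "U * ct - S * ct' = r Var_t * f" "U * cv - S * cv' = r Var_v * f"
        "W * ct - T * cv = r' Var_s * f" "W * ct' - T * cv' = r' Var_u * f" for f ct ct' cv cv'
    proof -
      have "(W * r Var_t - T * r Var_v) * f = W * (U * ct - S * ct') - T * (U * cv - S * cv')"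
        unfolding e by (simp add: algebra_simps)
      also have "\<dots> = U * (W * ct - T * cv) - S * (W * ct' - T * cv')" by (simp add: algebra_simps)
      also have "\<dots> = (U * r' Var_s - S * r' Var_u) * f" unfolding e by (simp add: algebra_simps)
      finally show ?thesis .
    qed
    consider "f3 \<noteq> 0" | "f2 \<noteq> 0" | "f1 \<noteq> 0" using not_all_zero by blast
    then show ?thesis
    proof cases
      case 1
      have "(W * r Var_t - T * r Var_v) * f3 = (U * r' Var_s - S * r' Var_u) * f3"
        unfolding S_def U_def T_def W_def
        by (rule gen[unfolded S_def U_def T_def W_def, OF r(2) r(2) r'(2) r'(2)]) simp_all
      then show ?thesis using 1 unfolding mult_cancel_right by blast
    next
      case 2
      have "(W * r Var_t - T * r Var_v) * (- f2) = (U * r' Var_s - S * r' Var_u) * (- f2)"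
        unfolding S_def U_def T_def W_def
        by (rule gen[unfolded S_def U_def T_def W_def, where f = "- f2", unfolded mult_minus_right, OF r(3) r(3) r'(3) r'(3), folded mult_minus_right]) simp_all
      then show ?thesis using 2 unfolding mult_cancel_right by auto
    next
      case 3
      have "(W * r Var_t - T * r Var_v) * f1 = (U * r' Var_s - S * r' Var_u) * f1"
        unfolding S_def U_def T_def W_def
        by (rule gen[unfolded S_def U_def T_def W_def, OF r(4) r(4) r'(4) r'(4)]) simp_all
      then show ?thesis using 3 unfolding mult_cancel_right by blast
    qed
  qed
  \<comment> \<open>If \<open>a' \<le> -1\<close>, then \<open>r Var_t\<close> and \<open>r Var_v\<close> have degree less than \<open>N\<close> in \<open>t, v\<close>. So no cancellation is possible
    between the two terms on the left of the cocycle condition.\<close>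
  have split: "\<exists>p q. r y = var Var_u ^ N * p - var Var_s ^ N * q" if y: "y \<in> {Var_t, Var_v}" for y
  proof (rule split_by_var_powers)
    fix e assume e: "e \<in> Poly_Mapping.keys (r y)"
    have ke: "int (Poly_Mapping.lookup e Var_s) + int (Poly_Mapping.lookup e Var_u) = a + 2 * n"
      "int (Poly_Mapping.lookup e Var_t) + int (Poly_Mapping.lookup e Var_v) = a' + n"
      using bihom_keys[OF r(1)[OF y] e] by auto
    show "N \<le> Poly_Mapping.lookup e Var_s \<or> N \<le> Poly_Mapping.lookup e Var_u"
      using cases
    proof
      assume "a \<ge> -1 \<and> a' \<ge> -1"
      then show ?thesis using ke(1) by (auto simp: n_def)
    next
      assume "a \<le> -1 \<and> a' \<le> -1"
      then have lt: "Poly_Mapping.lookup e Var_t < N" "Poly_Mapping.lookup e Var_v < N"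
        using ke(2) by (auto simp: n_def)
      consider "y = Var_t" | "y = Var_v" using y by blast
      then show ?thesis
      proof cases
        case 1
        have "W * r Var_t = T * r Var_v + (U * r' Var_s + S * (- r' Var_u))"
          using cocycle by (simp add: algebra_simps)
        from keys_of_combination[OF this[unfolded S_def U_def T_def W_def], of e] show ?thesis
          using e lt 1 by simp
      next
        case 2
        have "T * r Var_v = W * r Var_t + (U * (- r' Var_s) + S * r' Var_u)"
          using cocycle by (simp add: algebra_simps)
        from keys_of_combination[OF this[unfolded S_def U_def T_def W_def], of e] show ?thesis
          using e lt 2 by simp
      qed
    qed
  qed
  have half: "koszul (var y ^ N * v1) (var y ^ N * v2) (var y ^ N * v3)" if y: "y \<in> {Var_t, Var_v}" for y
  proof -
    obtain p q where pq: "r y = var Var_u ^ N * p - var Var_s ^ N * q" using split[OF y] by (elim exE) (rule that)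
    show ?thesis
      by (rule koszul_descent[OF _ c c r(2)[OF y] r(3)[OF y] r(4)[OF y] pq]) (use y in auto)
  qed
  have "\<exists>e1 e2 e3. koszul_with e1 e2 e3 (var y ^ N * v1) (var y ^ N * v2) (var y ^ N * v3) \<and>
      coefficients e1 e2 e3 k (k' + n)" if y: "y \<in> {Var_t, Var_v}" for y
  proof -
    have "twisted (var y ^ N * v1) (var y ^ N * v2) (var y ^ N * v3) k (k' + n)"
      using twisted_scale[OF v bt[OF y]] by simp
    then show ?thesis using koszul_coefficients[OF half[OF y]] by metis
  qed
  then obtain e1 e2 e3 where e: "\<And>y. y \<in> {Var_t, Var_v} \<Longrightarrow>
      koszul_with (e1 y) (e2 y) (e3 y) (var y ^ N * v1) (var y ^ N * v2) (var y ^ N * v3)"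
    and ed: "\<And>y. y \<in> {Var_t, Var_v} \<Longrightarrow> coefficients (e1 y) (e2 y) (e3 y) k (k' + n)"
    by metis
  \<comment> \<open>If \<open>a \<le> -1\<close>, the cocycle \<open>q\<close> that is left over has negative degree in \<open>s, u\<close>, so it has no monomials.\<close>
  obtain q where q: "q \<in> bihom (k + 2 * 0 - d1 - d2 - d3) (k' + 2 * n - d1' - d2' - d3')"
    "var Var_v ^ N * e1 Var_t - var Var_t ^ N * e1 Var_v = q * f3"
    "var Var_v ^ N * e2 Var_t - var Var_t ^ N * e2 Var_v = - (q * f2)"
    "var Var_v ^ N * e3 Var_t - var Var_t ^ N * e3 Var_v = q * f1"
    by (rule difference_multiple[OF e[of Var_t] _ e[of Var_v] _ bt[of Var_t] bt[of Var_v], of k k'])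
      (use ed in auto)
  have qd: "q \<in> bihom a (a' + 2 * n)" using q(1) by (simp add: a_def a'_def algebra_simps)
  have "\<exists>p p'. q = var Var_v ^ N * p - var Var_t ^ N * p'"
  proof (rule split_by_var_powers)
    fix d assume d: "d \<in> Poly_Mapping.keys q"
    have "int (Poly_Mapping.lookup d Var_s) + int (Poly_Mapping.lookup d Var_u) = a"
      "int (Poly_Mapping.lookup d Var_t) + int (Poly_Mapping.lookup d Var_v) = a' + 2 * n"
      using bihom_keys[OF qd d] by auto
    then show "N \<le> Poly_Mapping.lookup d Var_t \<or> N \<le> Poly_Mapping.lookup d Var_v"
      using cases by (auto simp: n_def)
  qed
  then obtain p p' where pp: "q = var Var_v ^ N * p - var Var_t ^ N * p'" by (elim exE) (rule that)
  show ?thesis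
    by (rule koszul_descent[OF _ e e q(2-4) pp]) auto
qed

end


section \<open>Stalks at a point\<close>

lemma stalk_iff:
  "z \<in> ideal_sheaf_stalk J P \<longleftrightarrow>
    (\<exists>a b k k'. a \<in> J \<and> a \<in> bihom k k' \<and> b \<in> bihom k k' \<and> b \<notin> P \<and> z = to_fract a / to_fract b)"
  unfolding ideal_sheaf_stalk_def Fract_conv_to_fract by blast

lemma stalkI:
  "a \<in> J \<Longrightarrow> a \<in> bihom k k' \<Longrightarrow> b \<in> bihom k k' \<Longrightarrow> b \<notin> P \<Longrightarrow> z = to_fract a / to_fract b \<Longrightarrow>
    z \<in> ideal_sheaf_stalk J P"
  unfolding stalk_iff by blast

lemma stalkE:
  assumes "z \<in> ideal_sheaf_stalk J P"
  obtains a b k k' where "a \<in> J" "a \<in> bihom k k'" "b \<in> bihom k k'" "b \<notin> P" "z = to_fract a / to_fract b"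
  using assms unfolding stalk_iff by (elim exE conjE) (rule that)

lemma pointD:
  assumes "P \<in> points"
  shows "prime_ideal P" "homogeneous P"
  using assms bihom_ideal_iff_homogeneous[of P] prime_idealD(1) by (auto simp: points_def)

lemma pointE:
  fixes P :: "'k::field bipoly set"
  assumes "P \<in> points"
  obtains x z y w where "(x, z) \<in> {(Var_s, Var_u), (Var_u, Var_s)}" "var x \<notin> P"
    "(y, w) \<in> {(Var_t, Var_v), (Var_v, Var_t)}" "var y \<notin> P"
proof -
  note sub = prime_idealD(1)[OF pointD(1)[OF assms]]
  have "\<not> ({var Var_s * var Var_t, var Var_s * var Var_v, var Var_u * var Var_t, var Var_u * var Var_v} \<subseteq> P)"
  proof
    assume "{var Var_s * var Var_t, var Var_s * var Var_v, var Var_u * var Var_t, var Var_u * var Var_v} \<subseteq> P"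
    then have "irrelevant_ideal \<subseteq> P" unfolding irrelevant_ideal_def by (rule ideal.span_minimal[OF _ sub])
    then show False using assms by (simp add: points_def)
  qed
  then obtain x y where xy: "x \<in> {Var_s, Var_u}" "y \<in> {Var_t, Var_v}" "var x * var y \<notin> P" by blast
  then have "var x \<notin> P" "var y \<notin> P" using ideal_mult_left[OF sub] ideal_mult_right[OF sub] by blast+
  moreover obtain z where "(x, z) \<in> {(Var_s, Var_u), (Var_u, Var_s)}" using xy(1) by blast
  moreover obtain w where "(y, w) \<in> {(Var_t, Var_v), (Var_v, Var_t)}" using xy(2) by blast
  ultimately show thesis using that by blast
qed

lemma var_bihom_cases:
  "(x, z) \<in> {(Var_s, Var_u), (Var_u, Var_s)} \<Longrightarrow> var x \<in> bihom 1 0"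
  "(y, w) \<in> {(Var_t, Var_v), (Var_v, Var_t)} \<Longrightarrow> var y \<in> bihom 0 1"
  using var_bihom by auto

text \<open>For \<open>k, k' \<ge> 0\<close>, division by this monomial trivializes the line bundle of bidegree \<open>(k, k')\<close> at the
  points where \<open>x\<close> and \<open>y\<close> do not vanish.\<close>

definition unit_monomial :: "bivar \<Rightarrow> bivar \<Rightarrow> int \<Rightarrow> int \<Rightarrow> 'k::field bipoly" where
  "unit_monomial x y k k' = var x ^ nat k * var y ^ nat k'"

lemma unit_monomial_bihom:
  fixes x y z w
  assumes "(x, z) \<in> {(Var_s, Var_u), (Var_u, Var_s)}" "(y, w) \<in> {(Var_t, Var_v), (Var_v, Var_t)}"
    and "k \<ge> 0" "k' \<ge> 0"
  shows "unit_monomial x y k k' \<in> bihom k k'"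
  using bihom_mult[OF bihom_power[OF var_bihom_cases(1)[OF assms(1)], of "nat k"]
      bihom_power[OF var_bihom_cases(2)[OF assms(2)], of "nat k'"]] assms(3,4)
  by (simp add: unit_monomial_def)

lemma unit_monomial_not_mem:
  assumes "prime_ideal P" "var x \<notin> P" "var y \<notin> P"
  shows "unit_monomial x y k k' \<notin> P"
  unfolding unit_monomial_def
  by (intro prime_ideal_not_mem_mult prime_ideal_not_mem_power assms)

lemma unit_monomial_add:
  "k \<ge> 0 \<Longrightarrow> k' \<ge> 0 \<Longrightarrow> l \<ge> 0 \<Longrightarrow> l' \<ge> 0 \<Longrightarrow>
    unit_monomial x y (k + l) (k' + l') = unit_monomial x y k k' * unit_monomial x y l l'"
  by (simp add: unit_monomial_def nat_add_distrib power_add mult_ac)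

lemma unit_monomial_nonzero: "unit_monomial x y k k' \<noteq> (0 :: 'k::field bipoly)"
  by (simp add: unit_monomial_def var_nonzero)

lemma subring_stalk:
  fixes P :: "'k::field bipoly set"
  assumes "prime_ideal P"
  shows "subring_carrier (structure_stalk P)"
proof
  have one: "1 \<notin> P" by (rule prime_idealD(2)[OF assms])
  show "0 \<in> structure_stalk P" by (rule stalkI[of 0 _ 0 0 1]) (use one in auto)
  show "1 \<in> structure_stalk P" by (rule stalkI[of 1 _ 0 0 1]) (use one in auto)
next
  fix z z' assume "z \<in> structure_stalk P" "z' \<in> structure_stalk P"
  then obtain a b k k' a' b' l l' where z: "a \<in> bihom k k'" "b \<in> bihom k k'" "b \<notin> P" "z = to_fract a / to_fract b"
      and z': "a' \<in> bihom l l'" "b' \<in> bihom l l'" "b' \<notin> P" "z' = to_fract a' / to_fract b'"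
    by (elim stalkE) (rule that)
  have b0: "b \<noteq> 0" "b' \<noteq> 0" using not_mem_nonzero[OF assms] z z' by auto
  have bb: "b * b' \<notin> P" by (rule prime_ideal_not_mem_mult[OF assms z(3) z'(3)])
  have deg: "b * b' \<in> bihom (k + l) (k' + l')" by (rule bihom_mult[OF z(2) z'(2)])
  have "a * b' + b * a' \<in> bihom (k + l) (k' + l')"
    by (intro bihom_add bihom_mult z z')
  moreover have "z + z' = to_fract (a * b' + b * a') / to_fract (b * b')"
    using z z' b0 by (simp add: field_simps)
  ultimately show "z + z' \<in> structure_stalk P" using stalkI[OF UNIV_I _ deg bb] by blast
  have "a * a' \<in> bihom (k + l) (k' + l')" by (intro bihom_mult z z')
  moreover have "z * z' = to_fract (a * a') / to_fract (b * b')" using z z' by simp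
  ultimately show "z * z' \<in> structure_stalk P" using stalkI[OF UNIV_I _ deg bb] by blast
next
  fix z assume "z \<in> structure_stalk P"
  then obtain a b k k' where z: "a \<in> bihom k k'" "b \<in> bihom k k'" "b \<notin> P" "z = to_fract a / to_fract b"
    by (elim stalkE) (rule that)
  show "- z \<in> structure_stalk P"
    by (rule stalkI[of "- a" _ k k' b]) (use z in \<open>auto intro: bihom_uminus\<close>)
qed

lemma stalk_subset_localization: "structure_stalk P \<subseteq> localization P"
  unfolding localization_def by (intro subsetI, elim stalkE) blast

lemma common_denominator:
  assumes P: "prime_ideal P" and S: "finite S" "S \<subseteq> localization P"
  shows "\<exists>b. b \<notin> P \<and> (\<forall>z\<in>S. \<exists>a. z = to_fract a / to_fract b)"
  using S
proof (induction S rule: finite_induct)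
  case empty
  then show ?case using prime_idealD(2)[OF P] by blast
next
  case (insert z S)
  then obtain b where b: "b \<notin> P" "\<And>z. z \<in> S \<Longrightarrow> \<exists>a. z = to_fract a / to_fract b" by auto
  have "z \<in> localization P" using insert.prems by simp
  then obtain a' b' where b': "b' \<notin> P" "b' \<noteq> 0" "z = to_fract a' / to_fract b'"
    by (elim localizationE[OF P]) (rule that)
  have b0: "b \<noteq> 0" by (rule not_mem_nonzero[OF P b(1)])
  have "\<exists>a. y = to_fract a / to_fract (b * b')" if y: "y \<in> insert z S" for y
  proof (cases "y = z")
    case True
    have "z = to_fract (a' * b) / to_fract (b * b')" unfolding b'(3) using b'(2) b0 by simp
    then show ?thesis using True by blast
  next
    case False
    then obtain a where a: "y = to_fract a / to_fract b" using b(2) y by blast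
    have "y = to_fract (a * b') / to_fract (b * b')" unfolding a using b'(2) b0 by simp
    then show ?thesis by blast
  qed
  then show ?case using prime_ideal_not_mem_mult[OF P b(1) b'(1)] by blast
qed

context bihom_triple
begin

lemma homogeneous_I: "homogeneous I"
  by (rule homogeneous_span) (use f1 f2 f3 in blast)

lemma f_in_I: "f1 \<in> I" "f2 \<in> I" "f3 \<in> I"
  by (auto intro: ideal.span_base)

lemma I_homogeneous_coefficients:
  assumes "a \<in> I" "a \<in> bihom k k'"
  obtains r1 r2 r3 where "a = r1 * f1 + r2 * f2 + r3 * f3" "r1 \<in> bihom (k - d1) (k' - d1')"
    "r2 \<in> bihom (k - d2) (k' - d2')" "r3 \<in> bihom (k - d3) (k' - d3')"
proof -
  obtain r1 r2 r3 where r: "a = r1 * f1 + r2 * f2 + r3 * f3" using assms(1) mem_span3 by blast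
  have cm: "component (k, k') (c * f) = component (k - l, k' - l') c * f" if "f \<in> bihom l l'" for c f l l'
    using component_mult_bihom[OF that, of k k' c] by (simp add: mult.commute)
  have "a = component (k, k') (r1 * f1 + r2 * f2 + r3 * f3)" using component_bihom[OF assms(2)] r by simp
  then have "a = component (k - d1, k' - d1') r1 * f1 + component (k - d2, k' - d2') r2 * f2
      + component (k - d3, k' - d3') r3 * f3"
    by (simp only: component_add cm[OF f1] cm[OF f2] cm[OF f3])
  then show thesis by (rule that) (rule component_in_bihom)+
qed

lemma mem_twisted_piece:
  "(v1, v2, v3) \<in> twisted_piece (d1, d1') (d2, d2') (d3, d3') k k' \<longleftrightarrow> twisted v1 v2 v3 k k'"
  by (simp add: twisted_piece_def twisted_def)

lemma mem_vanishing_syzygies: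
  "(v1, v2, v3) \<in> vanishing_syzygies f1 f2 f3 \<longleftrightarrow>
    v1 * f1 + v2 * f2 + v3 * f3 = 0 \<and> v1 \<in> saturation I \<and> v2 \<in> saturation I \<and> v3 \<in> saturation I"
  by (simp add: vanishing_syzygies_def Let_def)

lemma I_subset_saturation: "I \<subseteq> saturation I"
  unfolding saturation_def
  by (auto intro!: exI[of _ 0] intro: ideal_mult_left[OF ideal.subspace_span])

definition syzygies_agree :: bool where
  "syzygies_agree \<longleftrightarrow> (\<forall>k k' :: int.
      (k - (d1 + d2 + d3) + 1) * (k' - (d1' + d2' + d3') + 1) \<ge> 0 \<longrightarrow>
      koszul_syzygies f1 f2 f3 \<inter> twisted_piece (d1, d1') (d2, d2') (d3, d3') k k' =
      vanishing_syzygies f1 f2 f3 \<inter> twisted_piece (d1, d1') (d2, d2') (d3, d3') k k')"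


section \<open>From equality of syzygies to complete intersections\<close>

lemma shifted_components:
  assumes "finite D" "(\<lambda>(e, e'). (e + l, e' + l')) ` bidegrees a \<subseteq> D"
  shows "(\<Sum>(k, k')\<in>D. component (k - l, k' - l') a) = a"
proof -
  let ?h = "\<lambda>(k, k'). (k - l, k' - l')"
  have inj: "inj_on ?h D" by (auto simp: inj_on_def)
  have "(\<Sum>(k, k')\<in>D. component (k - l, k' - l') a) = (\<Sum>d\<in>?h ` D. component d a)"
    unfolding sum.reindex[OF inj] by (intro sum.cong) auto
  also have "\<dots> = a"
  proof (rule sum_component)
    show "bidegree ` Poly_Mapping.keys a \<subseteq> ?h ` D"
    proof
      fix d assume d: "d \<in> bidegree ` Poly_Mapping.keys a"
      obtain e e' where ee: "d = (e, e')" by (cases d)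
      have "(e + l, e' + l') \<in> D" using d ee assms(2) by (auto simp: bidegrees_def)
      then show "d \<in> ?h ` D" using ee by (force intro!: image_eqI[of _ _ "(e + l, e' + l')"])
    qed
  qed (use assms(1) in simp)
  finally show ?thesis .
qed

text \<open>Multiplication by a power of \<open>m\<close> moves each of the finitely many bihomogeneous components into a
  bidegree with \<open>k \<ge> \<Sum>d - 1\<close> and \<open>k' \<ge> \<Sum>d' - 1\<close>.\<close>

lemma koszul_after_power:
  assumes agree: syzygies_agree and m: "m \<in> bihom 1 1"
    and a: "a1 \<in> I" "a2 \<in> I" "a3 \<in> I" and syz: "a1 * f1 + a2 * f2 + a3 * f3 = 0"
  shows "\<exists>N. koszul (m ^ N * a1) (m ^ N * a2) (m ^ N * a3)"
proof -
  define S where "S = {(v1, v2, v3). \<exists>N. koszul (m ^ N * v1) (m ^ N * v2) (m ^ N * v3)}"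
  have S_add: "(v1 + w1, v2 + w2, v3 + w3) \<in> S" if vw: "(v1, v2, v3) \<in> S" "(w1, w2, w3) \<in> S" for v1 v2 v3 w1 w2 w3
  proof -
    obtain N where N: "koszul (m ^ N * v1) (m ^ N * v2) (m ^ N * v3)" using vw(1) by (auto simp: S_def)
    obtain M where M: "koszul (m ^ M * w1) (m ^ M * w2) (m ^ M * w3)" using vw(2) by (auto simp: S_def)
    have "koszul (m ^ M * (m ^ N * v1) + m ^ N * (m ^ M * w1)) (m ^ M * (m ^ N * v2) + m ^ N * (m ^ M * w2))
        (m ^ M * (m ^ N * v3) + m ^ N * (m ^ M * w3))"
      by (intro koszul_add koszul_scale N M)
    moreover have "m ^ M * (m ^ N * v) + m ^ N * (m ^ M * w) = m ^ (M + N) * (v + w)" for v w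
      by (simp add: power_add algebra_simps)
    ultimately show ?thesis unfolding S_def by auto
  qed
  define comp where "comp l l' d a = component (fst d - l, snd d - l') a" for l l' :: int and d and a :: "'k bipoly"
  have piece: "(comp d1 d1' d a1, comp d2 d2' d a2, comp d3 d3' d a3) \<in> S" for d
  proof -
    obtain k k' where d: "d = (k, k')" by (cases d)
    define v1 v2 v3 where "v1 = comp d1 d1' d a1" and "v2 = comp d2 d2' d a2" and "v3 = comp d3 d3' d a3"
    have tw: "twisted v1 v2 v3 k k'" by (simp add: twisted_def v1_def v2_def v3_def comp_def d)
    have vI: "v1 \<in> I" "v2 \<in> I" "v3 \<in> I"
      unfolding v1_def v2_def v3_def comp_def by (intro homogeneousD[OF homogeneous_I] a)+
    have cm: "component (k, k') (f * c) = f * component (k - l, k' - l') c" if "f \<in> bihom l l'" for c f l l'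
      by (rule component_mult_bihom[OF that])
    have "f1 * v1 + f2 * v2 + f3 * v3 = component (k, k') (f1 * a1 + f2 * a2 + f3 * a3)"
      by (simp add: component_add cm[OF f1] cm[OF f2] cm[OF f3] v1_def v2_def v3_def comp_def d)
    also have "f1 * a1 + f2 * a2 + f3 * a3 = 0" using syz by (simp add: mult.commute)
    finally have vsyz: "v1 * f1 + v2 * f2 + v3 * f3 = 0" by (simp add: mult.commute)
    define N where "N = nat (\<bar>k\<bar> + \<bar>k'\<bar> + \<bar>d1 + d2 + d3\<bar> + \<bar>d1' + d2' + d3'\<bar>)"
    have mN: "m ^ N \<in> bihom (int N) (int N)" using bihom_power[OF m, of N] by simp
    have tw': "twisted (m ^ N * v1) (m ^ N * v2) (m ^ N * v3) (k + int N) (k' + int N)"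
      by (rule twisted_scale[OF tw mN])
    have "m ^ N * v1 * f1 + m ^ N * v2 * f2 + m ^ N * v3 * f3 = m ^ N * (v1 * f1 + v2 * f2 + v3 * f3)"
      by (simp add: algebra_simps)
    also have "\<dots> = 0" unfolding vsyz by simp
    finally have "(m ^ N * v1, m ^ N * v2, m ^ N * v3) \<in> vanishing_syzygies f1 f2 f3"
      unfolding mem_vanishing_syzygies
      using vI I_subset_saturation by (auto intro!: subsetD[OF I_subset_saturation] ideal_mult_left[OF ideal.subspace_span])
    moreover have "(k + int N - (d1 + d2 + d3) + 1) * (k' + int N - (d1' + d2' + d3') + 1) \<ge> 0"
      by (intro mult_nonneg_nonneg) (auto simp: N_def)
    ultimately have "(m ^ N * v1, m ^ N * v2, m ^ N * v3) \<in> koszul_syzygies f1 f2 f3"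
      using agree tw' unfolding syzygies_agree_def mem_twisted_piece[symmetric] by blast
    then show ?thesis unfolding S_def mem_koszul_syzygies v1_def v2_def v3_def by blast
  qed
  define D where "D = (\<lambda>(e, e'). (e + d1, e' + d1')) ` bidegrees a1 \<union> (\<lambda>(e, e'). (e + d2, e' + d2')) ` bidegrees a2
     \<union> (\<lambda>(e, e'). (e + d3, e' + d3')) ` bidegrees a3"
  have fin: "finite D" by (simp add: D_def)
  have "((\<Sum>d\<in>E. comp d1 d1' d a1), (\<Sum>d\<in>E. comp d2 d2' d a2), (\<Sum>d\<in>E. comp d3 d3' d a3)) \<in> S"
    if "finite E" for E
    using that
  proof (induction E rule: finite_induct)
    case empty
    then show ?case using koszul_0 by (simp add: S_def)
  next
    case (insert d E)
    then show ?case using S_add[OF piece[of d] insert.IH] by simp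
  qed
  from this[OF fin] have "((\<Sum>d\<in>D. comp d1 d1' d a1), (\<Sum>d\<in>D. comp d2 d2' d a2), (\<Sum>d\<in>D. comp d3 d3' d a3)) \<in> S" .
  moreover have "(\<Sum>d\<in>D. comp d1 d1' d a1) = a1" "(\<Sum>d\<in>D. comp d2 d2' d a2) = a2" "(\<Sum>d\<in>D. comp d3 d3' d a3) = a3"
    using shifted_components[OF fin, of d1 d1' a1] shifted_components[OF fin, of d2 d2' a2]
      shifted_components[OF fin, of d3 d3' a3]
    by (auto simp: D_def comp_def case_prod_unfold)
  ultimately show ?thesis by (simp add: S_def)
qed

text \<open>In the local ring at the point all syzygies with coefficients in the ideal are Koszul. So some Koszul
  syzygy is not divisible by the maximal ideal, and then the generator that does not occur in it is
  redundant. The local ring here is the one of the cone; it is larger than the stalk, but the conclusion has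
  no denominators.\<close>

lemma redundant_generator_at_point:
  assumes agree: syzygies_agree and P: "P \<in> base_points I"
  shows "\<exists>c p q. c \<notin> P \<and> (c * f3 = p * f1 + q * f2 \<or> c * f2 = p * f1 + q * f3 \<or> c * f1 = p * f2 + q * f3)"
proof -
  have Pp: "P \<in> points" and IP: "I \<subseteq> P" using P by (auto simp: base_points_def)
  note prime = pointD(1)[OF Pp] and hom = pointD(2)[OF Pp]
  obtain x z y w where xz: "(x, z) \<in> {(Var_s, Var_u), (Var_u, Var_s)}" "var x \<notin> P"
    and yw: "(y, w) \<in> {(Var_t, Var_v), (Var_v, Var_t)}" "var y \<notin> P"
    by (rule pointE[OF Pp])
  define m where "m = var x * (var y :: 'k bipoly)"
  have m: "m \<in> bihom 1 1" using bihom_mult[OF var_bihom_cases(1)[OF xz(1)] var_bihom_cases(2)[OF yw(1)]] by (simp add: m_def)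
  have mP: "m \<notin> P" unfolding m_def by (rule prime_ideal_not_mem_mult[OF prime xz(2) yw(2)])
  have fP: "{f1, f2, f3} \<subseteq> P" using f_in_I IP by blast
  obtain f0 where f0: "f0 \<in> {f1, f2, f3}" "f0 \<noteq> 0" using not_all_zero by blast
  obtain \<xi> \<eta> where lp: "local_parameters P \<xi> \<eta>"
    using local_parameters_exist[OF prime hom xz yw fP no_common_prime f0] by blast
  define A where "A = localization P"
  interpret regular_surface_point A "localized_ideal P P" "to_fract \<xi>" "to_fract \<eta>"
    unfolding A_def by (rule localization_point[OF prime prime_product_bipoly lp])
  let ?g1 = "to_fract f1" and ?g2 = "to_fract f2" and ?g3 = "to_fract f3"
  have one: "1 \<notin> P" by (rule prime_idealD(2)[OF prime])
  have inM: "to_fract f \<in> localized_ideal P P" if "f \<in> P" for f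
    unfolding localized_ideal_def using that one by (intro CollectI exI[of _ f] exI[of _ 1]) simp
  have gM: "?g1 \<in> localized_ideal P P" "?g2 \<in> localized_ideal P P" "?g3 \<in> localized_ideal P P"
    using inM fP by auto
  have nz: "?g1 \<noteq> 0 \<or> ?g2 \<noteq> 0 \<or> ?g3 \<noteq> 0" using not_all_zero by simp
  have frac: "r \<in> A" if "r * ?g1 \<in> A" "r * ?g2 \<in> A" "r * ?g3 \<in> A" for r
    unfolding A_def
    by (rule localization_normal[OF prime prime_product_bipoly _ no_common_prime]) (use that A_def in auto)
  define J where "J = {a. \<exists>p\<in>A. \<exists>q\<in>A. \<exists>r\<in>A. a = p * ?g1 + q * ?g2 + r * ?g3}"
  have J_iff: "a \<in> J \<longleftrightarrow> (\<exists>p\<in>A. \<exists>q\<in>A. \<exists>r\<in>A. a = p * ?g1 + q * ?g2 + r * ?g3)" for a by (simp add: J_def)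
  have J_E: "\<exists>a'. a' \<in> I \<and> b \<notin> P \<and> a = to_fract a' / to_fract b"
    if "b \<notin> P" "a = (to_fract p / to_fract b) * ?g1 + (to_fract q / to_fract b) * ?g2 + (to_fract r / to_fract b) * ?g3" for a b p q r
  proof -
    have "a = to_fract (p * f1 + q * f2 + r * f3) / to_fract b" unfolding that(2) by (simp add: add_divide_distrib)
    moreover have "p * f1 + q * f2 + r * f3 \<in> I" using mem_span3 by blast
    ultimately show ?thesis using that(1) by blast
  qed
  have kos: "\<exists>c1\<in>A. \<exists>c2\<in>A. \<exists>c3\<in>A. a1 = c1 * ?g2 + c2 * ?g3 \<and> a2 = - c1 * ?g1 + c3 * ?g3 \<and> a3 = - c2 * ?g1 - c3 * ?g2"
    if aJ: "a1 \<in> J" "a2 \<in> J" "a3 \<in> J" and syz: "a1 * ?g1 + a2 * ?g2 + a3 * ?g3 = 0" for a1 a2 a3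
  proof -
    obtain p1 q1 r1 where 1: "p1 \<in> A" "q1 \<in> A" "r1 \<in> A" "a1 = p1 * ?g1 + q1 * ?g2 + r1 * ?g3"
      using aJ(1) unfolding J_iff by (elim bexE) (rule that)
    obtain p2 q2 r2 where 2: "p2 \<in> A" "q2 \<in> A" "r2 \<in> A" "a2 = p2 * ?g1 + q2 * ?g2 + r2 * ?g3"
      using aJ(2) unfolding J_iff by (elim bexE) (rule that)
    obtain p3 q3 r3 where 3: "p3 \<in> A" "q3 \<in> A" "r3 \<in> A" "a3 = p3 * ?g1 + q3 * ?g2 + r3 * ?g3"
      using aJ(3) unfolding J_iff by (elim bexE) (rule that)
    obtain b where b: "b \<notin> P" "\<And>z. z \<in> {p1, q1, r1, p2, q2, r2, p3, q3, r3} \<Longrightarrow> \<exists>a. z = to_fract a / to_fract b"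
      using common_denominator[OF prime, of "{p1, q1, r1, p2, q2, r2, p3, q3, r3}"] 1 2 3 unfolding A_def by auto
    have b0: "b \<noteq> 0" by (rule not_mem_nonzero[OF prime b(1)])
    have num: "\<exists>a'. a' \<in> I \<and> a = to_fract a' / to_fract b"
      if mem: "p \<in> {p1, q1, r1, p2, q2, r2, p3, q3, r3}" "q \<in> {p1, q1, r1, p2, q2, r2, p3, q3, r3}"
        "r \<in> {p1, q1, r1, p2, q2, r2, p3, q3, r3}" and eq: "a = p * ?g1 + q * ?g2 + r * ?g3" for a p q r
    proof -
      obtain p' where p': "p = to_fract p' / to_fract b" using b(2)[OF mem(1)] by blast
      obtain q' where q': "q = to_fract q' / to_fract b" using b(2)[OF mem(2)] by blast
      obtain r' where r': "r = to_fract r' / to_fract b" using b(2)[OF mem(3)] by blast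
      show ?thesis using J_E[OF b(1) eq[unfolded p' q' r']] by blast
    qed
    obtain a1' where a1': "a1' \<in> I" "a1 = to_fract a1' / to_fract b" using num[OF _ _ _ 1(4)] by auto
    obtain a2' where a2': "a2' \<in> I" "a2 = to_fract a2' / to_fract b" using num[OF _ _ _ 2(4)] by auto
    obtain a3' where a3': "a3' \<in> I" "a3 = to_fract a3' / to_fract b" using num[OF _ _ _ 3(4)] by auto
    have "to_fract (a1' * f1 + a2' * f2 + a3' * f3) / to_fract b = a1 * ?g1 + a2 * ?g2 + a3 * ?g3"
      unfolding a1' a2' a3' by (simp add: add_divide_distrib)
    then have "to_fract (a1' * f1 + a2' * f2 + a3' * f3) = 0" using syz b0 by simp
    then have "a1' * f1 + a2' * f2 + a3' * f3 = 0" by (simp only: to_fract_eq_0_iff)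
    from koszul_after_power[OF agree m a1'(1) a2'(1) a3'(1) this] obtain N where
      N: "koszul (m ^ N * a1') (m ^ N * a2') (m ^ N * a3')" by blast
    then obtain c1 c2 c3 where c: "koszul_with c1 c2 c3 (m ^ N * a1') (m ^ N * a2') (m ^ N * a3')"
      unfolding koszul_def by (elim exE) (rule that)
    have mN: "m ^ N \<notin> P" by (rule prime_ideal_not_mem_power[OF prime mP])
    have m0: "m ^ N \<noteq> 0" by (rule not_mem_nonzero[OF prime mN])
    define e where "e = m ^ N * b"
    have eP: "e \<notin> P" unfolding e_def by (rule prime_ideal_not_mem_mult[OF prime mN b(1)])
    have a_e: "to_fract a / to_fract b = to_fract (m ^ N * a) / to_fract e" for a
    proof -
      have "to_fract (m ^ N) \<noteq> 0" using m0 by (simp only: to_fract_eq_0_iff not_False_eq_True)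
      then show ?thesis unfolding e_def to_fract_mult by (rule mult_divide_mult_cancel_left[symmetric])
    qed
    have "a1 = to_fract c1 / to_fract e * ?g2 + to_fract c2 / to_fract e * ?g3"
      "a2 = - (to_fract c1 / to_fract e) * ?g1 + to_fract c3 / to_fract e * ?g3"
      "a3 = - (to_fract c2 / to_fract e) * ?g1 - to_fract c3 / to_fract e * ?g2"
      unfolding a1'(2) a2'(2) a3'(2) a_e using c unfolding koszul_with_def
      by (simp_all add: add_divide_distrib diff_divide_distrib)
    moreover have "to_fract c / to_fract e \<in> A" for c unfolding A_def by (rule localizationI[OF prime eP refl])
    ultimately show ?thesis by blast
  qed
  have clear: "\<exists>c p' q'. c \<notin> P \<and> c * g3 = p' * g1 + q' * g2"
    if pq: "p \<in> A" "q \<in> A" "to_fract g3 = p * to_fract g1 + q * to_fract g2" for p q g1 g2 g3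
  proof -
    obtain b where b: "b \<notin> P" "\<And>z. z \<in> {p, q} \<Longrightarrow> \<exists>a. z = to_fract a / to_fract b"
      using common_denominator[OF prime, of "{p, q}"] pq unfolding A_def by auto
    obtain p' where p': "p = to_fract p' / to_fract b" using b(2)[of p] by auto
    obtain q' where q': "q = to_fract q' / to_fract b" using b(2)[of q] by auto
    have "to_fract (b * g3) = to_fract (p' * g1 + q' * g2)"
      using not_mem_nonzero[OF prime b(1)] unfolding to_fract_mult to_fract_add pq(3) p' q' by (simp add: distrib_left)
    then show ?thesis using b(1) unfolding to_fract_eq_iff by blast
  qed
  have "\<not> (koszul_reducible ?g1 ?g2 ?g3 \<and> koszul_reducible ?g1 ?g3 ?g2 \<and> koszul_reducible ?g2 ?g3 ?g1)"
    using not_all_koszul_reducible[OF gM nz frac kos J_iff] by blast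
  then consider "\<not> koszul_reducible ?g1 ?g2 ?g3" | "\<not> koszul_reducible ?g1 ?g3 ?g2" | "\<not> koszul_reducible ?g2 ?g3 ?g1"
    by blast
  then show ?thesis
  proof cases
    case 1
    then show ?thesis using generator_redundant[OF gM(1,2,3)] clear by blast
  next
    case 2
    then show ?thesis using generator_redundant[OF gM(1,3,2)] clear by blast
  next
    case 3
    then show ?thesis using generator_redundant[OF gM(2,3,1)] clear by blast
  qed
qed

end


lemma generated_ideal_Nil: "generated_ideal A [] = {0}"
  by (auto simp: generated_ideal_def)

lemma generated_ideal_single: "z \<in> generated_ideal A [g] \<longleftrightarrow> (\<exists>c\<in>A. z = c * g)"
proof
  assume "\<exists>c\<in>A. z = c * g"
  then obtain c where "c \<in> A" "z = c * g" by blast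
  then show "z \<in> generated_ideal A [g]"
    unfolding generated_ideal_def by (intro CollectI exI[of _ "\<lambda>i. c"]) simp
qed (auto simp: generated_ideal_def)

lemma generated_ideal_pair: "z \<in> generated_ideal A [g, h] \<longleftrightarrow> (\<exists>c\<in>A. \<exists>d\<in>A. z = c * g + d * h)"
proof
  assume "\<exists>c\<in>A. \<exists>d\<in>A. z = c * g + d * h"
  then obtain c d where "c \<in> A" "d \<in> A" "z = c * g + d * h" by blast
  then show "z \<in> generated_ideal A [g, h]"
    unfolding generated_ideal_def
    by (intro CollectI exI[of _ "\<lambda>i. if i = 0 then c else d"]) (simp add: less_Suc_eq numeral_2_eq_2)
next
  assume "z \<in> generated_ideal A [g, h]"
  then obtain c where c: "z = (\<Sum>i<length [g, h]. c i * [g, h] ! i)" "\<forall>i<length [g, h]. c i \<in> A"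
    unfolding generated_ideal_def by blast
  have "z = c 0 * g + c 1 * h" using c(1) by simp
  moreover have "c 0 \<in> A" "c 1 \<in> A" using c(2) by auto
  ultimately show "\<exists>c\<in>A. \<exists>d\<in>A. z = c * g + d * h" by blast
qed

context bihom_triple
begin

text \<open>Otherwise the other generator \<open>g\<close> generates the ideal at \<open>P\<close>, and \<open>1 / g\<close> multiplies the ideal into the
  local ring. This would make \<open>1 / g\<close> regular at \<open>P\<close>, although \<open>g\<close> vanishes there.\<close>

lemma generator_nonzero:
  assumes P: "prime_ideal P" "I \<subseteq> P" and red: "c \<notin> P" "c * f3 = p * f1 + q * f2"
  shows "f1 \<noteq> 0" "f2 \<noteq> 0"
proof -
  have c0: "c \<noteq> 0" by (rule not_mem_nonzero[OF P(1) red(1)])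
  have False if g: "g \<noteq> 0" "g \<in> P" "c * f3 = r * g" "{f1, f2} \<subseteq> {0, g}" for g r
  proof -
    define z where "z = 1 / to_fract g"
    have zf: "z * to_fract f \<in> localization P" if f: "f \<in> {f1, f2, f3}" for f
    proof -
      have z1: "z * to_fract g = 1" using g(1) by (simp add: z_def)
      consider "f = 0" | "f = g" | "f = f3" using f g(4) by blast
      then show ?thesis
      proof cases
        case 1
        then show ?thesis using to_fract_localization[OF P(1), of 0] by simp
      next
        case 2
        then show ?thesis using to_fract_localization[OF P(1), of 1] z1 by simp
      next
        case 3
        have "to_fract c * to_fract f3 = to_fract r * to_fract g"
          using arg_cong[OF g(3), of to_fract] by simp
        then have "to_fract f3 = to_fract r * to_fract g / to_fract c" using c0 by (simp add: field_simps)
        then have "z * to_fract f3 = to_fract r / to_fract c" using g(1) by (simp add: z_def)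
        then show ?thesis using 3 localizationI[OF P(1) red(1)] by blast
      qed
    qed
    have "z \<in> localization P"
      by (rule localization_normal[OF P(1) prime_product_bipoly _ no_common_prime zf]) simp_all
    then obtain a b where ab: "b \<notin> P" "b \<noteq> 0" "z = to_fract a / to_fract b"
      by (elim localizationE[OF P(1)]) (rule that)
    then have "to_fract b = to_fract (a * g)" using g(1) by (simp add: z_def field_simps)
    then have "b = a * g" by (simp only: to_fract_eq_iff)
    then show False using ab(1) ideal_mult_left[OF prime_idealD(1)[OF P(1)] g(2)] by simp
  qed
  note * = this
  have fP: "f1 \<in> P" "f2 \<in> P" using P(2) f_in_I by auto
  show "f1 \<noteq> 0"
  proof
    assume f10: "f1 = 0"
    have "f2 \<noteq> 0" using f10 red(2) c0 not_all_zero by auto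
    then show False using *[of f2 q] fP(2) red(2) f10 by simp
  qed
  show "f2 \<noteq> 0"
  proof
    assume f20: "f2 = 0"
    have "f1 \<noteq> 0" using f20 red(2) c0 not_all_zero by auto
    then show False using *[of f1 p] fP(1) red(2) f20 by simp
  qed
qed

text \<open>Division by monomials that do not vanish at \<open>P\<close> turns \<open>f1, f2\<close> into elements \<open>g1, g2\<close> of the stalk, which
  generate. If \<open>a * g2 = b * g1\<close>, then \<open>r = a / g1\<close> multiplies all generators into the local ring, so \<open>r\<close>
  itself is regular at \<open>P\<close>.\<close>

lemma complete_intersection_of_redundant:
  assumes P: "P \<in> base_points I" and red: "c \<notin> P" "c * f3 = p * f1 + q * f2"
  shows "\<exists>xs. regular_sequence (structure_stalk P) xs \<and>
    ideal_sheaf_stalk I P = generated_ideal (structure_stalk P) xs"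
proof -
  have Pp: "P \<in> points" and IP: "I \<subseteq> P" using P by (auto simp: base_points_def)
  note prime = pointD(1)[OF Pp]
  note sub = prime_idealD(1)[OF prime]
  note f0 = generator_nonzero[OF prime IP red]
  have fP: "f1 \<in> P" "f2 \<in> P" using IP f_in_I by auto
  obtain x z y w where xz: "(x, z) \<in> {(Var_s, Var_u), (Var_u, Var_s)}" "var x \<notin> P"
    and yw: "(y, w) \<in> {(Var_t, Var_v), (Var_v, Var_t)}" "var y \<notin> P"
    by (rule pointE[OF Pp])
  have dpos: "d1 \<ge> 0" "d1' \<ge> 0" "d2 \<ge> 0" "d2' \<ge> 0"
    using bihom_negative[OF f1] bihom_negative[OF f2] f0 by (auto simp: not_less[symmetric])
  define m1 where "m1 = (unit_monomial x y d1 d1' :: 'k bipoly)"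
  define m2 where "m2 = (unit_monomial x y d2 d2' :: 'k bipoly)"
  have m1: "m1 \<in> bihom d1 d1'" "m1 \<notin> P" and m2: "m2 \<in> bihom d2 d2'" "m2 \<notin> P"
    unfolding m1_def m2_def using unit_monomial_bihom[OF xz(1) yw(1)] unit_monomial_not_mem[OF prime xz(2) yw(2)] dpos
    by auto
  have m0: "m1 \<noteq> 0" "m2 \<noteq> 0" using not_mem_nonzero[OF prime] m1 m2 by auto
  define A where "A = structure_stalk P"
  interpret subring_carrier A unfolding A_def by (rule subring_stalk[OF prime])
  define g1 where "g1 = to_fract f1 / to_fract m1"
  define g2 where "g2 = to_fract f2 / to_fract m2"
  have gA: "g1 \<in> A" "g2 \<in> A"
    unfolding A_def g1_def g2_def using stalkI[OF UNIV_I f1 m1 refl] stalkI[OF UNIV_I f2 m2 refl] by blast+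
  have g0: "g1 \<noteq> 0" "g2 \<noteq> 0" using f0 m0 by (simp_all add: g1_def g2_def)
  \<comment> \<open>Some homogeneous component of \<open>c\<close> is outside of \<open>P\<close>, and the relation can be cut down to its degree.\<close>
  obtain c' p' q' e e' where c': "c' \<in> bihom e e'" "c' \<notin> P" "c' * f3 = p' * f1 + q' * f2"
    and p': "p' \<in> bihom (e + d3 - d1) (e' + d3' - d1')" and q': "q' \<in> bihom (e + d3 - d2) (e' + d3' - d2')"
  proof -
    obtain d where d: "component d c \<notin> P" using homogeneous_not_mem[OF sub red(1)] by blast
    obtain e e' where ee: "d = (e, e')" by (cases d)
    have cm: "component (k, k') (r * f) = component (k - l, k' - l') r * f" if "f \<in> bihom l l'" for k k' r f l l'
      using component_mult_bihom[OF that, of k k' r] by (simp add: mult.commute)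
    have "component (e, e') c * f3 = component (e + d3, e' + d3') (c * f3)" by (simp add: cm[OF f3])
    also have "\<dots> = component (e + d3 - d1, e' + d3' - d1') p * f1 + component (e + d3 - d2, e' + d3' - d2') q * f2"
      unfolding red(2) component_add cm[OF f1] cm[OF f2] ..
    finally have rel: "component (e, e') c * f3
      = component (e + d3 - d1, e' + d3' - d1') p * f1 + component (e + d3 - d2, e' + d3' - d2') q * f2" .
    have "component (e, e') c \<notin> P" using d ee by simp
    then show thesis by (rule that[OF component_in_bihom _ rel component_in_bihom component_in_bihom])
  qed
  have c0: "c' \<noteq> 0" by (rule not_mem_nonzero[OF prime c'(2)])
  have reg2: "\<exists>b\<in>A. a = b * g1" if a: "a \<in> A" "a * g2 = b * g1" "b \<in> A" for a b
  proof -
    define r where "r = a / g1"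
    have ra: "a = r * g1" using g0 by (simp add: r_def)
    have "b = r * g2" using a(2) g0 by (simp add: r_def field_simps)
    interpret L: subring_carrier "localization P" by (rule subring_localization[OF prime])
    have AL: "A \<subseteq> localization P" unfolding A_def by (rule stalk_subset_localization)
    note tf = to_fract_localization[OF prime]
    have r1: "r * to_fract f1 \<in> localization P"
    proof -
      have "r * to_fract f1 = a * to_fract m1" using m0 by (simp add: ra g1_def)
      then show ?thesis using a(1) AL tf by auto
    qed
    have r2: "r * to_fract f2 \<in> localization P"
    proof -
      have "r * to_fract f2 = b * to_fract m2" using m0 by (simp add: \<open>b = r * g2\<close> g2_def)
      then show ?thesis using a(3) AL tf by auto
    qed
    have r3: "r * to_fract f3 \<in> localization P"
    proof -
      have "to_fract c' * to_fract f3 = to_fract p' * to_fract f1 + to_fract q' * to_fract f2"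
        using arg_cong[OF c'(3), of to_fract] by simp
      then have "to_fract f3 = (to_fract p' * to_fract f1 + to_fract q' * to_fract f2) / to_fract c'"
        using c0 by (simp add: field_simps)
      then have "r * to_fract f3 = (to_fract p' / to_fract c') * (r * to_fract f1) + (to_fract q' / to_fract c') * (r * to_fract f2)"
        by (simp add: add_divide_distrib distrib_left mult_ac)
      also have "\<dots> \<in> localization P"
        by (intro L.add_closed L.mult_closed r1 r2 localizationI[OF prime c'(2) refl])
      finally show ?thesis .
    qed
    have "r \<in> localization P"
      by (rule localization_normal[OF prime prime_product_bipoly _ no_common_prime]) (use r1 r2 r3 in auto)
    then obtain n m where nm: "m \<notin> P" "m \<noteq> 0" "r = to_fract n / to_fract m"
      by (elim localizationE[OF prime]) (rule that)
    obtain a0 b0 k k' where ab: "a0 \<in> bihom k k'" "b0 \<in> bihom k k'" "b0 \<notin> P" "a = to_fract a0 / to_fract b0"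
      using a(1) unfolding A_def by (elim stalkE) (rule that)
    have b00: "b0 \<noteq> 0" by (rule not_mem_nonzero[OF prime ab(3)])
    \<comment> \<open>\<open>r\<close> has degree zero, so numerator and denominator can be replaced by components.\<close>
    obtain d where d: "component d m \<notin> P" using homogeneous_not_mem[OF sub nm(1)] by blast
    obtain l l' where ll: "d = (l, l')" by (cases d)
    have "to_fract ((f1 * b0) * n) = to_fract ((a0 * m1) * m)"
    proof -
      have "to_fract n / to_fract m * (to_fract f1 / to_fract m1) = to_fract a0 / to_fract b0"
        using ra unfolding g1_def nm(3) ab(4) by simp
      then show ?thesis using nm(2) m0(1) b00 by (simp add: field_simps)
    qed
    then have eq: "(f1 * b0) * n = (a0 * m1) * m" by (simp only: to_fract_eq_iff)
    have h1: "f1 * b0 \<in> bihom (d1 + k) (d1' + k')" by (rule bihom_mult[OF f1 ab(2)])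
    have h2: "a0 * m1 \<in> bihom (k + d1) (k' + d1')" by (rule bihom_mult[OF ab(1) m1(1)])
    have "(f1 * b0) * component (l, l') n = component (k + d1 + l, k' + d1' + l') ((f1 * b0) * n)"
      using component_mult_bihom[OF h1, of "k + d1 + l" "k' + d1' + l'" n] by simp
    also have "\<dots> = (a0 * m1) * component (l, l') m"
      unfolding eq using component_mult_bihom[OF h2, of "k + d1 + l" "k' + d1' + l'" m] by simp
    finally have eq': "(f1 * b0) * component (l, l') n = (a0 * m1) * component (l, l') m" .
    define n' m' where "n' = component (l, l') n" and "m' = component (l, l') m"
    have m'P: "m' \<notin> P" using d ll by (simp add: m'_def)
    have m'0: "m' \<noteq> 0" by (rule not_mem_nonzero[OF prime m'P])
    have rA: "to_fract n' / to_fract m' \<in> A"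
      unfolding A_def by (rule stalkI[OF UNIV_I _ _ m'P refl, of _ l l']) (simp_all add: n'_def m'_def)
    have "to_fract f1 * to_fract b0 * to_fract n' = to_fract a0 * to_fract m1 * to_fract m'"
      using arg_cong[OF eq', of to_fract] by (simp add: n'_def m'_def)
    then have "a = to_fract n' / to_fract m' * g1"
      unfolding ab(4) g1_def using b00 m'0 m0(1) by (simp add: field_simps)
    then show ?thesis using rA by blast
  qed
  have notA: "generated_ideal A [g1, g2] \<noteq> A"
  proof
    assume "generated_ideal A [g1, g2] = A"
    then have "1 \<in> generated_ideal A [g1, g2]" by simp
    then obtain u v where uv: "u \<in> A" "v \<in> A" "1 = u * g1 + v * g2" unfolding generated_ideal_pair by blast
    obtain a1 b1 where 1: "b1 \<notin> P" "u = to_fract a1 / to_fract b1"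
      using uv(1) unfolding A_def by (elim stalkE) (rule that)
    obtain a2 b2 where 2: "b2 \<notin> P" "v = to_fract a2 / to_fract b2"
      using uv(2) unfolding A_def by (elim stalkE) (rule that)
    have b: "b1 \<noteq> 0" "b2 \<noteq> 0" using not_mem_nonzero[OF prime] 1 2 by auto
    have "to_fract (b1 * m1 * (b2 * m2)) = to_fract (a1 * b2 * m2 * f1 + a2 * b1 * m1 * f2)"
      using uv(3) b m0 unfolding 1(2) 2(2) g1_def g2_def by (simp add: field_simps)
    then have "b1 * m1 * (b2 * m2) = a1 * b2 * m2 * f1 + a2 * b1 * m1 * f2" by (simp only: to_fract_eq_iff)
    moreover have "a1 * b2 * m2 * f1 + a2 * b1 * m1 * f2 \<in> P"
      by (intro ideal.subspace_add[OF sub] ideal_mult_left[OF sub fP(1)] ideal_mult_left[OF sub fP(2)])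
    moreover have "b1 * m1 * (b2 * m2) \<notin> P"
      by (intro prime_ideal_not_mem_mult[OF prime] 1 2 m1 m2)
    ultimately show False by simp
  qed
  have "regular_sequence A [g1, g2]"
    unfolding regular_sequence_def
  proof (intro conjI allI impI ballI)
    show "set [g1, g2] \<subseteq> A" using gA by simp
    fix i a assume i: "i < length [g1, g2]" and a: "a \<in> A"
      and mem: "a * [g1, g2] ! i \<in> generated_ideal A (take i [g1, g2])"
    consider "i = 0" | "i = 1" using i by fastforce
    then show "a \<in> generated_ideal A (take i [g1, g2])"
    proof cases
      case 1
      then show ?thesis using mem g0 by (simp add: generated_ideal_Nil)
    next
      case 2
      then have "a * g2 \<in> generated_ideal A [g1]" using mem by simp
      then obtain b where b: "b \<in> A" "a * g2 = b * g1" unfolding generated_ideal_single by blast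
      have "a \<in> generated_ideal A [g1]" unfolding generated_ideal_single by (rule reg2[OF a b(2,1)])
      then show ?thesis using 2 by simp
    qed
  qed (rule notA)
  moreover have "ideal_sheaf_stalk I P = generated_ideal A [g1, g2]"
  proof
    show "ideal_sheaf_stalk I P \<subseteq> generated_ideal A [g1, g2]"
    proof
      fix t assume "t \<in> ideal_sheaf_stalk I P"
      then obtain a b k k' where ab: "a \<in> I" "a \<in> bihom k k'" "b \<in> bihom k k'" "b \<notin> P" "t = to_fract a / to_fract b"
        by (elim stalkE) (rule that)
      have b0: "b \<noteq> 0" by (rule not_mem_nonzero[OF prime ab(4)])
      obtain r1 r2 r3 where r: "a = r1 * f1 + r2 * f2 + r3 * f3" "r1 \<in> bihom (k - d1) (k' - d1')"
        "r2 \<in> bihom (k - d2) (k' - d2')" "r3 \<in> bihom (k - d3) (k' - d3')"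
        by (rule I_homogeneous_coefficients[OF ab(1,2)])
      have "c' * a = c' * r1 * f1 + c' * r2 * f2 + r3 * (c' * f3)" unfolding r(1) by (simp add: algebra_simps)
      then have ca: "c' * a = (c' * r1 + r3 * p') * f1 + (c' * r2 + r3 * q') * f2"
        unfolding c'(3) by (simp add: algebra_simps)
      have deg: "c' * b \<in> bihom (e + k) (e' + k')" "c' * b \<notin> P"
        using bihom_mult[OF c'(1) ab(3)] prime_ideal_not_mem_mult[OF prime c'(2) ab(4)] by auto
      have "(c' * r1 + r3 * p') * m1 \<in> bihom (e + k) (e' + k')"
      proof -
        have "c' * r1 \<in> bihom (e + k - d1) (e' + k' - d1')"
          using bihom_mult[OF c'(1) r(2)] by (simp add: algebra_simps)
        moreover have "r3 * p' \<in> bihom (e + k - d1) (e' + k' - d1')"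
          using bihom_mult[OF r(4) p'] by (simp add: algebra_simps)
        ultimately show ?thesis using bihom_mult[OF bihom_add m1(1), of "c' * r1" _ _ "r3 * p'"] by fastforce
      qed
      then have A1: "to_fract ((c' * r1 + r3 * p') * m1) / to_fract (c' * b) \<in> A"
        unfolding A_def by (rule stalkI[OF UNIV_I _ deg refl])
      have "(c' * r2 + r3 * q') * m2 \<in> bihom (e + k) (e' + k')"
      proof -
        have "c' * r2 \<in> bihom (e + k - d2) (e' + k' - d2')"
          using bihom_mult[OF c'(1) r(3)] by (simp add: algebra_simps)
        moreover have "r3 * q' \<in> bihom (e + k - d2) (e' + k' - d2')"
          using bihom_mult[OF r(4) q'] by (simp add: algebra_simps)
        ultimately show ?thesis using bihom_mult[OF bihom_add m2(1), of "c' * r2" _ _ "r3 * q'"] by fastforce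
      qed
      then have A2: "to_fract ((c' * r2 + r3 * q') * m2) / to_fract (c' * b) \<in> A"
        unfolding A_def by (rule stalkI[OF UNIV_I _ deg refl])
      have "t = to_fract (c' * a) / to_fract (c' * b)" unfolding ab(5) using c0 by simp
      also have "\<dots> = to_fract ((c' * r1 + r3 * p') * m1) / to_fract (c' * b) * g1
          + to_fract ((c' * r2 + r3 * q') * m2) / to_fract (c' * b) * g2"
        unfolding ca g1_def g2_def to_fract_mult[of _ m1] to_fract_mult[of _ m2] to_fract_add to_fract_mult[of _ f1] to_fract_mult[of _ f2]
        using m0 by (simp add: add_divide_distrib)
      finally show "t \<in> generated_ideal A [g1, g2]" unfolding generated_ideal_pair using A1 A2 by blast
    qed
    show "generated_ideal A [g1, g2] \<subseteq> ideal_sheaf_stalk I P"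
    proof
      fix t assume "t \<in> generated_ideal A [g1, g2]"
      then obtain u v where uv: "u \<in> A" "v \<in> A" "t = u * g1 + v * g2" unfolding generated_ideal_pair by blast
      obtain a1 b1 k k' where 1: "a1 \<in> bihom k k'" "b1 \<in> bihom k k'" "b1 \<notin> P" "u = to_fract a1 / to_fract b1"
        using uv(1) unfolding A_def by (elim stalkE) (rule that)
      obtain a2 b2 l l' where 2: "a2 \<in> bihom l l'" "b2 \<in> bihom l l'" "b2 \<notin> P" "v = to_fract a2 / to_fract b2"
        using uv(2) unfolding A_def by (elim stalkE) (rule that)
      have b: "b1 \<noteq> 0" "b2 \<noteq> 0" using not_mem_nonzero[OF prime] 1 2 by auto
      have "t = to_fract ((a1 * (b2 * m2)) * f1 + (a2 * (b1 * m1)) * f2) / to_fract ((b1 * m1) * (b2 * m2))"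
        using b m0 unfolding uv(3) 1(4) 2(4) g1_def g2_def by (simp add: field_simps)
      moreover have "(a1 * (b2 * m2)) * f1 + (a2 * (b1 * m1)) * f2 \<in> I"
        by (intro ideal.span_add ideal.span_scale f_in_I)
      moreover have "(a1 * (b2 * m2)) * f1 + (a2 * (b1 * m1)) * f2 \<in> bihom (k + d1 + (l + d2)) (k' + d1' + (l' + d2'))"
      proof (rule bihom_add)
        show "(a1 * (b2 * m2)) * f1 \<in> bihom (k + d1 + (l + d2)) (k' + d1' + (l' + d2'))"
          using bihom_mult[OF bihom_mult[OF 1(1) bihom_mult[OF 2(2) m2(1)]] f1] by (simp add: ac_simps)
        show "(a2 * (b1 * m1)) * f2 \<in> bihom (k + d1 + (l + d2)) (k' + d1' + (l' + d2'))"
          using bihom_mult[OF bihom_mult[OF 2(1) bihom_mult[OF 1(2) m1(1)]] f2] by (simp add: ac_simps)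
      qed
      moreover have "(b1 * m1) * (b2 * m2) \<in> bihom (k + d1 + (l + d2)) (k' + d1' + (l' + d2'))"
        by (intro bihom_mult 1 2 m1 m2)
      moreover have "(b1 * m1) * (b2 * m2) \<notin> P"
        by (intro prime_ideal_not_mem_mult[OF prime] 1 2 m1 m2)
      ultimately show "t \<in> ideal_sheaf_stalk I P" by (intro stalkI)
    qed
  qed
  ultimately show ?thesis unfolding A_def by blast
qed

lemma permute_23: "bihom_triple f1 f3 f2 d1 d3 d2 d1' d3' d2'"
  by unfold_locales (use f1 f2 f3 no_common_prime not_all_zero in \<open>auto simp: insert_commute\<close>)

lemma permute_rotate: "bihom_triple f2 f3 f1 d2 d3 d1 d2' d3' d1'"
  by unfold_locales (use f1 f2 f3 no_common_prime not_all_zero in \<open>auto simp: insert_commute\<close>)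

lemma agree_imp_complete_intersection:
  assumes syzygies_agree
  shows "local_complete_intersection I"
  unfolding local_complete_intersection_def
proof
  fix P assume P: "P \<in> base_points I"
  interpret t23: bihom_triple f1 f3 f2 d1 d3 d2 d1' d3' d2' by (rule permute_23)
  interpret rot: bihom_triple f2 f3 f1 d2 d3 d1 d2' d3' d1' by (rule permute_rotate)
  have I23: "ideal.span {f1, f3, f2} = I" and Irot: "ideal.span {f2, f3, f1} = I" by (simp_all add: insert_commute)
  obtain c p q where c: "c \<notin> P" and "c * f3 = p * f1 + q * f2 \<or> c * f2 = p * f1 + q * f3 \<or> c * f1 = p * f2 + q * f3"
    using redundant_generator_at_point[OF assms P] by blast
  then consider "c * f3 = p * f1 + q * f2" | "c * f2 = p * f1 + q * f3" | "c * f1 = p * f2 + q * f3" by blast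
  then show "\<exists>xs. regular_sequence (structure_stalk P) xs \<and>
    ideal_sheaf_stalk I P = generated_ideal (structure_stalk P) xs"
  proof cases
    case 1
    then show ?thesis by (rule complete_intersection_of_redundant[OF P c])
  next
    case 2
    then show ?thesis using t23.complete_intersection_of_redundant[unfolded I23, OF P c] by blast
  next
    case 3
    then show ?thesis using rot.complete_intersection_of_redundant[unfolded Irot, OF P c] by blast
  qed
qed

end


section \<open>From complete intersections to equality of syzygies\<close>

lemma var_product_irrelevant:
  assumes "x \<in> {Var_s, Var_u}" "y \<in> {Var_t, Var_v}"
  shows "var x * var y \<in> irrelevant_ideal"
  unfolding irrelevant_ideal_def by (rule ideal.span_base) (use assms in auto)

lemma ideal_power_power: "a \<in> J \<Longrightarrow> a ^ j \<in> ideal_power J j"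
proof (induction j)
  case (Suc j)
  then show ?case by (auto intro!: ideal.span_base)
qed simp

context bihom_triple
begin

lemma saturationD:
  assumes "r \<in> saturation I" "x \<in> {Var_s, Var_u}" "y \<in> {Var_t, Var_v}"
  shows "\<exists>j. (var x * var y) ^ j * r \<in> I"
  using assms(1) ideal_power_power[OF var_product_irrelevant[OF assms(2,3)]] unfolding saturation_def by blast

text \<open>The stalk of the ideal is generated by a regular sequence and also by the fractions \<open>\<phi> i\<close> that are
  obtained from the \<open>f\<close>. The syzygy becomes a relation \<open>\<alpha>\<close> between the \<open>\<phi> i\<close> with coefficients in the stalk,
  which is therefore given by an alternating matrix.\<close>

lemma locally_koszul:
  assumes lci: "local_complete_intersection I" and P: "P \<in> base_points I"
    and tw: "twisted v1 v2 v3 k k'" and syz: "v1 * f1 + v2 * f2 + v3 * f3 = 0"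
    and sat: "v1 \<in> saturation I" "v2 \<in> saturation I" "v3 \<in> saturation I"
  shows "\<exists>b. b \<notin> P \<and> koszul (b * v1) (b * v2) (b * v3)"
proof -
  have Pp: "P \<in> points" using P by (auto simp: base_points_def)
  note prime = pointD(1)[OF Pp]
  obtain x z y w where xz: "(x, z) \<in> {(Var_s, Var_u), (Var_u, Var_s)}" "var x \<notin> P"
    and yw: "(y, w) \<in> {(Var_t, Var_v), (Var_v, Var_t)}" "var y \<notin> P"
    by (rule pointE[OF Pp])
  have x: "x \<in> {Var_s, Var_u}" and y: "y \<in> {Var_t, Var_v}" using xz(1) yw(1) by auto
  define m where "m = var x * (var y :: 'k bipoly)"
  have m: "m \<in> bihom 1 1" using bihom_mult[OF var_bihom_cases(1)[OF xz(1)] var_bihom_cases(2)[OF yw(1)]] by (simp add: m_def)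
  have mP: "m \<notin> P" unfolding m_def by (rule prime_ideal_not_mem_mult[OF prime xz(2) yw(2)])
  define F where "F i = [f1, f2, f3] ! i" for i
  define V where "V i = [v1, v2, v3] ! i" for i
  define e where "e i = [d1, d2, d3] ! i" for i
  define e' where "e' i = [d1', d2', d3'] ! i" for i
  have three: "i = 0 \<or> i = 1 \<or> i = 2" if "i < 3" for i :: nat using that by linarith
  have F: "F i \<in> bihom (e i) (e' i)" if "i < 3" for i
    using three[OF that] by (elim disjE) (simp_all add: F_def e_def e'_def f1 f2 f3)
  have FI: "F i \<in> I" if "i < 3" for i
    using three[OF that] by (elim disjE) (simp_all add: F_def f_in_I)
  have V: "V i \<in> bihom (k - e i) (k' - e' i)" if "i < 3" for i
    using three[OF that] by (elim disjE) (use tw in \<open>simp_all add: V_def e_def e'_def twisted_def\<close>)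
  have Vsat: "V i \<in> saturation I" if "i < 3" for i
    using three[OF that] by (elim disjE) (simp_all add: V_def sat)
  \<comment> \<open>\<open>D\<close> bounds all degrees of the \<open>f\<close>, and \<open>(l, l')\<close> is a bidegree from which these degrees can be
    subtracted, so that all monomials below have nonnegative exponents. The \<open>f\<close> are brought to the common
    bidegree \<open>(D, D)\<close> first, because a vanishing \<open>f\<close> may come with a negative degree.\<close>
  define D where "D = \<bar>d1\<bar> + \<bar>d2\<bar> + \<bar>d3\<bar> + \<bar>d1'\<bar> + \<bar>d2'\<bar> + \<bar>d3'\<bar>"
  define N where "N = nat (\<bar>k\<bar> + \<bar>k'\<bar> + D)"
  define l l' where "l = k + int N" and "l' = k' + int N"
  have D: "D \<ge> 0" "D - e i \<ge> 0" "D - e' i \<ge> 0" if "i < 3" for i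
    using three[OF that] by (auto simp: D_def e_def e'_def)
  have N: "int N = \<bar>k\<bar> + \<bar>k'\<bar> + D" by (simp add: N_def D_def)
  have l: "l \<ge> 0" "l' \<ge> 0" "l - e i \<ge> 0" "l' - e' i \<ge> 0" if "i < 3" for i
    using D[OF that] N by (auto simp: l_def l'_def)
  define X Z where "X = (unit_monomial x y D D :: 'k bipoly)" and "Z = (unit_monomial x y l l' :: 'k bipoly)"
  define U where "U i = (unit_monomial x y (D - e i) (D - e' i) :: 'k bipoly)" for i
  define Y where "Y i = (unit_monomial x y (l - e i) (l' - e' i) :: 'k bipoly)" for i
  note um = unit_monomial_bihom[OF xz(1) yw(1)] and umP = unit_monomial_not_mem[OF prime xz(2) yw(2)]
  have XP: "X \<notin> P" and UP: "U i \<notin> P" and YP: "Y i \<notin> P" for i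
    by (simp_all add: X_def U_def Y_def umP)
  have X0: "X \<noteq> 0" and U0: "U i \<noteq> 0" and Y0: "Y i \<noteq> 0" and Z0: "Z \<noteq> 0" for i
    by (simp_all add: X_def U_def Y_def Z_def unit_monomial_nonzero)
  have Xd: "X \<in> bihom D D" unfolding X_def by (rule um) (use D(1)[of 0] in auto)
  have Ud: "U i \<in> bihom (D - e i) (D - e' i)" if "i < 3" for i unfolding U_def by (rule um) (use D[OF that] in auto)
  have Yd: "Y i \<in> bihom (l - e i) (l' - e' i)" if "i < 3" for i unfolding Y_def by (rule um) (use l[OF that] in auto)
  have UZ: "U i * Z = X * Y i" if "i < 3" for i
  proof -
    have "U i * Z = unit_monomial x y (D - e i + l) (D - e' i + l')"
      unfolding U_def Z_def using D[OF that] l[OF that] by (subst unit_monomial_add) auto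
    also have "\<dots> = unit_monomial x y (D + (l - e i)) (D + (l' - e' i))" by (simp add: algebra_simps)
    also have "unit_monomial x y (D + (l - e i)) (D + (l' - e' i)) = X * Y i"
      unfolding X_def Y_def using D[OF that] l[OF that] by (subst unit_monomial_add) auto
    finally show ?thesis .
  qed
  define V' where "V' i = m ^ N * V i" for i
  have V'd: "V' i \<in> bihom (l - e i) (l' - e' i)" if "i < 3" for i
    using bihom_mult[OF bihom_power[OF m, of N] V[OF that]] by (simp add: V'_def l_def l'_def algebra_simps)
  define A where "A = structure_stalk P"
  interpret subring_carrier A unfolding A_def by (rule subring_stalk[OF prime])
  define \<phi> where "\<phi> i = to_fract (F i * U i) / to_fract X" for i
  define \<alpha> where "\<alpha> i = to_fract (V' i) / to_fract (Y i)" for i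
  have FU: "F i * U i \<in> bihom D D" if "i < 3" for i
    using bihom_mult[OF F[OF that] Ud[OF that]] by simp
  have \<phi>_stalk: "\<phi> i \<in> ideal_sheaf_stalk I P" if "i < 3" for i
    unfolding \<phi>_def
    by (rule stalkI[OF ideal_mult_right[OF ideal.subspace_span FI[OF that]] FU[OF that] Xd XP refl])
  have \<alpha>_stalk: "\<alpha> i \<in> ideal_sheaf_stalk I P" if i3: "i < 3" for i
  proof -
    obtain j where j: "m ^ j * V i \<in> I" using saturationD[OF Vsat[OF i3] x y] unfolding m_def by blast
    have mj: "m ^ j \<in> bihom (int j) (int j)" using bihom_power[OF m, of j] by simp
    have mjP: "m ^ j \<notin> P" by (rule prime_ideal_not_mem_power[OF prime mP])
    have mj0: "to_fract (m ^ j) \<noteq> 0" using not_mem_nonzero[OF prime mjP] by (simp only: to_fract_eq_0_iff not_False_eq_True)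
    have "m ^ j * V' i = m ^ N * (m ^ j * V i)" by (simp add: V'_def mult.left_commute)
    then have 1: "m ^ j * V' i \<in> I" using ideal_mult_left[OF ideal.subspace_span j] by metis
    have 2: "m ^ j * V' i \<in> bihom (int j + (l - e i)) (int j + (l' - e' i))" by (rule bihom_mult[OF mj V'd[OF i3]])
    have 3: "m ^ j * Y i \<in> bihom (int j + (l - e i)) (int j + (l' - e' i))" by (rule bihom_mult[OF mj Yd[OF i3]])
    have "\<alpha> i = to_fract (m ^ j * V' i) / to_fract (m ^ j * Y i)"
      unfolding \<alpha>_def to_fract_mult by (rule mult_divide_mult_cancel_left[OF mj0, symmetric])
    then show ?thesis by (rule stalkI[OF 1 2 3 prime_ideal_not_mem_mult[OF prime mjP YP]])
  qed
  have stalk_A: "ideal_sheaf_stalk I P \<subseteq> A" 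
    unfolding A_def ideal_sheaf_stalk_def by blast
  have sum3: "(\<Sum>i<3. h i) = h 0 + h 1 + h 2" for h :: "nat \<Rightarrow> 'b::comm_monoid_add"
    by (simp add: numeral_3_eq_3 numeral_2_eq_2)
  have syz': "(\<Sum>i<3. \<alpha> i * \<phi> i) = 0"
  proof -
    have "\<alpha> i * \<phi> i = to_fract (V' i * F i) / to_fract Z" if "i < 3" for i
    proof -
      have "to_fract (U i) * to_fract Z = to_fract X * to_fract (Y i)"
        using arg_cong[OF UZ[OF that], of to_fract] by simp
      then have "to_fract (U i) / (to_fract X * to_fract (Y i)) = 1 / to_fract Z"
        using X0 Y0[of i] Z0 by (simp add: field_simps)
      moreover have "\<alpha> i * \<phi> i = to_fract (V' i * F i) * (to_fract (U i) / (to_fract X * to_fract (Y i)))"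
        by (simp add: \<alpha>_def \<phi>_def mult_ac)
      ultimately show ?thesis by simp
    qed
    then have "(\<Sum>i<3. \<alpha> i * \<phi> i) = to_fract (V' 0 * F 0 + V' 1 * F 1 + V' 2 * F 2) / to_fract Z"
      by (simp add: sum3 add_divide_distrib)
    also have "V' 0 * F 0 + V' 1 * F 1 + V' 2 * F 2 = m ^ N * (v1 * f1 + v2 * f2 + v3 * f3)"
      by (simp add: V'_def V_def F_def algebra_simps)
    finally show ?thesis unfolding syz by simp
  qed
  have expand: "\<exists>c. (\<forall>i<3. c i \<in> A) \<and> t = (\<Sum>i<3. c i * \<phi> i)" if t: "t \<in> ideal_sheaf_stalk I P" for t
  proof -
    obtain a b g g' where ab: "a \<in> I" "a \<in> bihom g g'" "b \<in> bihom g g'" "b \<notin> P" "t = to_fract a / to_fract b"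
      using t by (elim stalkE) (rule that)
    obtain r1 r2 r3 where r: "a = r1 * f1 + r2 * f2 + r3 * f3" "r1 \<in> bihom (g - d1) (g' - d1')"
        "r2 \<in> bihom (g - d2) (g' - d2')" "r3 \<in> bihom (g - d3) (g' - d3')"
      by (rule I_homogeneous_coefficients[OF ab(1,2)])
    define R where "R i = [r1, r2, r3] ! i" for i
    have R: "R i \<in> bihom (g - e i) (g' - e' i)" if "i < 3" for i
      using three[OF that] by (elim disjE) (simp_all add: R_def e_def e'_def r)
    define c where "c i = to_fract (R i * X) / to_fract (b * U i)" for i
    have "c i \<in> A" if "i < 3" for i
      unfolding A_def c_def
    proof (rule stalkI[OF UNIV_I _ _ prime_ideal_not_mem_mult[OF prime ab(4) UP] refl])
      show "R i * X \<in> bihom (g - e i + D) (g' - e' i + D)" by (rule bihom_mult[OF R[OF that] Xd])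
      show "b * U i \<in> bihom (g - e i + D) (g' - e' i + D)"
        using bihom_mult[OF ab(3) Ud[OF that]] by (simp add: algebra_simps)
    qed
    moreover have "c i * \<phi> i = to_fract (R i * F i) / to_fract b" for i
      using X0 U0[of i] by (simp add: c_def \<phi>_def)
    then have "(\<Sum>i<3. c i * \<phi> i) = to_fract (R 0 * F 0 + R 1 * F 1 + R 2 * F 2) / to_fract b"
      by (simp add: sum3 add_divide_distrib)
    then have "t = (\<Sum>i<3. c i * \<phi> i)" unfolding ab(5) r(1) by (simp add: R_def F_def)
    ultimately show ?thesis by blast
  qed
  obtain xs where xs: "regular_sequence A xs" "ideal_sheaf_stalk I P = generated_ideal A xs"
    using lci P unfolding local_complete_intersection_def A_def by blast
  have "\<exists>c. (\<forall>l<length xs. c l \<in> A) \<and> \<phi> i = (\<Sum>l<length xs. c l * xs ! l)" if "i < 3" for i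
    using \<phi>_stalk[OF that] unfolding xs(2) generated_ideal_def by blast
  then obtain M where M: "\<And>i l. i < 3 \<Longrightarrow> l < length xs \<Longrightarrow> M i l \<in> A"
    "\<And>i. i < 3 \<Longrightarrow> \<phi> i = (\<Sum>l<length xs. M i l * xs ! l)" by metis
  have "\<exists>c. (\<forall>i<3. c i \<in> A) \<and> xs ! l = (\<Sum>i<3. c i * \<phi> i)" if "l < length xs" for l
  proof (rule expand)
    have "xs ! l = (\<Sum>i<length xs. (if i = l then 1 else 0) * xs ! i)" using that by (simp add: if_distrib[of "\<lambda>c. c * _"] cong: if_cong)
    then show "xs ! l \<in> ideal_sheaf_stalk I P" unfolding xs(2) generated_ideal_def
      by (intro CollectI exI[of _ "\<lambda>i. if i = l then 1 else 0"]) auto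
  qed
  then obtain L where L: "\<And>l i. l < length xs \<Longrightarrow> i < 3 \<Longrightarrow> L l i \<in> A"
    "\<And>l. l < length xs \<Longrightarrow> xs ! l = (\<Sum>i<3. L l i * \<phi> i)" by metis
  have "\<exists>c. (\<forall>j<3. c j \<in> A) \<and> \<alpha> i = (\<Sum>j<3. c j * \<phi> j)" if "i < 3" for i
    by (rule expand[OF \<alpha>_stalk[OF that]])
  then obtain B where B: "\<And>i j. i < 3 \<Longrightarrow> j < 3 \<Longrightarrow> B i j \<in> A"
    "\<And>i. i < 3 \<Longrightarrow> \<alpha> i = (\<Sum>j<3. B i j * \<phi> j)" by metis
  have \<alpha>A: "\<alpha> i \<in> A" if "i < 3" for i using \<alpha>_stalk[OF that] stalk_A by blast
  obtain w where wA: "\<And>i j. i < 3 \<Longrightarrow> j < 3 \<Longrightarrow> w i j \<in> A" and w: "alternating w"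
    "\<And>i. i < 3 \<Longrightarrow> \<alpha> i = (\<Sum>j<3. w i j * \<phi> j)"
    using syzygies_with_coefficients_in_ideal[OF xs(1), where m = 3 and M = M and N = L and b = B and a = \<alpha> and f = \<phi>,
        OF M L B \<alpha>A syz'] by blast
  have "{w 0 1, w 0 2, w 1 2} \<subseteq> localization P"
    using wA stalk_subset_localization unfolding A_def by fastforce
  then obtain b where b: "b \<notin> P" "\<And>t. t \<in> {w 0 1, w 0 2, w 1 2} \<Longrightarrow> \<exists>a. t = to_fract a / to_fract b"
    using common_denominator[OF prime, of "{w 0 1, w 0 2, w 1 2}"] by auto
  have b0: "b \<noteq> 0" by (rule not_mem_nonzero[OF prime b(1)])
  obtain a1 where a1: "w 0 1 = to_fract a1 / to_fract b" using b(2)[of "w 0 1"] by blast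
  obtain a2 where a2: "w 0 2 = to_fract a2 / to_fract b" using b(2)[of "w 0 2"] by blast
  obtain a3 where a3: "w 1 2 = to_fract a3 / to_fract b" using b(2)[of "w 1 2"] by blast
  have wd: "w 0 0 = 0" "w 1 1 = 0" "w 2 2 = 0" using alternatingD(2)[OF w(1)] by auto
  have wm: "w 1 0 = - w 0 1" "w 2 0 = - w 0 2" "w 2 1 = - w 1 2"
    by (rule alternatingD(1)[OF w(1)])+
  \<comment> \<open>Since \<open>\<alpha> i = V' i / Y i\<close> and \<open>Y i = U i * Z / X\<close>, the entry \<open>w i j\<close> is multiplied by \<open>Z * U i * U j\<close>
    up to a common denominator. So the matrix stays alternating.\<close>
  have clear: "b * X ^ 2 * V' i = Z * U i * (p * U j * F j + q * U j' * F j')"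
    if i: "i < 3" and eq: "\<alpha> i = to_fract p / to_fract b * \<phi> j + to_fract q / to_fract b * \<phi> j'" for i j j' p q
  proof -
    have "to_fract (V' i) = to_fract (Y i) * \<alpha> i" using Y0[of i] by (simp add: \<alpha>_def)
    also have "\<dots> = to_fract (Y i) * to_fract (p * U j * F j + q * U j' * F j') / (to_fract b * to_fract X)"
      unfolding eq \<phi>_def using b0 X0 by (simp add: field_simps)
    finally have "to_fract (V' i) * (to_fract b * to_fract X) = to_fract (Y i) * to_fract (p * U j * F j + q * U j' * F j')"
      using b0 X0 by (simp only: nonzero_eq_divide_eq to_fract_eq_0_iff mult_eq_0_iff simp_thms)
    then have "to_fract (V' i * (b * X)) = to_fract (Y i * (p * U j * F j + q * U j' * F j'))"
      by (simp only: to_fract_mult)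
    then have 1: "V' i * (b * X) = Y i * (p * U j * F j + q * U j' * F j')" by (simp only: to_fract_eq_iff)
    have "b * X ^ 2 * V' i = X * (V' i * (b * X))" by (simp add: power2_eq_square mult_ac)
    also have "\<dots> = (U i * Z) * (p * U j * F j + q * U j' * F j')" unfolding 1 UZ[OF i] by (simp only: mult.assoc)
    finally show ?thesis by (simp only: mult_ac)
  qed
  have Fs: "F 0 = f1" "F 1 = f2" "F 2 = f3" by (simp_all add: F_def)
  have "\<alpha> 0 = to_fract a1 / to_fract b * \<phi> 1 + to_fract a2 / to_fract b * \<phi> 2"
    using w(2)[of 0, unfolded sum3 wd a1 a2] by simp
  from clear[OF _ this] have row0: "b * X ^ 2 * V' 0 = Z * U 0 * (a1 * U 1 * f2 + a2 * U 2 * f3)"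
    unfolding Fs by simp
  have "\<alpha> 1 = to_fract (- a1) / to_fract b * \<phi> 0 + to_fract a3 / to_fract b * \<phi> 2"
    using w(2)[of 1, unfolded sum3 wd wm a1 a3] by simp
  from clear[OF _ this] have row1: "b * X ^ 2 * V' 1 = Z * U 1 * (- a1 * U 0 * f1 + a3 * U 2 * f3)"
    unfolding Fs by simp
  have "\<alpha> 2 = to_fract (- a2) / to_fract b * \<phi> 0 + to_fract (- a3) / to_fract b * \<phi> 1"
    using w(2)[of 2, unfolded sum3 wd wm a2 a3] by simp
  from clear[OF _ this] have row2: "b * X ^ 2 * V' 2 = Z * U 2 * (- a2 * U 0 * f1 + - a3 * U 1 * f2)"
    unfolding Fs by simp
  have "koszul_with (Z * U 0 * U 1 * a1) (Z * U 0 * U 2 * a2) (Z * U 1 * U 2 * a3)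
      (b * X ^ 2 * V' 0) (b * X ^ 2 * V' 1) (b * X ^ 2 * V' 2)"
    unfolding koszul_with_def row0 row1 row2 by (simp add: algebra_simps)
  then have "koszul (b * X ^ 2 * V' 0) (b * X ^ 2 * V' 1) (b * X ^ 2 * V' 2)" by (rule koszulI)
  then have "koszul ((b * X ^ 2 * m ^ N) * v1) ((b * X ^ 2 * m ^ N) * v2) ((b * X ^ 2 * m ^ N) * v3)"
    by (simp add: V'_def V_def mult.assoc)
  moreover have "b * X ^ 2 * m ^ N \<notin> P"
    by (intro prime_ideal_not_mem_mult prime_ideal_not_mem_power prime b(1) XP mP)
  ultimately show ?thesis by blast
qed

text \<open>The polynomials that multiply \<open>v\<close> into the Koszul syzygies form a homogeneous ideal \<open>Q\<close>, which contains
  \<open>f1, f2, f3\<close>. If it contained no power of \<open>x * y\<close>, it would vanish at some point, a base point; but there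
  \<open>v\<close> is a Koszul syzygy locally.\<close>

lemma koszul_after_variable_power:
  assumes lci: "local_complete_intersection I"
    and tw: "twisted v1 v2 v3 k k'" and syz: "v1 * f1 + v2 * f2 + v3 * f3 = 0"
    and sat: "v1 \<in> saturation I" "v2 \<in> saturation I" "v3 \<in> saturation I"
    and xy: "x \<in> {Var_s, Var_u}" "y \<in> {Var_t, Var_v}"
  shows "\<exists>N. koszul ((var x * var y) ^ N * v1) ((var x * var y) ^ N * v2) ((var x * var y) ^ N * v3)"
proof (rule ccontr)
  assume no: "\<not> ?thesis"
  define Q where "Q = {r. koszul (r * v1) (r * v2) (r * v3)}"
  have "ideal.subspace Q"
  proof (rule idealI)
    show "0 \<in> Q" using koszul_0 by (simp add: Q_def)
    show "a + b \<in> Q" if "a \<in> Q" "b \<in> Q" for a b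
      using that koszul_add[of "a * v1" "a * v2" "a * v3" "b * v1" "b * v2" "b * v3"]
      by (simp add: Q_def distrib_right)
    show "r * a \<in> Q" if "a \<in> Q" for r a
      using that koszul_scale[of "a * v1" "a * v2" "a * v3" r] by (simp add: Q_def mult.assoc)
  qed
  moreover have "homogeneous Q"
    unfolding homogeneous_def
  proof (intro ballI allI)
    fix r and d :: "int \<times> int" assume r: "r \<in> Q"
    obtain l l' where d: "d = (l, l')" by (cases d)
    obtain c1 c2 c3 where "koszul_with c1 c2 c3 (r * v1) (r * v2) (r * v3)"
      using r unfolding Q_def koszul_def by blast
    from koszulI[OF koszul_with_component[OF this, of "l + k" "l' + k'"]]
    have *: "koszul (component (l + k - d1, l' + k' - d1') (r * v1)) (component (l + k - d2, l' + k' - d2') (r * v2))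
        (component (l + k - d3, l' + k' - d3') (r * v3))" .
    have c: "component (l + k - e, l' + k' - e') (r * v) = component d r * v" if "v \<in> bihom (k - e) (k' - e')" for v e e'
      using component_mult_bihom[OF that, of "l + k - e" "l' + k' - e'" r] by (simp add: d mult.commute)
    show "component d r \<in> Q" using * tw by (simp add: Q_def twisted_def c)
  qed
  moreover have "(var x * var y) ^ n \<notin> Q" for n using no by (simp add: Q_def)
  ultimately obtain P where P: "prime_ideal P" "homogeneous P" "Q \<subseteq> P" "var x * var y \<notin> P"
    by (rule homogeneous_prime_avoiding)
  have pt: "P \<in> points"
    using P bihom_ideal_iff_homogeneous[OF prime_idealD(1)[OF P(1)]] var_product_irrelevant[OF xy]
    by (auto simp: points_def)
  have e1: "f1 * v1 = - (v2 * f2) - v3 * f3" and e2: "f2 * v2 = - (v1 * f1) - v3 * f3"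
    and e3: "f3 * v3 = - (v1 * f1) - v2 * f2"
    using syz by (simp_all add: algebra_simps eq_neg_iff_add_eq_0)
  have "koszul (f1 * v1) (f1 * v2) (f1 * v3)"
    by (rule koszulI[of "- v2" "- v3" 0]) (simp add: koszul_with_def e1 mult.commute)
  moreover have "koszul (f2 * v1) (f2 * v2) (f2 * v3)"
    by (rule koszulI[of v1 0 "- v3"]) (simp add: koszul_with_def e2 mult.commute)
  moreover have "koszul (f3 * v1) (f3 * v2) (f3 * v3)"
    by (rule koszulI[of 0 v1 v2]) (simp add: koszul_with_def e3 mult.commute)
  ultimately have "{f1, f2, f3} \<subseteq> P" using P(3) by (auto simp: Q_def)
  then have "I \<subseteq> P" by (rule ideal.span_minimal[OF _ prime_idealD(1)[OF P(1)]])
  then have "P \<in> base_points I" using pt by (simp add: base_points_def)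
  from locally_koszul[OF lci this tw syz sat] obtain b where "b \<notin> P" "b \<in> Q" by (auto simp: Q_def)
  then show False using P(3) by blast
qed

lemma complete_intersection_imp_agree:
  assumes lci: "local_complete_intersection I"
  shows syzygies_agree
  unfolding syzygies_agree_def
proof (intro allI impI)
  fix k k' :: int
  assume deg: "(k - (d1 + d2 + d3) + 1) * (k' - (d1' + d2' + d3') + 1) \<ge> 0"
  have "(v1, v2, v3) \<in> koszul_syzygies f1 f2 f3 \<longleftrightarrow> (v1, v2, v3) \<in> vanishing_syzygies f1 f2 f3"
    if tw: "twisted v1 v2 v3 k k'" for v1 v2 v3
    unfolding mem_koszul_syzygies mem_vanishing_syzygies
  proof
    assume "koszul v1 v2 v3"
    then obtain c1 c2 c3 where c: "koszul_with c1 c2 c3 v1 v2 v3" unfolding koszul_def by (elim exE) (rule that)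
    have "v1 * f1 + v2 * f2 + v3 * f3 = 0"
      using c unfolding koszul_with_def by (elim conjE, hypsubst) (simp add: algebra_simps)
    moreover have "v1 = 0 * f1 + c1 * f2 + c2 * f3" "v2 = (- c1) * f1 + 0 * f2 + c3 * f3"
      "v3 = (- c2) * f1 + (- c3) * f2 + 0 * f3" using c by (simp_all add: koszul_with_def)
    then have "v1 \<in> I" "v2 \<in> I" "v3 \<in> I" using mem_span3 by blast+
    ultimately show "v1 * f1 + v2 * f2 + v3 * f3 = 0 \<and> v1 \<in> saturation I \<and> v2 \<in> saturation I \<and> v3 \<in> saturation I"
      using I_subset_saturation by blast
  next
    assume v: "v1 * f1 + v2 * f2 + v3 * f3 = 0 \<and> v1 \<in> saturation I \<and> v2 \<in> saturation I \<and> v3 \<in> saturation I"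
    define kp where "kp x y N \<longleftrightarrow> koszul ((var x * var y) ^ N * v1) ((var x * var y) ^ N * v2) ((var x * var y) ^ N * v3)" for x y N
    have "\<exists>N. kp x y N" if "x \<in> {Var_s, Var_u}" "y \<in> {Var_t, Var_v}" for x y
      unfolding kp_def using koszul_after_variable_power[OF lci tw _ _ _ _ that] v by blast
    then obtain n where n: "\<And>x y. x \<in> {Var_s, Var_u} \<Longrightarrow> y \<in> {Var_t, Var_v} \<Longrightarrow> kp x y (n x y)" by metis
    define N where "N = n Var_s Var_t + n Var_s Var_v + n Var_u Var_t + n Var_u Var_v"
    have mono: "kp x y N'" if "kp x y M" "M \<le> N'" for x y M N'
    proof -
      have pw: "(var x * var y) ^ N' * v = (var x * var y) ^ (N' - M) * ((var x * var y) ^ M * v)" for v :: "'k bipoly"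
        using that(2) by (simp only: mult.assoc[symmetric] power_add[symmetric]) simp
      show ?thesis unfolding kp_def pw by (rule koszul_scale[OF that(1)[unfolded kp_def]])
    qed
    show "koszul v1 v2 v3"
    proof (rule koszul_saturated[OF tw _ deg])
      fix x y assume xy: "x \<in> {Var_s, Var_u}" "y \<in> {Var_t, Var_v}"
      have "n x y \<le> N" using xy by (auto simp: N_def)
      from mono[OF n[OF xy] this]
      show "koszul (var x ^ N * (var y ^ N * v1)) (var x ^ N * (var y ^ N * v2)) (var x ^ N * (var y ^ N * v3))"
        by (simp add: kp_def power_mult_distrib mult.assoc)
    qed
  qed
  note * = this
  show "koszul_syzygies f1 f2 f3 \<inter> twisted_piece (d1, d1') (d2, d2') (d3, d3') k k' =
      vanishing_syzygies f1 f2 f3 \<inter> twisted_piece (d1, d1') (d2, d2') (d3, d3') k k'"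
  proof (rule Set.set_eqI)
    fix v :: "'k bipoly3"
    obtain v1 v2 v3 where "v = (v1, v2, v3)" by (cases v)
    then show "v \<in> koszul_syzygies f1 f2 f3 \<inter> twisted_piece (d1, d1') (d2, d2') (d3, d3') k k' \<longleftrightarrow>
      v \<in> vanishing_syzygies f1 f2 f3 \<inter> twisted_piece (d1, d1') (d2, d2') (d3, d3') k k'"
      using *[of v1 v2 v3] unfolding Int_iff mem_twisted_piece by (auto simp: mem_twisted_piece)
  qed
qed

end

theorem corollary3p15:
  fixes f1 f2 f3 :: "'k::field bipoly"
    and d1 d2 d3 d1' d2' d3' :: int
  assumes "f1 \<in> bihom d1 d1'" and "f2 \<in> bihom d2 d2'" and "f3 \<in> bihom d3 d3'"
    and "codimension (ideal.span {f1, f2, f3}) = 2"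
  shows "(\<forall>k k' :: int.
            (k - (d1 + d2 + d3) + 1) * (k' - (d1' + d2' + d3') + 1) \<ge> 0 \<longrightarrow>
            koszul_syzygies f1 f2 f3 \<inter> twisted_piece (d1, d1') (d2, d2') (d3, d3') k k' =
            vanishing_syzygies f1 f2 f3 \<inter> twisted_piece (d1, d1') (d2, d2') (d3, d3') k k')
         \<longleftrightarrow> local_complete_intersection (ideal.span {f1, f2, f3})"
proof -
  interpret bihom_triple f1 f2 f3 d1 d2 d3 d1' d2' d3'
    by unfold_locales (use assms codimension_two_no_common_prime[OF assms(4)] in auto)
  show ?thesis
    using agree_imp_complete_intersection complete_intersection_imp_agree
    unfolding syzygies_agree_def by blast
qed


end
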